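(* Assume that $$c_0 > 3\alpha_m,\qquad C_d > 3\alpha_m\theta_0,$$ and $$L \ge 2\delta \quad\text{for some } \delta \ge \tfrac12 .$$ For a fixed $n+1$, assume that the FS-HF solution at time step $n+1$ (defined in the context) is initialized to the M-HF solution at time step $n$ (defined in the context), i.e. $$\boldsymbol{u}_h^{n+1,0}=\boldsymbol{u}_h^{n},\qquad p_h^{n+1,0}=p_h^{n},\qquad \theta_h^{n+1,0}=\theta_h^{n}.$$ Then the FS-HF solution converges to the solution of the M-HF method: $$\|\boldsymbol{u}_h^{n+1,i}-\boldsymbol{u}_h^{n+1}\|_1\to 0,\qquad \|p_h^{n+1,i}-p_h^{n+1}\|\to 0,\qquad \|\theta_h^{n+1,i}-\theta_h^{n+1}\|\to 0$$ as $i\to\infty$.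
   Context: Setting. $\Omega\subset\mathbb{R}^d$, $d\in\{2,3\}$, is a bounded connected Lipschitz domain; $(\cdot,\cdot)$ and $\|\cdot\|$ are the $L^2(\Omega)$ inner product and norm (for scalar, vector or tensor fields), and $\|\cdot\|_1$ is the full $H^1(\Omega)$-norm. $\varepsilon(\boldsymbol{v})=\frac12(\nabla\boldsymbol{v}+(\nabla\boldsymbol{v})^T)$. The unknowns are the displacement $\boldsymbol{u}$, the fluid pressure $p$ and the temperature $\theta$ of a linear thermo-poroelasticity model with homogeneous Dirichlet boundary conditions for all three variables. Parameters. The Lamé constants satisfy $\mu\in[\mu_0,\mu_1]$ with $0<\mu_0<\mu_1<\infty$ and $\lambda\in[0,\infty)$; $K_{dr}=(d\lambda+2\mu)/d$ is the drained isothermal bulk modulus. The physical constants are: $\alpha$, the Biot-Willis constant; $c_0=1/M$, where $M$ is Biot's modulus; $\alpha_T$, the volumetric skeleton thermal dilation coefficient; $3\alpha_m$, the thermal dilation coefficient; $C_d$, the effective total heat conductivity; and $\theta_0$, a reference temperature, assumed to be nonzero. $L>0$ is a stabilization coefficient. The permeability tensor $\boldsymbol{K}$ and the bulk thermal conductivity tensor $\boldsymbol{D}$ are symmetric $d\times d$ tensors on $\Omega$, and there are positive constants $k_{\min},k_{\max},d_{\min},d_{\max}$ with $k_{\min}\xi^T\xi\le \xi^T\boldsymbol{K}(x)\xi\le k_{\max}\xi^T\xi$ and $d_{\min}\xi^T\xi\le \xi^T\boldsymbol{D}(x)\xi\le d_{\max}\xi^T\xi$ for all $x\in\Omega$, $\xi\in\mathbb{R}^d$.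 $\Delta t>0$ is the time step, $t^n=n\Delta t$, $n=0,\dots,N$, $t^N=T$. The body force $\mathbf{f}$, the fluid source $g$ and the heat source $\eta$ are given, and $\mathbf{f}^{n+1},g^{n+1},\eta^{n+1}$ are their values at $t^{n+1}$. $\boldsymbol{V}_h,W_h,\Theta_h$ are finite-dimensional (continuous Galerkin finite element) subspaces of $[H^1_0(\Omega)]^d$, $H^1_0(\Omega)$, $H^1_0(\Omega)$, respectively, on a shape-regular triangulation of $\Omega$. M-HF (monolithic high-fidelity) method. Given $(\boldsymbol{u}_h^n,p_h^n,\theta_h^n)\in\boldsymbol{V}_h\times W_h\times\Theta_h$, the M-HF solution at step $n+1$ is $(\boldsymbol{u}_h^{n+1},p_h^{n+1},\theta_h^{n+1})\in\boldsymbol{V}_h\times W_h\times\Theta_h$ such that for all $(\boldsymbol{v},w,s)\in\boldsymbol{V}_h\times W_h\times\Theta_h$: $$2\mu(\varepsilon(\boldsymbol{u}_h^{n+1}),\varepsilon(\boldsymbol{v}))+\lambda(\nabla\cdot\boldsymbol{u}_h^{n+1},\nabla\cdot\boldsymbol{v})-\alpha(p_h^{n+1},\nabla\cdot\boldsymbol{v})-3\alpha_TK_{dr}(\theta_h^{n+1},\nabla\cdot\boldsymbol{v})=(\mathbf{f}^{n+1},\boldsymbol{v}),$$ $$c_0\Big(\tfrac{p_h^{n+1}-p_h^n}{\Delta t},w\Big)+\alpha\Big(\tfrac{\nabla\cdot\boldsymbol{u}_h^{n+1}-\nabla\cdot\boldsymbol{u}_h^n}{\Delta t},w\Big)-3\alpha_m\Big(\tfrac{\theta_h^{n+1}-\theta_h^n}{\Delta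 t},w\Big)+(\boldsymbol{K}\nabla p_h^{n+1},\nabla w)=(g^{n+1},w),$$ $$C_d\Big(\tfrac{\theta_h^{n+1}-\theta_h^n}{\Delta t},s\Big)+3\alpha_TK_{dr}\theta_0\Big(\tfrac{\nabla\cdot\boldsymbol{u}_h^{n+1}-\nabla\cdot\boldsymbol{u}_h^n}{\Delta t},s\Big)-3\alpha_m\theta_0\Big(\tfrac{p_h^{n+1}-p_h^n}{\Delta t},s\Big)+(\boldsymbol{D}\nabla\theta_h^{n+1},\nabla s)=(\eta^{n+1},s).$$ FS-HF (fixed-stress high-fidelity) iteration at time step $n+1$. With the same $(\boldsymbol{u}_h^n,p_h^n,\theta_h^n)$ and an initialization $(\boldsymbol{u}_h^{n+1,0},p_h^{n+1,0},\theta_h^{n+1,0})\in\boldsymbol{V}_h\times W_h\times\Theta_h$, for $i=0,1,2,\dots$: Step 1: find $p_h^{n+1,i+1}\in W_h$ such that for all $w\in W_h$ $$c_0\Big(\tfrac{p_h^{n+1,i+1}-p_h^n}{\Delta t},w\Big)+(\boldsymbol{K}\nabla p_h^{n+1,i+1},\nabla w)+L\tfrac{\alpha^2}{K_{dr}}\Big(\tfrac{p_h^{n+1,i+1}-p_h^{n+1,i}}{\Delta t},w\Big)=(g^{n+1},w)-\alpha\Big(\nabla\cdot\tfrac{\boldsymbol{u}_h^{n+1,i}-\boldsymbol{u}_h^n}{\Delta t},w\Big)+3\alpha_m\Big(\tfrac{\theta_h^{n+1,i}-\theta_h^n}{\Delta t},w\Big).$$ Step 2: find $\theta_h^{n+1,i+1}\in\Theta_h$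 such that for all $s\in\Theta_h$ $$C_d\Big(\tfrac{\theta_h^{n+1,i+1}-\theta_h^n}{\Delta t},s\Big)+(\boldsymbol{D}\nabla\theta_h^{n+1,i+1},\nabla s)+9L\alpha_T^2K_{dr}\theta_0\Big(\tfrac{\theta_h^{n+1,i+1}-\theta_h^{n+1,i}}{\Delta t},s\Big)=(\eta^{n+1},s)+3\alpha_m\theta_0\Big(\tfrac{p_h^{n+1,i}-p_h^n}{\Delta t},s\Big)-3\alpha_TK_{dr}\theta_0\Big(\nabla\cdot\tfrac{\boldsymbol{u}_h^{n+1,i}-\boldsymbol{u}_h^n}{\Delta t},s\Big).$$ Step 3: find $\boldsymbol{u}_h^{n+1,i+1}\in\boldsymbol{V}_h$ such that for all $\boldsymbol{v}\in\boldsymbol{V}_h$ $$2\mu(\varepsilon(\boldsymbol{u}_h^{n+1,i+1}),\varepsilon(\boldsymbol{v}))+\lambda(\nabla\cdot\boldsymbol{u}_h^{n+1,i+1},\nabla\cdot\boldsymbol{v})=(\mathbf{f}^{n+1},\boldsymbol{v})+\alpha(p_h^{n+1,i+1},\nabla\cdot\boldsymbol{v})+3\alpha_TK_{dr}(\theta_h^{n+1,i+1},\nabla\cdot\boldsymbol{v}).$$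
   Formalization: The formal theorem additionally assumes α_m ≥ 0 and a positive reference temperature θ_0; without these signs the iteration can diverge or be singular (e.g. α=α_T=0, c_0=C_d=θ_0=1, 3α_m=−30, small Δt). *)

theory Defs
  imports "HOL-Analysis.Analysis"
begin

text \<open>The graph of \<open>\<gamma>\<close> lives over the hyperplane orthogonal to the unit vector \<open>\<nu>\<close>, which plays the
  role of \<open>\<real>\<^sup>d\<^sup>-\<^sup>1\<close>; \<open>x - (x \<bullet> \<nu>) *\<^sub>R \<nu>\<close> is the orthogonal projection of \<open>x\<close> onto it.\<close>

definition bounded_lipschitz_domain :: "(real ^ 'd) set \<Rightarrow> bool" where
  "bounded_lipschitz_domain \<Omega> \<longleftrightarrow>
     open \<Omega> \<and> connected \<Omega> \<and> \<Omega> \<noteq> {} \<and> bounded \<Omega> \<and>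
     (\<forall>x0 \<in> frontier \<Omega>. \<exists>r > 0. \<exists>\<nu> \<gamma> C. norm \<nu> = 1 \<and> C-lipschitz_on {y. y \<bullet> \<nu> = 0} \<gamma> \<and>
        \<Omega> \<inter> ball x0 r = {x \<in> ball x0 r. \<gamma> (x - (x \<bullet> \<nu>) *\<^sub>R \<nu>) < x \<bullet> \<nu>})"


subsection \<open>Square-integrable fields\<close>

text \<open>Fields are total functions of which only the values on \<open>\<Omega>\<close> matter. The value type is \<open>\<real>\<close>,
  \<open>\<real>\<^sup>d\<close> or the \<open>d \<times> d\<close> matrices; on matrices \<open>\<bullet>\<close> is the Frobenius inner product.\<close>

definition L2_fields :: "(real ^ 'd) set \<Rightarrow> (real ^ 'd \<Rightarrow> 'b::euclidean_space) set" where
  "L2_fields \<Omega> = {f. f \<in> borel_measurable (lebesgue_on \<Omega>) \<and>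
                     integrable (lebesgue_on \<Omega>) (\<lambda>x. (norm (f x))\<^sup>2)}"

definition L2_inner ::
  "(real ^ 'd) set \<Rightarrow> (real ^ 'd \<Rightarrow> 'b::euclidean_space) \<Rightarrow> (real ^ 'd \<Rightarrow> 'b) \<Rightarrow> real" where
  "L2_inner \<Omega> f g = (LINT x | lebesgue_on \<Omega>. f x \<bullet> g x)"

definition L2_norm :: "(real ^ 'd) set \<Rightarrow> (real ^ 'd \<Rightarrow> 'b::euclidean_space) \<Rightarrow> real" where
  "L2_norm \<Omega> f = sqrt (L2_inner \<Omega> f f)"


subsection \<open>Test functions and weak derivatives\<close>

definition partial_deriv :: "'d \<Rightarrow> (real ^ 'd \<Rightarrow> real) \<Rightarrow> real ^ 'd \<Rightarrow> real" where
  "partial_deriv j f x = frechet_derivative f (at x) (axis j 1)"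

primrec Ck_fun :: "nat \<Rightarrow> (real ^ 'd \<Rightarrow> real) \<Rightarrow> bool" where
  "Ck_fun 0 f = continuous_on UNIV f"
| "Ck_fun (Suc k) f = (f differentiable_on UNIV \<and> (\<forall>j. Ck_fun k (partial_deriv j f)))"

definition test_functions :: "(real ^ 'd) set \<Rightarrow> (real ^ 'd \<Rightarrow> real) set" where
  "test_functions \<Omega> = {\<phi>. (\<forall>k. Ck_fun k \<phi>) \<and>
                          compact (closure {x. \<phi> x \<noteq> 0}) \<and> closure {x. \<phi> x \<noteq> 0} \<subseteq> \<Omega>}"

definition has_weak_gradient ::
  "(real ^ 'd) set \<Rightarrow> (real ^ 'd \<Rightarrow> real) \<Rightarrow> (real ^ 'd \<Rightarrow> real ^ 'd) \<Rightarrow> bool" where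
  "has_weak_gradient \<Omega> f G \<longleftrightarrow> G \<in> L2_fields \<Omega> \<and>
     (\<forall>\<phi> \<in> test_functions \<Omega>. \<forall>j.
        (LINT x | lebesgue_on \<Omega>. f x * partial_deriv j \<phi> x) =
        - (LINT x | lebesgue_on \<Omega>. G x $ j * \<phi> x))"

text \<open>The weak gradient is unique up to a null set; \<open>wgrad\<close> picks one representative
  and is meaningful on \<open>H1\<close> only.\<close>

definition wgrad :: "(real ^ 'd) set \<Rightarrow> (real ^ 'd \<Rightarrow> real) \<Rightarrow> real ^ 'd \<Rightarrow> real ^ 'd" where
  "wgrad \<Omega> f = (SOME G. has_weak_gradient \<Omega> f G)"

definition wjac :: "(real ^ 'd) set \<Rightarrow> (real ^ 'd \<Rightarrow> real ^ 'd) \<Rightarrow> real ^ 'd \<Rightarrow> real ^ 'd ^ 'd" where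
  "wjac \<Omega> v x = (\<chi> j. wgrad \<Omega> (\<lambda>y. v y $ j) x)"

definition wdiv :: "(real ^ 'd) set \<Rightarrow> (real ^ 'd \<Rightarrow> real ^ 'd) \<Rightarrow> real ^ 'd \<Rightarrow> real" where
  "wdiv \<Omega> v x = trace (wjac \<Omega> v x)"

definition strain :: "(real ^ 'd) set \<Rightarrow> (real ^ 'd \<Rightarrow> real ^ 'd) \<Rightarrow> real ^ 'd \<Rightarrow> real ^ 'd ^ 'd" where
  "strain \<Omega> v x = (1 / 2) *\<^sub>R (wjac \<Omega> v x + transpose (wjac \<Omega> v x))"


subsection \<open>Sobolev spaces\<close>

definition H1 :: "(real ^ 'd) set \<Rightarrow> (real ^ 'd \<Rightarrow> real) set" where
  "H1 \<Omega> = {f \<in> L2_fields \<Omega>. \<exists>G. has_weak_gradient \<Omega> f G}"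

definition H1_norm :: "(real ^ 'd) set \<Rightarrow> (real ^ 'd \<Rightarrow> real) \<Rightarrow> real" where
  "H1_norm \<Omega> f = sqrt ((L2_norm \<Omega> f)\<^sup>2 + (L2_norm \<Omega> (wgrad \<Omega> f))\<^sup>2)"

definition H1_norm_vec :: "(real ^ 'd) set \<Rightarrow> (real ^ 'd \<Rightarrow> real ^ 'd) \<Rightarrow> real" where
  "H1_norm_vec \<Omega> v = sqrt ((L2_norm \<Omega> v)\<^sup>2 + (L2_norm \<Omega> (wjac \<Omega> v))\<^sup>2)"

text \<open>\<open>H10\<close> is the closure of the test functions in \<open>H1\<close>.\<close>

definition H10 :: "(real ^ 'd) set \<Rightarrow> (real ^ 'd \<Rightarrow> real) set" where
  "H10 \<Omega> = {f \<in> H1 \<Omega>. \<exists>\<phi> :: nat \<Rightarrow> real ^ 'd \<Rightarrow> real. (\<forall>k. \<phi> k \<in> test_functions \<Omega>) \<and>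
               (\<lambda>k. H1_norm \<Omega> (\<lambda>x. f x - \<phi> k x)) \<longlonglongrightarrow> 0}"

definition H10_vec :: "(real ^ 'd) set \<Rightarrow> (real ^ 'd \<Rightarrow> real ^ 'd) set" where
  "H10_vec \<Omega> = {v. \<forall>j. (\<lambda>x. v x $ j) \<in> H10 \<Omega>}"

text \<open>Function types carry no \<open>real_vector\<close> instance, so spans are written out.\<close>

definition fin_dim_fun_space :: "('a \<Rightarrow> 'b::real_vector) set \<Rightarrow> bool" where
  "fin_dim_fun_space S \<longleftrightarrow>
     (\<exists>B. finite B \<and> S = {f. \<exists>c :: ('a \<Rightarrow> 'b) \<Rightarrow> real. f = (\<lambda>x. \<Sum>b\<in>B. c b *\<^sub>R b x)})"


subsection \<open>Coefficient tensors\<close>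

definition elliptic_tensor ::
  "(real ^ 'd) set \<Rightarrow> (real ^ 'd \<Rightarrow> real ^ 'd ^ 'd) \<Rightarrow> real \<Rightarrow> real \<Rightarrow> bool" where
  "elliptic_tensor \<Omega> A amin amax \<longleftrightarrow>
     A \<in> borel_measurable (lebesgue_on \<Omega>) \<and> 0 < amin \<and> 0 < amax \<and>
     (\<forall>x \<in> \<Omega>. transpose (A x) = A x \<and>
        (\<forall>\<xi>. amin * (\<xi> \<bullet> \<xi>) \<le> \<xi> \<bullet> (A x *v \<xi>) \<and> \<xi> \<bullet> (A x *v \<xi>) \<le> amax * (\<xi> \<bullet> \<xi>)))"

end

theory Submission
  imports Defs
begin

text \<open>The displacement error is determined by the pressure and temperature errors \<open>z\<^sub>i\<close> once one
  iteration has been made. Let \<open>G\<close> be the sum of the mass, diffusion and stabilisation forms, and \<open>H\<close>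
  the form of the monolithic problem after elimination of the displacement, both with the temperature
  equation divided by \<open>\<theta>\<^sub>0\<close> to make them symmetric. The errors satisfy
  \<open>G(z\<^sub>i\<^sub>+\<^sub>1 - z\<^sub>i, w) = - H(z\<^sub>i, w)\<close> for all \<open>w\<close>, whence
  \<open>H(z\<^sub>i, z\<^sub>i) - H(z\<^sub>i\<^sub>+\<^sub>1, z\<^sub>i\<^sub>+\<^sub>1) = (2 G - H)(z\<^sub>i\<^sub>+\<^sub>1 - z\<^sub>i, z\<^sub>i\<^sub>+\<^sub>1 - z\<^sub>i)\<close>.
  The assumptions on the coefficients and \<open>L \<ge> 1\<close> make both \<open>H\<close> and \<open>2 G - H\<close> dominate a multiple of
  \<open>G\<close>, so \<open>H(z\<^sub>i, z\<^sub>i)\<close> decreases, its increments and hence \<open>G(z\<^sub>i\<^sub>+\<^sub>1 - z\<^sub>i, z\<^sub>i\<^sub>+\<^sub>1 - z\<^sub>i)\<close> tend to 0, and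
  the error equation forces \<open>H(z\<^sub>i, z\<^sub>i)\<close> itself to 0. This controls the \<open>L\<^sup>2\<close> norms of the pressure and
  temperature errors and the elastic energy of the displacement error; Korn's and Poincare's
  inequalities bound the \<open>H\<^sup>1\<close> norm by that energy. Weak gradients are additive only up to null sets,
  which rests on the fundamental lemma of the calculus of variations.\<close>

section \<open>Symmetric positive semidefinite forms\<close>

text \<open>No smallness of the coupling is available, so its sign has to be used. Once the
  displacement is eliminated, the two coupling terms together equal the elastic form of the
  displacement errors. This term helps in \<open>H\<close> and costs something only in
  \<open>2 G - H\<close>. There Young's inequality with weight \<open>Kdr\<close> bounds the elastic
  energy by \<open>2 / Kdr\<close> times \<open>\<alpha>\<close> squared times the squared pressure
  norm plus \<open>\<beta>\<close> squared times the squared temperature norm, where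
  \<open>\<beta> = 3 * \<alpha>T * Kdr\<close>. The stabilisation, doubled in
  \<open>2 G - H\<close>, covers this bound as soon as \<open>L \<ge> 1\<close>, which is what
  \<open>L \<ge> 2 * \<delta>\<close> and \<open>\<delta> \<ge> 1 / 2\<close> give. The
  pressure-temperature term is indefinite; it is absorbed by the masses \<open>c0\<close> and
  \<open>Cd / \<theta>0\<close>, both larger than \<open>3 * \<alpha>m\<close>. Small increments
  imply small errors because testing with \<open>z = z_i\<close> gives
  \<open>G(d, z) = - H(z, z)\<close> for the increment \<open>d\<close>; nonnegativity of
  \<open>G\<close> at \<open>z + c d\<close> with a suitable \<open>c\<close> then bounds
  \<open>H(z, z)\<close> by a multiple of \<open>G(d, d)\<close>. Korn's inequality rests on an
  identity for zero boundary values: twice the squared strain norm is the squared gradient norm plus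
  the squared divergence norm.\<close>

text \<open>Function types carry no \<open>real_vector\<close> instance, so subspaces and forms are relative to a carrier.\<close>

locale sym_form =
  fixes X :: "('a \<Rightarrow> 'b::real_vector) set" and B :: "('a \<Rightarrow> 'b) \<Rightarrow> ('a \<Rightarrow> 'b) \<Rightarrow> real"
  assumes lincomb: "\<And>f g a b. f \<in> X \<Longrightarrow> g \<in> X \<Longrightarrow> (\<lambda>x. a *\<^sub>R f x + b *\<^sub>R g x) \<in> X"
    and sym: "\<And>f g. f \<in> X \<Longrightarrow> g \<in> X \<Longrightarrow> B f g = B g f"
    and lin: "\<And>f g h a b. f \<in> X \<Longrightarrow> g \<in> X \<Longrightarrow> h \<in> X \<Longrightarrow>
      B (\<lambda>x. a *\<^sub>R f x + b *\<^sub>R g x) h = a * B f h + b * B g h"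
    and nonneg: "\<And>f. f \<in> X \<Longrightarrow> 0 \<le> B f f"
begin

lemma diff_mem: "f \<in> X \<Longrightarrow> g \<in> X \<Longrightarrow> (\<lambda>x. f x - g x) \<in> X"
  using lincomb[of f g 1 "-1"] by simp

lemma lin_right:
  assumes "f \<in> X" "g \<in> X" "h \<in> X"
  shows "B h (\<lambda>x. a *\<^sub>R f x + b *\<^sub>R g x) = a * B h f + b * B h g"
proof -
  have "B h (\<lambda>x. a *\<^sub>R f x + b *\<^sub>R g x) = B (\<lambda>x. a *\<^sub>R f x + b *\<^sub>R g x) h"
    by (intro sym lincomb assms)
  then show ?thesis
    using lin[OF assms] sym assms by simp
qed

lemma diff_left:
  assumes "f \<in> X" "g \<in> X" "h \<in> X"
  shows "B (\<lambda>x. f x - g x) h = B f h - B g h"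
  using lin[OF assms, of 1 "-1"] by simp

lemma diff_right:
  assumes "f \<in> X" "g \<in> X" "h \<in> X"
  shows "B h (\<lambda>x. f x - g x) = B h f - B h g"
  using lin_right[OF assms, of 1 "-1"] by simp

lemma square_lincomb:
  assumes "f \<in> X" "g \<in> X"
  shows "B (\<lambda>x. a *\<^sub>R f x + b *\<^sub>R g x) (\<lambda>x. a *\<^sub>R f x + b *\<^sub>R g x)
    = a\<^sup>2 * B f f + 2 * a * b * B f g + b\<^sup>2 * B g g"
proof -
  have "B g f = B f g" using sym assms by simp
  then show ?thesis
    using assms by (simp add: lin lin_right lincomb power2_eq_square algebra_simps)
qed

lemma square_diff:
  assumes "f \<in> X" "g \<in> X"
  shows "B (\<lambda>x. f x - g x) (\<lambda>x. f x - g x) = B f f - 2 * B f g + B g g"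
  using square_lincomb[OF assms, of 1 "-1"] by simp

lemma two_mult_le:
  assumes "f \<in> X" "g \<in> X"
  shows "2 * \<bar>B f g\<bar> \<le> B f f + B g g"
  using square_lincomb[OF assms, of 1 1] square_lincomb[OF assms, of 1 "-1"]
    nonneg[OF lincomb[OF assms, of 1 1]] nonneg[OF lincomb[OF assms, of 1 "-1"]]
  by simp

lemma square_le_diff:
  assumes "f \<in> X" "g \<in> X"
  shows "B f f \<le> 2 * B (\<lambda>x. f x - g x) (\<lambda>x. f x - g x) + 2 * B g g"
  \<comment> \<open>The gap between the two sides is exactly \<open>B\<close> evaluated at
    \<open>f - 2 g\<close>.\<close>
  using square_lincomb[OF assms, of 1 "-2"] nonneg[OF lincomb[OF assms, of 1 "-2"]]
    square_diff[OF assms] by simp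

lemma Cauchy_Schwarz:
  assumes "f \<in> X" "g \<in> X"
  shows "(B f g)\<^sup>2 \<le> B f f * B g g"
proof (cases "B g g = 0")
  case True
  have "0 \<le> B f f + 2 * b * B f g" for b
    using nonneg[OF lincomb[OF assms, of 1 b]] square_lincomb[OF assms, of 1 b] True by simp
  \<comment> \<open>If \<open>B f g\<close> were nonzero, this \<open>b\<close> would make the
    affine expression equal to \<open>-1\<close>. The case is separate because \<open>B\<close> may
    be degenerate.\<close>
  from this[of "- (B f f + 1) / (2 * B f g)"] have "B f g = 0"
    by (cases "B f g = 0") (auto simp: field_simps)
  then show ?thesis using True by simp
next
  case False
  then have pos: "0 < B g g" using nonneg[OF assms(2)] by simp
  \<comment> \<open>Up to the factor \<open>B g g\<close>, the vector used is the part of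
    \<open>f\<close> that is \<open>B\<close>-orthogonal to \<open>g\<close>; scaling avoids a
    division.\<close>
  have "0 \<le> (B g g)\<^sup>2 * B f f + 2 * B g g * (- B f g) * B f g + (- B f g)\<^sup>2 * B g g"
    using nonneg[OF lincomb[OF assms, of "B g g" "- B f g"]]
      square_lincomb[OF assms, of "B g g" "- B f g"] by simp
  also have "\<dots> = B g g * (B f f * B g g - (B f g)\<^sup>2)"
    by (simp add: power2_eq_square algebra_simps)
  finally show ?thesis
    using pos by (simp add: zero_le_mult_iff)
qed

end

lemma sym_form_scaled_add:
  assumes "sym_form X B" "sym_form X C" "0 \<le> b" "0 \<le> c"
  shows "sym_form X (\<lambda>f g. b * B f g + c * C f g)"
proof -
  interpret B: sym_form X B by fact
  interpret C: sym_form X C by fact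
  show ?thesis
  proof
    fix f g assume "f \<in> X" "g \<in> X"
    then show "b * B f g + c * C f g = b * B g f + c * C g f"
      by (simp add: B.sym C.sym)
  qed (use assms in \<open>auto simp: B.lincomb B.lin C.lin B.nonneg C.nonneg algebra_simps\<close>)
qed


section \<open>Square-integrable fields\<close>

lemma L2_fieldsD:
  assumes "f \<in> L2_fields \<Omega>"
  shows "f \<in> borel_measurable (lebesgue_on \<Omega>)" "integrable (lebesgue_on \<Omega>) (\<lambda>x. (norm (f x))\<^sup>2)"
  using assms by (auto simp: L2_fields_def)

lemma L2_fields_dominated:
  assumes "f \<in> borel_measurable (lebesgue_on \<Omega>)"
    and "integrable (lebesgue_on \<Omega>) g"
    and "\<And>x. x \<in> \<Omega> \<Longrightarrow> (norm (f x))\<^sup>2 \<le> g x"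
  shows "f \<in> L2_fields \<Omega>"
proof -
  have "integrable (lebesgue_on \<Omega>) (\<lambda>x. (norm (f x))\<^sup>2)"
  proof (rule Bochner_Integration.integrable_bound[OF assms(2)])
    show "AE x in lebesgue_on \<Omega>. norm ((norm (f x))\<^sup>2) \<le> norm (g x)"
      using assms(3) by (intro AE_I2) (force simp: space_restrict_space)
  qed (use assms(1) in measurable)
  then show ?thesis using assms(1) by (simp add: L2_fields_def)
qed

lemma L2_inner_integrable:
  assumes "f \<in> L2_fields \<Omega>" "g \<in> L2_fields \<Omega>"
  shows "integrable (lebesgue_on \<Omega>) (\<lambda>x. f x \<bullet> g x)"
proof (rule Bochner_Integration.integrable_bound)
  show "integrable (lebesgue_on \<Omega>) (\<lambda>x. (norm (f x))\<^sup>2 + (norm (g x))\<^sup>2)"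
    using L2_fieldsD[OF assms(1)] L2_fieldsD[OF assms(2)] by simp
  show "(\<lambda>x. f x \<bullet> g x) \<in> borel_measurable (lebesgue_on \<Omega>)"
    using L2_fieldsD(1)[OF assms(1)] L2_fieldsD(1)[OF assms(2)] by measurable
  have "\<bar>f x \<bullet> g x\<bar> \<le> (norm (f x))\<^sup>2 + (norm (g x))\<^sup>2" for x
    using Cauchy_Schwarz_ineq2[of "f x" "g x"] sum_squares_bound[of "norm (f x)" "norm (g x)"]
      zero_le_mult_iff[of "norm (f x)" "norm (g x)"] norm_ge_zero[of "f x"] norm_ge_zero[of "g x"]
    by linarith
  then show "AE x in lebesgue_on \<Omega>. norm (f x \<bullet> g x) \<le> norm ((norm (f x))\<^sup>2 + (norm (g x))\<^sup>2)"
    by simp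
qed

lemma L2_fields_lincomb:
  fixes f g :: "real ^ 'd \<Rightarrow> 'b::euclidean_space"
  assumes "f \<in> L2_fields \<Omega>" "g \<in> L2_fields \<Omega>"
  shows "(\<lambda>x. a *\<^sub>R f x + b *\<^sub>R g x) \<in> L2_fields \<Omega>"
proof (rule L2_fields_dominated)
  show "(\<lambda>x. a *\<^sub>R f x + b *\<^sub>R g x) \<in> borel_measurable (lebesgue_on \<Omega>)"
    using L2_fieldsD(1)[OF assms(1)] L2_fieldsD(1)[OF assms(2)] by measurable
  show "integrable (lebesgue_on \<Omega>) (\<lambda>x. 2 * a\<^sup>2 * (norm (f x))\<^sup>2 + 2 * b\<^sup>2 * (norm (g x))\<^sup>2)"
    using L2_fieldsD[OF assms(1)] L2_fieldsD[OF assms(2)] by simp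
  fix x
  have "norm (a *\<^sub>R f x + b *\<^sub>R g x) \<le> \<bar>a\<bar> * norm (f x) + \<bar>b\<bar> * norm (g x)"
    by (metis norm_scaleR norm_triangle_ineq)
  then have "(norm (a *\<^sub>R f x + b *\<^sub>R g x))\<^sup>2 \<le> (\<bar>a\<bar> * norm (f x) + \<bar>b\<bar> * norm (g x))\<^sup>2"
    by (intro power_mono) auto
  also have "\<dots> \<le> 2 * (\<bar>a\<bar> * norm (f x))\<^sup>2 + 2 * (\<bar>b\<bar> * norm (g x))\<^sup>2"
    using sum_squares_bound[of "\<bar>a\<bar> * norm (f x)" "\<bar>b\<bar> * norm (g x)"]
    by (simp add: power2_sum)
  finally show "(norm (a *\<^sub>R f x + b *\<^sub>R g x))\<^sup>2 \<le> 2 * a\<^sup>2 * (norm (f x))\<^sup>2 + 2 * b\<^sup>2 * (norm (g x))\<^sup>2"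
    by (simp add: power_mult_distrib)
qed

lemma sym_form_L2: "sym_form (L2_fields \<Omega> :: (real ^ 'd \<Rightarrow> 'b::euclidean_space) set) (L2_inner \<Omega>)"
proof
  fix f g h :: "real ^ 'd \<Rightarrow> 'b" and a b
  assume *: "f \<in> L2_fields \<Omega>" "g \<in> L2_fields \<Omega>" "h \<in> L2_fields \<Omega>"
  show "L2_inner \<Omega> (\<lambda>x. a *\<^sub>R f x + b *\<^sub>R g x) h = a * L2_inner \<Omega> f h + b * L2_inner \<Omega> g h"
    using L2_inner_integrable[OF *(1,3)] L2_inner_integrable[OF *(2,3)]
    by (simp add: L2_inner_def inner_add_left)
qed (auto intro!: L2_fields_lincomb Bochner_Integration.integral_nonneg simp: L2_inner_def inner_commute)

lemma L2_inner_cong_AE: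
  fixes f :: "real ^ 'd \<Rightarrow> 'b::euclidean_space"
  assumes "f \<in> L2_fields \<Omega>" "f' \<in> L2_fields \<Omega>" "g \<in> L2_fields \<Omega>" "g' \<in> L2_fields \<Omega>"
    and "AE x in lebesgue_on \<Omega>. f x = f' x" "AE x in lebesgue_on \<Omega>. g x = g' x"
  shows "L2_inner \<Omega> f g = L2_inner \<Omega> f' g'"
  unfolding L2_inner_def
proof (rule integral_cong_AE)
  show "AE x in lebesgue_on \<Omega>. f x \<bullet> g x = f' x \<bullet> g' x"
    using assms(5,6) by eventually_elim simp
qed (use L2_inner_integrable assms in auto)

text \<open>Linearity of \<open>T\<close> is asked only almost everywhere: \<open>wgrad\<close>
  chooses a representative for each function separately, so it is linear only up to null sets, and
  the integral does not see these.\<close>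

lemma sym_form_pullback:
  fixes T :: "('a \<Rightarrow> 'b::real_vector) \<Rightarrow> real ^ 'd \<Rightarrow> 'c::euclidean_space"
  assumes lincomb: "\<And>f g a b. f \<in> X \<Longrightarrow> g \<in> X \<Longrightarrow> (\<lambda>x. a *\<^sub>R f x + b *\<^sub>R g x) \<in> X"
    and T: "\<And>f. f \<in> X \<Longrightarrow> T f \<in> L2_fields \<Omega>"
    and lin: "\<And>f g a b. f \<in> X \<Longrightarrow> g \<in> X \<Longrightarrow>
      AE x in lebesgue_on \<Omega>. T (\<lambda>x. a *\<^sub>R f x + b *\<^sub>R g x) x = a *\<^sub>R T f x + b *\<^sub>R T g x"
  shows "sym_form X (\<lambda>f g. L2_inner \<Omega> (T f) (T g))"
proof -
  interpret L: sym_form "L2_fields \<Omega> :: (real ^ 'd \<Rightarrow> 'c) set" "L2_inner \<Omega>"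
    by (rule sym_form_L2)
  show ?thesis
  proof
    fix f g h a b assume *: "f \<in> X" "g \<in> X" "h \<in> X"
    have "L2_inner \<Omega> (T (\<lambda>x. a *\<^sub>R f x + b *\<^sub>R g x)) (T h)
      = L2_inner \<Omega> (\<lambda>x. a *\<^sub>R T f x + b *\<^sub>R T g x) (T h)"
      using * by (intro L2_inner_cong_AE lin T lincomb L.lincomb) auto
    then show "L2_inner \<Omega> (T (\<lambda>x. a *\<^sub>R f x + b *\<^sub>R g x)) (T h)
      = a * L2_inner \<Omega> (T f) (T h) + b * L2_inner \<Omega> (T g) (T h)"
      using * by (simp add: L.lin T)
  qed (use T lincomb L.sym L.nonneg in blast)+
qed

lemma L2_fields_comp:
  fixes f :: "real ^ 'd \<Rightarrow> ('c::euclidean_space) ^ 'n"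
  assumes "f \<in> L2_fields \<Omega>"
  shows "(\<lambda>x. f x $ j) \<in> L2_fields \<Omega>"
proof (rule L2_fields_dominated)
  show "(\<lambda>x. f x $ j) \<in> borel_measurable (lebesgue_on \<Omega>)"
    using L2_fieldsD(1)[OF assms]
    by (rule measurable_compose) (intro borel_measurable_continuous_onI continuous_intros)
  show "integrable (lebesgue_on \<Omega>) (\<lambda>x. (norm (f x))\<^sup>2)" by (rule L2_fieldsD[OF assms])
qed (simp add: Finite_Cartesian_Product.norm_nth_le power_mono)

lemma borel_measurable_vec:
  fixes f :: "'a \<Rightarrow> ('c::euclidean_space) ^ 'n"
  assumes "\<And>j. (\<lambda>x. f x $ j) \<in> borel_measurable M"
  shows "f \<in> borel_measurable M"
proof (subst borel_measurable_euclidean_space, rule ballI)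
  fix i :: "'c ^ 'n" assume "i \<in> Basis"
  then obtain j b where "i = axis j b" by (auto simp: Basis_vec_def)
  then show "(\<lambda>x. f x \<bullet> i) \<in> borel_measurable M"
    using assms[of j] by (simp add: inner_axis)
qed

lemma L2_fields_vec:
  fixes f :: "real ^ 'd \<Rightarrow> ('c::euclidean_space) ^ 'n"
  assumes "\<And>j. (\<lambda>x. f x $ j) \<in> L2_fields \<Omega>"
  shows "f \<in> L2_fields \<Omega>"
proof (rule L2_fields_dominated)
  show "f \<in> borel_measurable (lebesgue_on \<Omega>)"
    by (intro borel_measurable_vec L2_fieldsD(1) assms)
  show "integrable (lebesgue_on \<Omega>) (\<lambda>x. \<Sum>j\<in>UNIV. (norm (f x $ j))\<^sup>2)"
    using L2_fieldsD(2)[OF assms] by simp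
  show "(norm (f x))\<^sup>2 \<le> (\<Sum>j\<in>UNIV. (norm (f x $ j))\<^sup>2)" for x
    by (simp add: norm_vec_def L2_set_def sum_nonneg)
qed

lemma L2_inner_vec:
  fixes f g :: "real ^ 'd \<Rightarrow> ('c::euclidean_space) ^ 'n"
  assumes "f \<in> L2_fields \<Omega>" "g \<in> L2_fields \<Omega>"
  shows "L2_inner \<Omega> f g = (\<Sum>j\<in>UNIV. L2_inner \<Omega> (\<lambda>x. f x $ j) (\<lambda>x. g x $ j))"
  using L2_inner_integrable[OF L2_fields_comp[OF assms(1)] L2_fields_comp[OF assms(2)]]
  by (simp add: L2_inner_def inner_vec_def)

section \<open>Differentiation of compactly supported functions\<close>

lemma partial_deriv_eqI:
  "(f has_derivative f') (at x) \<Longrightarrow> partial_deriv j f x = f' (axis j 1)"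
  unfolding partial_deriv_def using frechet_derivative_at by metis

lemma Ck_fun_differentiable: "Ck_fun (Suc k) f \<Longrightarrow> f differentiable at x"
  by (simp add: differentiable_on_def)

lemma Ck_fun_SucD: "Ck_fun (Suc k) f \<Longrightarrow> Ck_fun k f"
proof (induction k arbitrary: f)
  case 0
  then show ?case by (simp add: differentiable_imp_continuous_on)
next
  case (Suc k)
  then have "f differentiable_on UNIV" "\<And>j. Ck_fun (Suc k) (partial_deriv j f)"
    by auto
  then show ?case using Suc.IH by (simp only: Ck_fun.simps) blast
qed

lemma Ck_fun_continuous: "Ck_fun k f \<Longrightarrow> continuous_on UNIV f"
  by (induction k) (use Ck_fun_SucD in auto)

lemma Ck_fun_partial_continuous: "Ck_fun (Suc k) f \<Longrightarrow> continuous_on UNIV (partial_deriv j f)"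
  using Ck_fun_continuous[of k "partial_deriv j f"] by simp

lemma Ck_fun_1D:
  assumes "Ck_fun 1 f"
  shows "f differentiable at x" "continuous_on UNIV f" "continuous_on UNIV (partial_deriv j f)"
  using assms Ck_fun_differentiable[of 0 f] Ck_fun_continuous[of 1 f] Ck_fun_partial_continuous[of 0 f]
  by simp_all

lemma partial_deriv_const: "partial_deriv j (\<lambda>x. c) = (\<lambda>x. 0)"
proof
  show "partial_deriv j (\<lambda>x. c) x = 0" for x
    by (subst partial_deriv_eqI[OF has_derivative_const]) simp
qed

lemma Ck_fun_const: "Ck_fun k (\<lambda>x. c)"
  by (induction k arbitrary: c) (auto simp: partial_deriv_const)

lemma partial_deriv_add:
  assumes "f differentiable at x" "g differentiable at x"
  shows "partial_deriv j (\<lambda>x. f x + g x) x = partial_deriv j f x + partial_deriv j g x"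
  unfolding partial_deriv_def[of j f] partial_deriv_def[of j g]
  by (rule partial_deriv_eqI, rule has_derivative_add; rule frechet_derivative_works[THEN iffD1]; fact)

lemma partial_deriv_mult:
  assumes "f differentiable at x" "g differentiable at x"
  shows "partial_deriv j (\<lambda>x. f x * g x) x = partial_deriv j f x * g x + f x * partial_deriv j g x"
  unfolding partial_deriv_def[of j f] partial_deriv_def[of j g]
  by (subst partial_deriv_eqI[OF has_derivative_mult[OF frechet_derivative_works[THEN iffD1] frechet_derivative_works[THEN iffD1]]])
    (use assms in auto)

lemma Ck_fun_add:
  assumes "Ck_fun k f" "Ck_fun k g"
  shows "Ck_fun k (\<lambda>x. f x + g x)"
  using assms
proof (induction k arbitrary: f g)
  case (Suc k)
  have "partial_deriv j (\<lambda>x. f x + g x) = (\<lambda>x. partial_deriv j f x + partial_deriv j g x)" for j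
    using Suc.prems by (intro ext partial_deriv_add Ck_fun_differentiable)
  moreover have "Ck_fun k (\<lambda>x. partial_deriv j f x + partial_deriv j g x)" for j
    using Suc.prems by (intro Suc.IH) auto
  ultimately show ?case
    using Suc.prems by (auto intro: differentiable_on_add)
qed (auto intro: continuous_intros)

lemma Ck_fun_mult:
  assumes "Ck_fun k f" "Ck_fun k g"
  shows "Ck_fun k (\<lambda>x. f x * g x)"
  using assms
proof (induction k arbitrary: f g)
  case (Suc k)
  have "partial_deriv j (\<lambda>x. f x * g x)
    = (\<lambda>x. partial_deriv j f x * g x + f x * partial_deriv j g x)" for j
    using Suc.prems by (intro ext partial_deriv_mult Ck_fun_differentiable)
  moreover have "Ck_fun k (\<lambda>x. partial_deriv j f x * g x + f x * partial_deriv j g x)" for j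
    using Suc.IH[of "partial_deriv j f" g] Suc.IH[of f "partial_deriv j g"] Suc.prems
      Ck_fun_SucD[OF Suc.prems(1)] Ck_fun_SucD[OF Suc.prems(2)]
    by (simp add: Ck_fun_add)
  ultimately show ?case
    using Suc.prems by (auto intro: differentiable_on_mult)
qed (auto intro: continuous_intros)

lemma Ck_fun_prod:
  assumes "finite I" "\<And>i. i \<in> I \<Longrightarrow> Ck_fun k (f i)"
  shows "Ck_fun k (\<lambda>x. \<Prod>i\<in>I. f i x)"
  using assms by (induction I) (auto intro: Ck_fun_const Ck_fun_mult)

lemma Ck_fun_coord: "Ck_fun k (\<lambda>x. x $ i)"
proof (cases k)
  case (Suc l)
  have der: "((\<lambda>x. x $ i) has_derivative (\<lambda>h. h $ i)) (at x)" for x :: "real ^ 'a"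
    by (rule bounded_linear.has_derivative[OF bounded_linear_vec_nth has_derivative_ident])
  have "partial_deriv j (\<lambda>x. x $ i) = (\<lambda>x. axis j 1 $ i)" for j :: 'a
    using partial_deriv_eqI[OF der] by blast
  then show ?thesis
    using der by (auto simp: Suc differentiable_on_def differentiable_def Ck_fun_const)
qed (auto intro: continuous_intros)

lemma has_real_derivative_along_axis:
  assumes "f differentiable at (x + t *\<^sub>R axis j 1)"
  shows "((\<lambda>t. f (x + t *\<^sub>R axis j 1)) has_real_derivative partial_deriv j f (x + t *\<^sub>R axis j 1)) (at t)"
proof -
  let ?F = "frechet_derivative f (at (x + t *\<^sub>R axis j 1))"
  have F: "(f has_derivative ?F) (at (x + t *\<^sub>R axis j 1))"
    using assms by (rule frechet_derivative_works[THEN iffD1])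
  have "((\<lambda>t. f (x + t *\<^sub>R axis j 1)) has_derivative (\<lambda>h. ?F (h *\<^sub>R axis j 1))) (at t)"
    by (rule has_derivative_compose[where g = f and f = "\<lambda>t. x + t *\<^sub>R axis j 1"
          and f' = "\<lambda>h. h *\<^sub>R axis j 1", OF _ F]) (auto intro!: derivative_eq_intros)
  moreover have "?F (h *\<^sub>R axis j 1) = partial_deriv j f (x + t *\<^sub>R axis j 1) * h" for h
    using linear_frechet_derivative[OF assms] by (simp add: linear_scale partial_deriv_def)
  ultimately show ?thesis by (simp add: has_field_derivative_def)
qed

lemma partial_deriv_outside_support:
  assumes "\<And>x. R < norm x \<Longrightarrow> f x = 0" "R < norm x"
  shows "partial_deriv j f x = 0"
proof -
  have "((\<lambda>x. 0) has_derivative (\<lambda>h. 0)) (at x)" by (rule has_derivative_const)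
  then have "(f has_derivative (\<lambda>h. 0)) (at x)"
  proof (rule has_derivative_transform_within_open)
    show "open {x. R < norm x}" by (intro open_Collect_less continuous_intros)
  qed (use assms in auto)
  then show ?thesis by (simp add: partial_deriv_eqI)
qed

lemma compact_support_bounded:
  fixes f :: "real ^ 'd \<Rightarrow> real"
  assumes "continuous_on UNIV f" "\<And>x. R < norm x \<Longrightarrow> f x = 0"
  obtains C where "0 \<le> C" "\<And>x. \<bar>f x\<bar> \<le> C"
proof -
  have "compact (f ` cball 0 R)"
    using assms(1) by (intro compact_continuous_image continuous_on_subset[OF assms(1)]) auto
  then obtain C where C: "\<And>x. x \<in> cball 0 R \<Longrightarrow> \<bar>f x\<bar> \<le> C"
    using compact_imp_bounded[of "f ` cball 0 R"] unfolding bounded_iff by force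
  have "\<bar>f x\<bar> \<le> max C 0" for x
    using C[of x] assms(2)[of x] by (cases "norm x \<le> R") auto
  then show thesis using that[of "max C 0"] by auto
qed

lemma compact_support_integrable:
  fixes f :: "real ^ 'd \<Rightarrow> real"
  assumes "continuous_on UNIV f" "\<And>x. R < norm x \<Longrightarrow> f x = 0"
  shows "integrable lborel f"
proof -
  have "integrable lborel (\<lambda>x. indicator (cball 0 R) x *\<^sub>R f x)"
    using continuous_on_subset[OF assms(1)] by (intro borel_integrable_compact) auto
  moreover have "(\<lambda>x. indicator (cball 0 R) x *\<^sub>R f x) = f"
    using assms(2) by (force simp: indicator_def)
  ultimately show ?thesis by simp
qed

section \<open>Integration by parts through translation invariance\<close>

lemma lborel_integral_translate:
  fixes f :: "'a::euclidean_space \<Rightarrow> real"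
  assumes "f \<in> borel_measurable borel"
  shows "(LINT x | lborel. f (x + c)) = (LINT x | lborel. f x)"
proof -
  have "(LINT x | lborel. f x) = (LINT x | distr lborel borel ((+) c). f x)"
    by (simp add: lborel_distr_plus)
  also have "\<dots> = (LINT x | lborel. f (c + x))"
    using assms by (intro integral_distr) auto
  finally show ?thesis by (simp add: add.commute)
qed

text \<open>Dominated convergence: the mean value theorem bounds all quotients by the supremum of
  the partial derivative, and steps of length at most 1 keep their supports in the ball of radius
  \<open>R + 1\<close>, where the merely continuous \<open>g\<close> is bounded.\<close>

lemma difference_quotient_integral:
  fixes f g :: "real ^ 'd \<Rightarrow> real" and h :: "nat \<Rightarrow> real"
  assumes f: "Ck_fun 1 f" "\<And>x. R < norm x \<Longrightarrow> f x = 0"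
    and g: "continuous_on UNIV g"
    and h: "h \<longlonglongrightarrow> 0" "\<And>n. h n \<noteq> 0" "\<And>n. \<bar>h n\<bar> \<le> 1"
  shows "(\<lambda>n. LINT x | lborel. (f (x + h n *\<^sub>R axis j 1) - f x) / h n * g x)
    \<longlonglongrightarrow> (LINT x | lborel. partial_deriv j f x * g x)"
proof -
  have df: "f differentiable at x" for x
    by (rule Ck_fun_1D[OF f(1)])
  have cf: "continuous_on UNIV f" "continuous_on UNIV (partial_deriv j f)"
    by (rule Ck_fun_1D[OF f(1)])+
  obtain C where C: "0 \<le> C" "\<And>x. \<bar>partial_deriv j f x\<bar> \<le> C"
    by (rule compact_support_bounded[OF cf(2) partial_deriv_outside_support[OF f(2)]]) (auto intro: that)
  have "compact (g ` cball 0 (R + 1))"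
    by (intro compact_continuous_image continuous_on_subset[OF g]) auto
  then obtain C' where C': "\<And>x. x \<in> cball 0 (R + 1) \<Longrightarrow> \<bar>g x\<bar> \<le> C'"
    using compact_imp_bounded[of "g ` cball 0 (R + 1)"] unfolding bounded_iff by force
  have meas: "f \<in> borel_measurable borel" "g \<in> borel_measurable borel"
    "partial_deriv j f \<in> borel_measurable borel"
    using cf g by (auto intro: borel_measurable_continuous_onI)
  have quot: "\<bar>(f (x + h n *\<^sub>R axis j 1) - f x) / h n\<bar> \<le> C" for x n
  proof -
    have "norm (f (x + h n *\<^sub>R axis j 1) - f (x + 0 *\<^sub>R axis j 1)) \<le> C * norm (h n - 0)"
    proof (rule field_differentiable_bound[where S = UNIV
          and f = "\<lambda>t. f (x + t *\<^sub>R axis j 1)" and f' = "\<lambda>t. partial_deriv j f (x + t *\<^sub>R axis j 1)"])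
      show "((\<lambda>t. f (x + t *\<^sub>R axis j 1)) has_field_derivative partial_deriv j f (x + t *\<^sub>R axis j 1))
        (at t within UNIV)" for t
        using has_real_derivative_along_axis[OF df] by simp
    qed (use C in auto)
    then show ?thesis using h(2)[of n] by (simp add: abs_divide divide_le_eq)
  qed
  show ?thesis
  proof (rule integral_dominated_convergence[where w = "\<lambda>x. indicator (cball 0 (R + 1)) x * (C * C')"])
    show "(\<lambda>x. partial_deriv j f x * g x) \<in> borel_measurable lborel"
      using meas by simp
    show "(\<lambda>x. (f (x + h n *\<^sub>R axis j 1) - f x) / h n * g x) \<in> borel_measurable lborel" for n
      using meas by measurable
    have "integrable lborel (\<lambda>x. indicator (cball 0 (R + 1)) x *\<^sub>R (C * C'))"
      by (intro borel_integrable_compact) auto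
    then show "integrable lborel (\<lambda>x. indicator (cball 0 (R + 1)) x * (C * C'))" by simp
    show "AE x in lborel. (\<lambda>n. (f (x + h n *\<^sub>R axis j 1) - f x) / h n * g x)
      \<longlonglongrightarrow> partial_deriv j f x * g x"
    proof (intro AE_I2 tendsto_mult tendsto_const)
      fix x
      have "((\<lambda>t. (f (x + t *\<^sub>R axis j 1) - f x) / t) \<longlongrightarrow> partial_deriv j f x) (at 0)"
        using has_real_derivative_along_axis[of f x 0 j] df unfolding DERIV_def by simp
      moreover have "filterlim h (at 0) sequentially"
        using h by (simp add: filterlim_at)
      ultimately show "(\<lambda>n. (f (x + h n *\<^sub>R axis j 1) - f x) / h n) \<longlonglongrightarrow> partial_deriv j f x"
        by (rule filterlim_compose)
    qed
    show "AE x in lborel. norm ((f (x + h n *\<^sub>R axis j 1) - f x) / h n * g x)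
      \<le> indicator (cball 0 (R + 1)) x * (C * C')" for n
    proof (rule AE_I2)
      fix x
      show "norm ((f (x + h n *\<^sub>R axis j 1) - f x) / h n * g x) \<le> indicator (cball 0 (R + 1)) x * (C * C')"
      proof (cases "norm x \<le> R + 1")
        case True
        then show ?thesis
          using mult_mono[OF quot[of x n] C'[of x]] C(1) by (simp add: abs_mult)
      next
        case False
        have "norm x \<le> norm (x + h n *\<^sub>R axis j 1) + \<bar>h n\<bar>"
          using norm_triangle_ineq4[of "x + h n *\<^sub>R axis j 1" "h n *\<^sub>R axis j 1"] by simp
        with False h(3)[of n] have "R < norm (x + h n *\<^sub>R axis j 1)" "R < norm x" by auto
        then show ?thesis using f(2) False by simp
      qed
    qed
  qed
qed

text \<open>By translation invariance every difference quotient of \<open>f\<close> has integral 0,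
  and the limit inherits this. No iterated integrals are involved.\<close>

lemma integral_partial_deriv_eq_0:
  fixes f :: "real ^ 'd \<Rightarrow> real"
  assumes f: "Ck_fun 1 f" "\<And>x. R < norm x \<Longrightarrow> f x = 0"
  shows "(LINT x | lborel. partial_deriv j f x) = 0"
proof -
  define h where "h n = inverse (real (Suc n))" for n
  have h: "h \<longlonglongrightarrow> 0" "\<And>n. h n \<noteq> 0" "\<And>n. \<bar>h n\<bar> \<le> 1"
    unfolding h_def using LIMSEQ_inverse_real_of_nat by (auto simp: inverse_le_1_iff)
  have cont: "continuous_on UNIV f" by (rule Ck_fun_1D[OF f(1)])
  have int: "integrable lborel f" by (rule compact_support_integrable[OF cont f(2)])
  have meas: "f \<in> borel_measurable borel" using cont by (rule borel_measurable_continuous_onI)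
  have "(LINT x | lborel. (f (x + h n *\<^sub>R axis j 1) - f x) / h n * 1) = 0" for n
  proof -
    have "integrable lborel (\<lambda>x. f (x + h n *\<^sub>R axis j 1))"
    proof (rule compact_support_integrable)
      show "continuous_on UNIV (\<lambda>x. f (x + h n *\<^sub>R axis j 1))"
        by (intro continuous_on_compose2[OF cont] continuous_intros) auto
      fix x :: "real ^ 'd" assume "R + 1 < norm x"
      moreover have "norm x \<le> norm (x + h n *\<^sub>R axis j 1) + \<bar>h n\<bar>"
        using norm_triangle_ineq4[of "x + h n *\<^sub>R axis j 1" "h n *\<^sub>R axis j 1"] by simp
      ultimately show "f (x + h n *\<^sub>R axis j 1) = 0"
        using h(3)[of n] by (intro f(2)) simp
    qed
    then show ?thesis
      using int lborel_integral_translate[OF meas] by simp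
  qed
  then show ?thesis
    using difference_quotient_integral[of f R "\<lambda>x. 1" h j, OF f continuous_on_const h]
    using h(2) by (simp add: LIMSEQ_const_iff)
qed

lemma integration_by_parts:
  fixes f g :: "real ^ 'd \<Rightarrow> real"
  assumes f: "Ck_fun 1 f" and g: "Ck_fun 1 g" and supp: "\<And>x. R < norm x \<Longrightarrow> g x = 0"
  shows "(LINT x | lborel. f x * partial_deriv j g x) = - (LINT x | lborel. partial_deriv j f x * g x)"
proof -
  have cont: "continuous_on UNIV f" "continuous_on UNIV g"
    "continuous_on UNIV (partial_deriv j f)" "continuous_on UNIV (partial_deriv j g)"
    by (rule Ck_fun_1D[OF f] Ck_fun_1D[OF g])+
  have "partial_deriv j (\<lambda>x. f x * g x) x = partial_deriv j f x * g x + f x * partial_deriv j g x" for x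
    by (intro partial_deriv_mult Ck_fun_1D[OF f] Ck_fun_1D[OF g])
  then have "0 = (LINT x | lborel. partial_deriv j f x * g x + f x * partial_deriv j g x)"
    using integral_partial_deriv_eq_0[of "\<lambda>x. f x * g x" R j, OF Ck_fun_mult[OF f g]] supp by simp
  also have "\<dots> = (LINT x | lborel. partial_deriv j f x * g x) + (LINT x | lborel. f x * partial_deriv j g x)"
    using supp partial_deriv_outside_support[of R g]
    by (intro Bochner_Integration.integral_add compact_support_integrable[of _ R] continuous_intros cont) auto
  finally show ?thesis by simp
qed

text \<open>Shifting one factor by a difference quotient replaces Schwarz's theorem on mixed derivatives.\<close>

lemma partial_deriv_swap:
  fixes f g :: "real ^ 'd \<Rightarrow> real"
  assumes f: "Ck_fun 1 f" "\<And>x. R < norm x \<Longrightarrow> f x = 0"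
    and g: "Ck_fun 1 g" "\<And>x. R < norm x \<Longrightarrow> g x = 0"
  shows "(LINT x | lborel. partial_deriv i f x * partial_deriv j g x)
    = (LINT x | lborel. partial_deriv j f x * partial_deriv i g x)"
proof -
  define h where "h n = inverse (real (Suc n))" for n
  have h: "h \<longlonglongrightarrow> 0" "\<And>n. h n \<noteq> 0" "\<And>n. \<bar>h n\<bar> \<le> 1"
    unfolding h_def using LIMSEQ_inverse_real_of_nat by (auto simp: inverse_le_1_iff)
  have h': "(\<lambda>n. - h n) \<longlonglongrightarrow> 0" "\<And>n. - h n \<noteq> 0" "\<And>n. \<bar>- h n\<bar> \<le> 1"
    using tendsto_minus[OF h(1)] h by auto
  have cont: "continuous_on UNIV f" "continuous_on UNIV g"
    "continuous_on UNIV (partial_deriv j f)" "continuous_on UNIV (partial_deriv j g)"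
    by (rule Ck_fun_1D[OF f(1)] Ck_fun_1D[OF g(1)])+
  have df: "f differentiable at x" for x
    by (rule Ck_fun_1D[OF f(1)])
  \<comment> \<open>The \<open>j\<close>-derivative is moved from \<open>g\<close> to
    \<open>f\<close> by parts, and the difference quotient in direction \<open>i\<close> from
    \<open>f\<close> to \<open>g\<close> by translation, which reverses its step. At no point is a
    second derivative taken, so one continuous derivative suffices.\<close>
  have eq: "(LINT x | lborel. (f (x + h n *\<^sub>R axis i 1) - f x) / h n * partial_deriv j g x)
    = (LINT x | lborel. (g (x + (- h n) *\<^sub>R axis i 1) - g x) / (- h n) * partial_deriv j f x)" for n
  proof -
    define c :: "real ^ 'd" where "c = h n *\<^sub>R axis i 1"
    have "norm c \<le> 1" using h(3)[of n] by (simp add: c_def)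
    have shift: "continuous_on UNIV (\<lambda>x. k (x + d))" if "continuous_on UNIV k"
      for k :: "real ^ 'd \<Rightarrow> real" and d
      by (intro continuous_on_compose2[OF that] continuous_intros) auto
    have der: "((\<lambda>x. f (x + c)) has_derivative frechet_derivative f (at (x + c))) (at x)" for x
      by (rule has_derivative_compose[where g = f and f = "\<lambda>x. x + c"
            and f' = "\<lambda>h. h", OF _ frechet_derivative_works[THEN iffD1, OF df]])
        (auto intro!: derivative_eq_intros)
    then have fc: "partial_deriv j (\<lambda>x. f (x + c)) = (\<lambda>x. partial_deriv j f (x + c))" for j
      unfolding partial_deriv_def[of j f] using partial_deriv_eqI by blast
    have "Ck_fun 1 (\<lambda>x. f (x + c))"
      using der shift Ck_fun_partial_continuous f(1)
      by (auto simp: fc differentiable_on_def differentiable_def)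
    then have ibp: "(LINT x | lborel. f (x + c) * partial_deriv j g x)
      = - (LINT x | lborel. partial_deriv j f (x + c) * g x)"
      using integration_by_parts[of "\<lambda>x. f (x + c)" g R j, OF _ g] by (simp add: fc)
    have supp: "partial_deriv k g x = 0" "partial_deriv k f x = 0" if "R < norm x" for k x
      using that f(2) g(2) partial_deriv_outside_support by blast+
    have supp': "g (x - c) = 0" if "R + 1 < norm x" for x
      using g(2)[of "x - c"] that \<open>norm c \<le> 1\<close> norm_triangle_ineq2[of x c] by linarith
    have I1: "integrable lborel (\<lambda>x. f (x + c) * partial_deriv j g x)"
      "integrable lborel (\<lambda>x. f x * partial_deriv j g x)"
      "integrable lborel (\<lambda>x. partial_deriv j f x * g x)"
      by (rule compact_support_integrable[of _ R];
          use supp g(2) in \<open>auto intro!: continuous_intros cont shift\<close>)+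
    have I2: "integrable lborel (\<lambda>x. partial_deriv j f x * g (x - c))"
      using supp' shift[OF cont(2), of "-c"]
      by (intro compact_support_integrable[of _ "R + 1"] continuous_intros cont) auto
    have "(LINT x | lborel. partial_deriv j f (x + c) * g x)
      = (LINT x | lborel. partial_deriv j f (x + c) * g (x + c - c))" by simp
    also have "\<dots> = (LINT x | lborel. partial_deriv j f x * g (x - c))"
      using shift[OF cont(2), of "-c"]
      by (intro lborel_integral_translate[where f = "\<lambda>x. partial_deriv j f x * g (x - c)"]
          borel_measurable_continuous_onI continuous_intros cont) auto
    finally have tr: "(LINT x | lborel. partial_deriv j f (x + c) * g x)
      = (LINT x | lborel. partial_deriv j f x * g (x - c))" .
    have "(LINT x | lborel. (f (x + c) - f x) / h n * partial_deriv j g x)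
      = ((LINT x | lborel. f (x + c) * partial_deriv j g x)
        - (LINT x | lborel. f x * partial_deriv j g x)) / h n"
      using I1 by (simp add: left_diff_distrib)
    also have "\<dots> = ((LINT x | lborel. partial_deriv j f x * g x)
        - (LINT x | lborel. partial_deriv j f x * g (x - c))) / h n"
      using integration_by_parts[of f g R j, OF f(1) g] ibp tr by simp
    also have "\<dots> = (LINT x | lborel. (g (x - c) - g x) / (- h n) * partial_deriv j f x)"
      using I1 I2 by (simp add: algebra_simps diff_divide_distrib)
    finally show ?thesis by (simp add: c_def)
  qed
  have "(\<lambda>n. LINT x | lborel. (f (x + h n *\<^sub>R axis i 1) - f x) / h n * partial_deriv j g x)
    \<longlonglongrightarrow> (LINT x | lborel. partial_deriv i f x * partial_deriv j g x)"
    by (intro difference_quotient_integral[OF f] cont h)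
  moreover have "(\<lambda>n. LINT x | lborel. (g (x + (- h n) *\<^sub>R axis i 1) - g x) / (- h n) * partial_deriv j f x)
    \<longlonglongrightarrow> (LINT x | lborel. partial_deriv i g x * partial_deriv j f x)"
    by (intro difference_quotient_integral[OF g] cont h')
  ultimately show ?thesis
    using LIMSEQ_unique eq by (simp add: mult.commute)
qed

section \<open>Smooth bumps and the fundamental lemma of the calculus of variations\<close>

text \<open>The family \<open>e\<^sup>-\<^sup>1\<^sup>/\<^sup>t / t\<^sup>n\<close> on the positive half-line is closed under differentiation up to linear
  combinations, which makes its members smooth.\<close>

definition flat_exp :: "nat \<Rightarrow> real \<Rightarrow> real" where
  "flat_exp n t = (if 0 < t then exp (- (1 / t)) / t ^ n else 0)"

lemma flat_exp_tendsto_0: "(flat_exp n \<longlongrightarrow> 0) (at 0)"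
proof -
  have "((\<lambda>t. (inverse t) ^ n / exp (inverse t)) \<longlongrightarrow> (0::real)) (at_right 0)"
    by (rule filterlim_compose[OF tendsto_power_div_exp_0 filterlim_inverse_at_top_right])
  moreover have "\<forall>\<^sub>F t in at_right 0. (inverse t) ^ n / exp (inverse t) = flat_exp n t"
    unfolding eventually_at_right_field
    by (intro exI[of _ 1]) (auto simp: flat_exp_def exp_minus field_simps)
  ultimately have "(flat_exp n \<longlongrightarrow> 0) (at_right 0)"
    by (rule Lim_transform_eventually)
  moreover have "\<forall>\<^sub>F t in at_left 0. 0 = flat_exp n t"
    unfolding eventually_at_left_field by (intro exI[of _ "-1"]) (auto simp: flat_exp_def)
  then have "(flat_exp n \<longlongrightarrow> 0) (at_left 0)"
    by (rule Lim_transform_eventually[OF tendsto_const])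
  ultimately show ?thesis
    using filterlim_split_at by blast
qed

lemma flat_exp_deriv:
  "(flat_exp n has_real_derivative flat_exp (n + 2) t - real n * flat_exp (n + 1) t) (at t)"
proof -
  consider "t < 0" | "t = 0" | "0 < t" by linarith
  then show ?thesis
  proof cases
    case 1
    have "((\<lambda>t. 0) has_real_derivative 0) (at t)" by simp
    then have "(flat_exp n has_real_derivative 0) (at t)"
      by (rule has_field_derivative_transform_within_open[of _ _ _ "{..<0}"])
        (use 1 in \<open>auto simp: flat_exp_def\<close>)
    then show ?thesis using 1 by (simp add: flat_exp_def)
  next
    case 2
    \<comment> \<open>At 0 the difference quotient is itself the next member of the family, so
      differentiability there is the limit already computed.\<close>
    have "(\<lambda>h. (flat_exp n (0 + h) - flat_exp n 0) / h) = flat_exp (Suc n)"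
      by (auto simp: flat_exp_def)
    then have "(flat_exp n has_real_derivative 0) (at 0)"
      using flat_exp_tendsto_0 unfolding DERIV_def by simp
    then show ?thesis using 2 by (simp add: flat_exp_def)
  next
    case 3
    have "((\<lambda>t. exp (- inverse t) * inverse t ^ n) has_real_derivative
      exp (- inverse t) * inverse t ^ 2 * inverse t ^ n
        - exp (- inverse t) * (real n * inverse t ^ (n - 1) * inverse t ^ 2)) (at t)"
      using 3 by (auto intro!: derivative_eq_intros simp: power2_eq_square)
    moreover have "exp (- inverse t) * inverse t ^ 2 * inverse t ^ n
        - exp (- inverse t) * (real n * inverse t ^ (n - 1) * inverse t ^ 2)
      = flat_exp (n + 2) t - real n * flat_exp (n + 1) t"
      using 3 by (cases n) (simp_all add: flat_exp_def divide_inverse power_inverse power2_eq_square)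
    ultimately have "((\<lambda>t. exp (- inverse t) * inverse t ^ n) has_real_derivative
      flat_exp (n + 2) t - real n * flat_exp (n + 1) t) (at t)"
      by simp
    then show ?thesis
      by (rule has_field_derivative_transform_within_open[of _ _ _ "{0<..}"])
        (use 3 in \<open>auto simp: flat_exp_def field_simps\<close>)
  qed
qed

lemma Ck_fun_flat_exp: "Ck_fun k (\<lambda>x. flat_exp n (a * x $ i + b))"
proof (induction k arbitrary: n)
  case 0
  have "continuous_on UNIV (flat_exp n)"
    using flat_exp_deriv DERIV_isCont by (intro continuous_at_imp_continuous_on) blast
  then show ?case
    by (auto intro!: continuous_on_compose2[of UNIV "flat_exp n"] continuous_intros)
next
  case (Suc k)
  let ?F = "\<lambda>x::real ^ 'a. flat_exp (n + 2) (a * x $ i + b) + (- real n) * flat_exp (n + 1) (a * x $ i + b)"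
  have der: "((\<lambda>x. flat_exp n (a * x $ i + b)) has_derivative (\<lambda>h. ?F x * (a * h $ i))) (at x)"
    for x :: "real ^ 'a"
  proof -
    have "((\<lambda>x. a * x $ i + b) has_derivative (\<lambda>h. a * h $ i)) (at x)"
      by (auto intro!: derivative_eq_intros bounded_linear.has_derivative[OF bounded_linear_vec_nth])
    from has_derivative_compose[OF this has_field_derivative_imp_has_derivative[OF flat_exp_deriv]]
    show ?thesis by simp
  qed
  have "partial_deriv j (\<lambda>x. flat_exp n (a * x $ i + b)) = (\<lambda>x. ?F x * (a * axis j 1 $ i))" for j
    using partial_deriv_eqI[OF der] by blast
  moreover have "Ck_fun k (\<lambda>x. ?F x * (a * axis j 1 $ i))" for j
    by (intro Ck_fun_mult Ck_fun_add Ck_fun_const Suc.IH)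
  ultimately show ?case
    using der by (auto simp: differentiable_on_def differentiable_def)
qed

text \<open>One factor per face of the box, each vanishing to infinite order at that face. Rescaling
  its argument by \<open>Suc n\<close> drives the factor to 1 inside while the support stays in
  \<open>cbox a b\<close>.\<close>

lemma test_functions_box_approx:
  fixes a b :: "real ^ 'd"
  assumes "cbox a b \<subseteq> \<Omega>"
  obtains \<phi> where "\<And>n. \<phi> n \<in> test_functions \<Omega>" "\<And>n x. \<bar>\<phi> n x\<bar> \<le> 1"
    "\<And>x. (\<lambda>n. \<phi> n x) \<longlonglongrightarrow> indicator (box a b) x"
proof -
  define \<phi> where "\<phi> n x = (\<Prod>i\<in>UNIV. flat_exp 0 (real (Suc n) * x $ i + - real (Suc n) * a $ i)
    * flat_exp 0 (- real (Suc n) * x $ i + real (Suc n) * b $ i))" for n and x :: "real ^ 'd"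
  have fe: "0 \<le> flat_exp 0 t" "flat_exp 0 t \<le> 1" "flat_exp 0 t \<noteq> 0 \<Longrightarrow> 0 < t" for t
    by (auto simp: flat_exp_def split: if_splits)
  have zero: "x \<in> box a b" if "\<phi> n x \<noteq> 0" for n x
  proof -
    have "a $ i < x $ i \<and> x $ i < b $ i" for i
    proof -
      have "0 < real (Suc n) * x $ i + - real (Suc n) * a $ i"
        "0 < - real (Suc n) * x $ i + real (Suc n) * b $ i"
        using that fe(3) unfolding \<phi>_def by auto
      then have "0 < real (Suc n) * (x $ i - a $ i)" "0 < real (Suc n) * (b $ i - x $ i)"
        by (simp_all add: algebra_simps)
      then show ?thesis by (simp add: zero_less_mult_iff)
    qed
    then show ?thesis by (simp add: mem_box_cart)
  qed
  have cl: "closure {x. \<phi> n x \<noteq> 0} \<subseteq> cbox a b" for n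
    using zero box_subset_cbox[of a b] by (intro closure_minimal) blast+
  have "\<phi> n \<in> test_functions \<Omega>" for n
  proof -
    have "Ck_fun k (\<phi> n)" for k
      unfolding \<phi>_def[abs_def] by (intro Ck_fun_prod Ck_fun_mult Ck_fun_flat_exp) auto
    moreover have "compact (closure {x. \<phi> n x \<noteq> 0})"
      using cl[of n] bounded_subset[OF bounded_cbox] by (simp add: compact_eq_bounded_closed)
    ultimately show ?thesis using cl[of n] assms by (auto simp: test_functions_def)
  qed
  moreover have "\<bar>\<phi> n x\<bar> \<le> 1" for n x
    unfolding \<phi>_def abs_prod using fe by (intro prod_le_1) (auto simp: abs_mult mult_le_one)
  moreover have "(\<lambda>n. \<phi> n x) \<longlonglongrightarrow> indicator (box a b) x" for x
  proof (cases "x \<in> box a b")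
    case True
    have lim: "(\<lambda>n. flat_exp 0 (real (Suc n) * c)) \<longlonglongrightarrow> 1" if "0 < c" for c
    proof -
      have "(\<lambda>n. exp (- (inverse (real (Suc n)) * (1 / c)))) \<longlonglongrightarrow> exp (- (0 * (1 / c)))"
        by (intro tendsto_intros LIMSEQ_inverse_real_of_nat)
      moreover have "exp (- (inverse (real (Suc n)) * (1 / c))) = flat_exp 0 (real (Suc n) * c)" for n
        using that by (simp add: flat_exp_def zero_less_mult_iff inverse_eq_divide)
      ultimately show ?thesis by simp
    qed
    have "(\<lambda>n. \<phi> n x) \<longlonglongrightarrow> (\<Prod>i\<in>(UNIV :: 'd set). 1 * 1)"
      unfolding \<phi>_def
    proof (intro tendsto_prod tendsto_mult)
      fix i :: 'd
      show "(\<lambda>n. flat_exp 0 (real (Suc n) * x $ i + - real (Suc n) * a $ i)) \<longlonglongrightarrow> 1"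
        using lim[of "x $ i - a $ i"] True by (simp add: mem_box_cart algebra_simps)
      show "(\<lambda>n. flat_exp 0 (- real (Suc n) * x $ i + real (Suc n) * b $ i)) \<longlonglongrightarrow> 1"
        using lim[of "b $ i - x $ i"] True by (simp add: mem_box_cart algebra_simps)
    qed
    then show ?thesis using True by simp
  next
    case False
    then have "\<phi> n x = 0" for n using zero by blast
    then show ?thesis using False by simp
  qed
  ultimately show thesis by (rule that)
qed

text \<open>Boxes form an intersection-stable generator of the Borel sets, so Dynkin's argument
  makes all Borel set integrals vanish. The total integral is a separate hypothesis because the
  whole space is not a box; it handles complements.\<close>

lemma AE_zero_if_box_integrals_zero:
  fixes f :: "'a::euclidean_space \<Rightarrow> real"
  assumes f: "integrable lborel f" and zero: "(LINT x | lborel. f x) = 0"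
    and box: "\<And>a b. (LINT x:box a b | lborel. f x) = 0"
  shows "AE x in lborel. f x = 0"
proof -
  define E where "E = range (\<lambda>(a, b). box a b :: 'a set)"
  have bor: "sets borel = sigma_sets UNIV E"
    unfolding E_def by (subst borel_eq_box) simp
  have si: "set_integrable lborel A f" if "A \<in> sets borel" for A
    using integrable_mult_indicator[OF _ f, of A] that by (simp add: set_integrable_def)
  have "Int_stable E"
    unfolding Int_stable_def E_def by (auto simp: box_Int_box)
  moreover have "E \<subseteq> Pow UNIV" by simp
  ultimately have "(LINT x:A | lborel. f x) = 0" if "A \<in> sigma_sets UNIV E" for A
    using that
  proof (induction rule: sigma_sets_induct_disjoint)
    case (basic A)
    then show ?case using box by (auto simp: E_def)
  next
    case empty
    then show ?case by (simp add: set_lebesgue_integral_def)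
  next
    case (compl A)
    then have A: "A \<in> sets borel" using bor by simp
    have "(LINT x:UNIV | lborel. f x) = (LINT x:A | lborel. f x) + (LINT x:UNIV - A | lborel. f x)"
      using set_integral_Un[OF _ si[OF A] si[of "UNIV - A"]] A by (simp add: Un_absorb1)
    moreover have "(LINT x:UNIV | lborel. f x) = 0" using zero by (simp add: set_lebesgue_integral_def)
    ultimately show ?case using compl by simp
  next
    case (union A)
    then have A: "A i \<in> sets borel" for i using bor by blast
    have "(LINT x:(\<Union>i. A i) | lborel. f x) = (\<Sum>i. (LINT x:A i | lborel. f x))"
      using A union(1) by (intro lebesgue_integral_countable_add si)
        (auto simp: disjoint_family_on_def)
    then show ?case using union.IH by simp
  qed
  then have "AE x in lborel. f x = (\<lambda>x. 0) x"
    using f bor by (intro density_unique_real) (auto simp: set_lebesgue_integral_def)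
  then show ?thesis by simp
qed

lemma test_functionsD:
  assumes "\<phi> \<in> test_functions \<Omega>"
  shows "Ck_fun k \<phi>" "x \<notin> \<Omega> \<Longrightarrow> \<phi> x = 0" "x \<notin> \<Omega> \<Longrightarrow> partial_deriv j \<phi> x = 0"
    "\<exists>R. \<forall>x. R < norm x \<longrightarrow> \<phi> x = 0"
proof -
  let ?S = "closure {x. \<phi> x \<noteq> 0}"
  have S: "compact ?S" "?S \<subseteq> \<Omega>" and k: "\<And>k. Ck_fun k \<phi>"
    using assms by (auto simp: test_functions_def)
  have out: "\<phi> y = 0" if "y \<notin> ?S" for y
    using that closure_subset[of "{x. \<phi> x \<noteq> 0}"] by blast
  show "Ck_fun k \<phi>" by (rule k)
  show "x \<notin> \<Omega> \<Longrightarrow> \<phi> x = 0" using out S(2) by blast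
  show "partial_deriv j \<phi> x = 0" if "x \<notin> \<Omega>"
  proof -
    have "((\<lambda>x. 0) has_derivative (\<lambda>h. 0)) (at x)" by (rule has_derivative_const)
    then have "(\<phi> has_derivative (\<lambda>h. 0)) (at x)"
    proof (rule has_derivative_transform_within_open)
      show "open (- ?S)" by auto
      show "x \<in> - ?S" using that S(2) by blast
      show "0 = \<phi> y" if "y \<in> - ?S" for y using out[of y] that by simp
    qed
    then show ?thesis by (simp add: partial_deriv_eqI)
  qed
  obtain R where "\<And>y. y \<in> ?S \<Longrightarrow> norm y \<le> R"
    using compact_imp_bounded[OF S(1)] unfolding bounded_iff by blast
  then show "\<exists>R. \<forall>x. R < norm x \<longrightarrow> \<phi> x = 0"
    using out by (meson linorder_not_le)
qed

text \<open>Bumps converge boundedly to box indicators, so integrals over boxes with closure in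
  \<open>\<Omega>\<close> vanish; this is localised to each such box and then spread over a
  countable cover of \<open>\<Omega>\<close>.\<close>

theorem fundamental_lemma:
  fixes g :: "real ^ 'd \<Rightarrow> real"
  assumes \<Omega>: "open \<Omega>" and g: "integrable (lebesgue_on \<Omega>) g"
    and zero: "\<And>\<phi>. \<phi> \<in> test_functions \<Omega> \<Longrightarrow> (LINT x | lebesgue_on \<Omega>. g x * \<phi> x) = 0"
  shows "AE x in lebesgue_on \<Omega>. g x = 0"
proof -
  have \<Omega>l: "\<Omega> \<inter> space lebesgue \<in> sets lebesgue" using \<Omega> by simp
  have ig: "integrable lebesgue (\<lambda>x. indicator \<Omega> x *\<^sub>R g x)"
    using g integrable_restrict_space[OF \<Omega>l] by blast
  \<comment> \<open>A Borel representative of the extension of \<open>g\<close> by zero lets the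
    argument run in \<open>lborel\<close>, where boxes and translations live; it agrees with
    \<open>g\<close> almost everywhere on \<open>\<Omega>\<close>.\<close>
  then obtain f where f: "f \<in> borel_measurable lborel" "AE x in lborel. indicator \<Omega> x *\<^sub>R g x = f x"
    using completion_ex_borel_measurable_real[of _ lborel] borel_measurable_integrable by blast
  have ae: "AE x in lebesgue. indicator \<Omega> x *\<^sub>R g x = f x"
    using f(2) by (rule AE_completion)
  have fl: "f \<in> borel_measurable lebesgue" using f(1) by (rule measurable_completion)
  have "integrable lebesgue f"
    using ig integrable_cong_AE[OF _ fl ae] borel_measurable_integrable by blast
  then have intf: "integrable lborel f" using integrable_completion[OF f(1)] by simp
  have test: "(LINT x | lborel. f x * \<phi> x) = 0" if \<phi>: "\<phi> \<in> test_functions \<Omega>" for \<phi>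
  proof -
    have m: "\<phi> \<in> borel_measurable borel"
      using Ck_fun_continuous test_functionsD(1)[OF \<phi>] borel_measurable_continuous_onI by blast
    have "(LINT x | lborel. f x * \<phi> x) = (LINT x | lebesgue. f x * \<phi> x)"
      using f m by (intro integral_completion[symmetric]) auto
    also have "\<dots> = (LINT x | lebesgue. indicator \<Omega> x *\<^sub>R (g x * \<phi> x))"
    proof (rule integral_cong_AE)
      have ml: "\<phi> \<in> borel_measurable lebesgue" using m by (simp add: measurable_completion)
      show "(\<lambda>x. f x * \<phi> x) \<in> borel_measurable lebesgue" using ml fl by simp
      have "(\<lambda>x. (indicator \<Omega> x *\<^sub>R g x) * \<phi> x) \<in> borel_measurable lebesgue"
        using ml borel_measurable_integrable[OF ig] by (intro borel_measurable_times)
      then show "(\<lambda>x. indicator \<Omega> x *\<^sub>R (g x * \<phi> x)) \<in> borel_measurable lebesgue"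
        by (simp add: mult.assoc)
      show "AE x in lebesgue. f x * \<phi> x = indicator \<Omega> x *\<^sub>R (g x * \<phi> x)"
        using ae by eventually_elim (metis scaleR_scaleR real_scaleR_def mult.assoc)
    qed
    also have "\<dots> = (LINT x | lebesgue_on \<Omega>. g x * \<phi> x)"
      by (rule integral_restrict_space[OF \<Omega>l, symmetric])
    finally show ?thesis using zero[OF \<phi>] by simp
  qed
  have box: "(LINT x:box a b | lborel. f x) = 0" if ab: "cbox a b \<subseteq> \<Omega>" for a b
  proof -
    obtain \<phi> where \<phi>: "\<And>n. \<phi> n \<in> test_functions \<Omega>" "\<And>n x. \<bar>\<phi> n x\<bar> \<le> 1"
      "\<And>x. (\<lambda>n. \<phi> n x) \<longlonglongrightarrow> indicator (box a b) x"
      using test_functions_box_approx[OF ab] by blast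
    have m: "\<phi> n \<in> borel_measurable borel" for n
      using Ck_fun_continuous test_functionsD(1)[OF \<phi>(1)] borel_measurable_continuous_onI by blast
    have "(\<lambda>n. LINT x | lborel. f x * \<phi> n x) \<longlonglongrightarrow> (LINT x | lborel. f x * indicator (box a b) x)"
    proof (rule integral_dominated_convergence[where w = "\<lambda>x. \<bar>f x\<bar>"])
      show "AE x in lborel. (\<lambda>n. f x * \<phi> n x) \<longlonglongrightarrow> f x * indicator (box a b) x"
        using \<phi>(3) by (intro AE_I2 tendsto_mult tendsto_const)
      show "AE x in lborel. norm (f x * \<phi> n x) \<le> \<bar>f x\<bar>" for n
        using \<phi>(2) by (simp add: abs_mult mult_left_le)
    qed (use f m intf in auto)
    then have "(LINT x | lborel. f x * indicator (box a b) x) = 0"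
      using test[OF \<phi>(1)] by (simp add: LIMSEQ_const_iff)
    then show ?thesis by (simp add: set_lebesgue_integral_def mult.commute)
  qed
  \<comment> \<open>Boxes reaching outside \<open>\<Omega>\<close> are not controlled, so
    \<open>f\<close> is cut off to \<open>box c d\<close>: every box then contributes only through
    its intersection with \<open>box c d\<close>, which is again a box.\<close>
  have ae_box: "AE x in lborel. x \<in> box c d \<longrightarrow> f x = 0" if cd: "cbox c d \<subseteq> \<Omega>" for c d
  proof -
    have "AE x in lborel. indicator (box c d) x *\<^sub>R f x = 0"
    proof (rule AE_zero_if_box_integrals_zero)
      show "integrable lborel (\<lambda>x. indicator (box c d) x *\<^sub>R f x)"
        by (intro integrable_mult_indicator intf) simp
      show "(LINT x | lborel. indicator (box c d) x *\<^sub>R f x) = 0"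
        using box[OF cd] by (simp add: set_lebesgue_integral_def)
      fix a b :: "real ^ 'd"
      obtain a' b' where ab': "box a b \<inter> box c d = box a' b'" using box_Int_box by blast
      have "(LINT x:box a' b' | lborel. f x) = 0"
      \<comment> \<open>For an empty intersection the corners are arbitrary and
        \<open>cbox a' b'\<close> may be a nonempty degenerate box outside \<open>\<Omega>\<close>,
        so that case is settled directly.\<close>
      proof (cases "box a' b' = {}")
        case False
        then have "cbox a' b' = closure (box a b \<inter> box c d)" using ab' by simp
        also have "\<dots> \<subseteq> cbox c d"
          using box_subset_cbox by (intro closure_minimal) auto
        finally show ?thesis using box cd by auto
      qed (simp add: set_lebesgue_integral_def)
      then show "(LINT x:box a b | lborel. indicator (box c d) x *\<^sub>R f x) = 0"
        unfolding ab'[symmetric] by (simp add: set_lebesgue_integral_def indicator_inter_arith mult.assoc)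
    qed
    then show ?thesis by eventually_elim (auto simp: indicator_def)
  qed
  obtain \<D> where \<D>: "countable \<D>" "\<D> \<subseteq> Pow \<Omega>" "\<And>X. X \<in> \<D> \<Longrightarrow> \<exists>a b. X = cbox a b" "\<Union>\<D> = \<Omega>"
    using open_countable_Union_open_cbox[OF \<Omega>] by metis
  have "AE x in lebesgue. x \<in> X \<longrightarrow> f x = 0" if X: "X \<in> \<D>" for X
  proof -
    obtain a b where ab: "X = cbox a b" using \<D>(3)[OF X] by blast
    then have "cbox a b \<subseteq> \<Omega>" using X \<D>(2) by blast
    from AE_completion[OF ae_box[OF this]] have "AE x in lebesgue. x \<in> box a b \<longrightarrow> f x = 0" .
    \<comment> \<open>The cover consists of closed boxes, but only their interiors are controlled;
      the faces are null.\<close>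
    moreover have "AE x in lebesgue. x \<notin> cbox a b - box a b"
      using negligible_frontier_interval[of a b] by (intro AE_not_in) (simp add: negligible_iff_null_sets)
    ultimately show ?thesis by eventually_elim (auto simp: ab)
  qed
  then have "AE x in lebesgue. \<forall>X\<in>\<D>. x \<in> X \<longrightarrow> f x = 0"
    using \<D>(1) by (intro AE_ball_countable')
  with ae have "AE x in lebesgue. x \<in> \<Omega> \<longrightarrow> g x = 0"
  proof eventually_elim
    case (elim x)
    show ?case
    proof
      assume x: "x \<in> \<Omega>"
      then obtain X where "X \<in> \<D>" "x \<in> X" using \<D>(4) by blast
      then show "g x = 0" using elim x by simp
    qed
  qed
  then show ?thesis by (simp add: AE_restrict_space_iff[OF \<Omega>l])
qed

section \<open>Weak gradients on a bounded open set\<close>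

locale bounded_open_set =
  fixes \<Omega> :: "(real ^ 'd) set"
  assumes open_\<Omega>: "open \<Omega>" and bounded_\<Omega>: "bounded \<Omega>"
begin

sublocale L2s: sym_form "L2_fields \<Omega> :: (real ^ 'd \<Rightarrow> real) set" "L2_inner \<Omega>"
  by (rule sym_form_L2)

sublocale L2v: sym_form "L2_fields \<Omega> :: (real ^ 'd \<Rightarrow> real ^ 'd) set" "L2_inner \<Omega>"
  by (rule sym_form_L2)

lemma finite_measure_\<Omega>: "finite_measure (lebesgue_on \<Omega>)"
  using open_\<Omega> bounded_\<Omega>
  by (intro finite_measure_lebesgue_on bounded_set_imp_lmeasurable) auto

text \<open>Finite measure puts the square-integrable functions among the integrable ones, as the
  fundamental lemma requires.\<close>

lemma L2_fields_integrable:
  fixes f :: "real ^ 'd \<Rightarrow> real"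
  assumes "f \<in> L2_fields \<Omega>"
  shows "integrable (lebesgue_on \<Omega>) f"
proof (rule Bochner_Integration.integrable_bound)
  interpret finite_measure "lebesgue_on \<Omega>" by (rule finite_measure_\<Omega>)
  show "integrable (lebesgue_on \<Omega>) (\<lambda>x. 1 + (norm (f x))\<^sup>2)"
    using L2_fieldsD(2)[OF assms] by simp
  have "\<bar>f x\<bar> \<le> 1 + (f x)\<^sup>2" for x
    using sum_squares_bound[of "\<bar>f x\<bar>" 1] by simp
  then show "AE x in lebesgue_on \<Omega>. norm (f x) \<le> norm (1 + (norm (f x))\<^sup>2)"
    by simp
qed (rule L2_fieldsD[OF assms])

lemma L2_fields_bounded:
  fixes f :: "real ^ 'd \<Rightarrow> real"
  assumes "f \<in> borel_measurable (lebesgue_on \<Omega>)" "\<And>x. \<bar>f x\<bar> \<le> C"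
  shows "f \<in> L2_fields \<Omega>"
proof (rule L2_fields_dominated[OF assms(1)])
  interpret finite_measure "lebesgue_on \<Omega>" by (rule finite_measure_\<Omega>)
  show "integrable (lebesgue_on \<Omega>) (\<lambda>x. C\<^sup>2)" by simp
  show "(norm (f x))\<^sup>2 \<le> C\<^sup>2" for x
    using assms(2)[of x] by (simp add: abs_le_square_iff[symmetric])
qed

lemma borel_measurable_lebesgue_on:
  fixes f :: "real ^ 'd \<Rightarrow> real"
  assumes "continuous_on UNIV f"
  shows "f \<in> borel_measurable (lebesgue_on \<Omega>)"
  using borel_measurable_continuous_onI[OF assms]
  by (intro measurable_restrict_space1 measurable_completion) simp

lemma integral_lebesgue_on_eq_lborel:
  fixes f :: "real ^ 'd \<Rightarrow> real"
  assumes "continuous_on UNIV f" "\<And>x. x \<notin> \<Omega> \<Longrightarrow> f x = 0"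
  shows "(LINT x | lebesgue_on \<Omega>. f x) = (LINT x | lborel. f x)"
proof -
  have "(LINT x | lebesgue_on \<Omega>. f x) = (LINT x | lebesgue. indicator \<Omega> x *\<^sub>R f x)"
    using open_\<Omega> by (intro integral_restrict_space) simp
  also have "(\<lambda>x. indicator \<Omega> x *\<^sub>R f x) = f"
    using assms(2) by (force simp: indicator_def)
  also have "(LINT x | lebesgue. f x) = (LINT x | lborel. f x)"
    using borel_measurable_continuous_onI[OF assms(1)] by (intro integral_completion) simp
  finally show ?thesis .
qed

lemma test_functions_continuous:
  assumes "\<phi> \<in> test_functions \<Omega>"
  shows "continuous_on UNIV \<phi>" "continuous_on UNIV (partial_deriv j \<phi>)"
  by (rule Ck_fun_1D[OF test_functionsD(1)[OF assms]])+

lemma test_functions_L2: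
  assumes "\<phi> \<in> test_functions \<Omega>"
  shows "\<phi> \<in> L2_fields \<Omega>" "partial_deriv j \<phi> \<in> L2_fields \<Omega>"
proof -
  obtain R where R: "\<And>x. R < norm x \<Longrightarrow> \<phi> x = 0" using test_functionsD(4)[OF assms] by blast
  note cont = test_functions_continuous[OF assms]
  obtain C where "\<And>x. \<bar>\<phi> x\<bar> \<le> C"
    by (rule compact_support_bounded[OF cont(1) R]) auto
  then show "\<phi> \<in> L2_fields \<Omega>"
    by (intro L2_fields_bounded borel_measurable_lebesgue_on cont)
  obtain C' where "\<And>x. \<bar>partial_deriv j \<phi> x\<bar> \<le> C'"
    by (rule compact_support_bounded[OF cont(2) partial_deriv_outside_support[OF R]]) auto
  then show "partial_deriv j \<phi> \<in> L2_fields \<Omega>"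
    by (intro L2_fields_bounded borel_measurable_lebesgue_on cont)
qed

text \<open>With uniqueness below, this allows the classical derivatives to replace the chosen
  \<open>wgrad\<close> of a test function.\<close>

lemma has_weak_gradient_test:
  assumes "\<phi> \<in> test_functions \<Omega>"
  shows "has_weak_gradient \<Omega> \<phi> (\<lambda>x. \<chi> j. partial_deriv j \<phi> x)"
  unfolding has_weak_gradient_def
proof (intro conjI ballI allI)
  show "(\<lambda>x. \<chi> j. partial_deriv j \<phi> x) \<in> L2_fields \<Omega>"
    using test_functions_L2[OF assms] by (intro L2_fields_vec) simp
  fix \<psi> j assume \<psi>: "\<psi> \<in> test_functions \<Omega>"
  obtain R where R: "\<And>x. R < norm x \<Longrightarrow> \<psi> x = 0" using test_functionsD(4)[OF \<psi>] by blast
  have "(LINT x | lebesgue_on \<Omega>. \<phi> x * partial_deriv j \<psi> x) = (LINT x | lborel. \<phi> x * partial_deriv j \<psi> x)"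
    using assms \<psi> test_functionsD(2)
    by (intro integral_lebesgue_on_eq_lborel continuous_intros test_functions_continuous) auto
  also have "\<dots> = - (LINT x | lborel. partial_deriv j \<phi> x * \<psi> x)"
    by (intro integration_by_parts[of _ _ R] test_functionsD(1)[OF assms] test_functionsD(1)[OF \<psi>] R)
  also have "(LINT x | lborel. partial_deriv j \<phi> x * \<psi> x)
    = (LINT x | lebesgue_on \<Omega>. partial_deriv j \<phi> x * \<psi> x)"
    using assms \<psi> test_functionsD(2)
    by (intro integral_lebesgue_on_eq_lborel[symmetric] continuous_intros test_functions_continuous) auto
  finally show "(LINT x | lebesgue_on \<Omega>. \<phi> x * partial_deriv j \<psi> x)
    = - (LINT x | lebesgue_on \<Omega>. (\<chi> j. partial_deriv j \<phi> x) $ j * \<psi> x)" by simp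
qed

text \<open>Each component of the difference is orthogonal to all test functions, so the fundamental
  lemma applies. This is what makes the arbitrary choice in \<open>wgrad\<close> harmless under
  integrals.\<close>

lemma has_weak_gradient_unique:
  assumes "has_weak_gradient \<Omega> f G" "has_weak_gradient \<Omega> f G'"
  shows "AE x in lebesgue_on \<Omega>. G x = G' x"
proof -
  have L2: "G \<in> L2_fields \<Omega>" "G' \<in> L2_fields \<Omega>"
    using assms by (auto simp: has_weak_gradient_def)
  have "AE x in lebesgue_on \<Omega>. G x $ j - G' x $ j = 0" for j
  proof (rule fundamental_lemma[OF open_\<Omega>])
    note comp = L2_fields_comp[OF L2(1), of j] L2_fields_comp[OF L2(2), of j]
    show "integrable (lebesgue_on \<Omega>) (\<lambda>x. G x $ j - G' x $ j)"
      by (intro Bochner_Integration.integrable_diff L2_fields_integrable comp)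
    fix \<phi> assume \<phi>: "\<phi> \<in> test_functions \<Omega>"
    have "(LINT x | lebesgue_on \<Omega>. G x $ j * \<phi> x) = (LINT x | lebesgue_on \<Omega>. G' x $ j * \<phi> x)"
      using assms \<phi> by (simp add: has_weak_gradient_def)
    then show "(LINT x | lebesgue_on \<Omega>. (G x $ j - G' x $ j) * \<phi> x) = 0"
      using L2_inner_integrable[OF comp(1) test_functions_L2(1)[OF \<phi>]]
        L2_inner_integrable[OF comp(2) test_functions_L2(1)[OF \<phi>]]
      by (simp add: left_diff_distrib)
  qed
  then have "AE x in lebesgue_on \<Omega>. \<forall>j\<in>UNIV. G x $ j - G' x $ j = 0"
    by (intro AE_ball_countable') auto
  then show ?thesis by eventually_elim (simp add: vec_eq_iff)
qed

lemma has_weak_gradient_lincomb: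
  assumes "f \<in> L2_fields \<Omega>" "g \<in> L2_fields \<Omega>"
    and "has_weak_gradient \<Omega> f F" "has_weak_gradient \<Omega> g G"
  shows "has_weak_gradient \<Omega> (\<lambda>x. a *\<^sub>R f x + b *\<^sub>R g x) (\<lambda>x. a *\<^sub>R F x + b *\<^sub>R G x)"
  unfolding has_weak_gradient_def
proof (intro conjI ballI allI)
  have L2: "F \<in> L2_fields \<Omega>" "G \<in> L2_fields \<Omega>"
    using assms by (auto simp: has_weak_gradient_def)
  then show "(\<lambda>x. a *\<^sub>R F x + b *\<^sub>R G x) \<in> L2_fields \<Omega>" by (rule L2_fields_lincomb)
  fix \<phi> j assume \<phi>: "\<phi> \<in> test_functions \<Omega>"
  note test = test_functions_L2[OF \<phi>]
  have "(LINT x | lebesgue_on \<Omega>. (a *\<^sub>R f x + b *\<^sub>R g x) * partial_deriv j \<phi> x)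
    = L2_inner \<Omega> (\<lambda>x. a *\<^sub>R f x + b *\<^sub>R g x) (partial_deriv j \<phi>)"
    by (simp add: L2_inner_def)
  also have "\<dots> = a * L2_inner \<Omega> f (partial_deriv j \<phi>) + b * L2_inner \<Omega> g (partial_deriv j \<phi>)"
    by (intro L2s.lin assms test)
  also have "\<dots> = - (a * L2_inner \<Omega> (\<lambda>x. F x $ j) \<phi> + b * L2_inner \<Omega> (\<lambda>x. G x $ j) \<phi>)"
    using assms(3,4) \<phi> by (simp add: L2_inner_def has_weak_gradient_def)
  also have "\<dots> = - L2_inner \<Omega> (\<lambda>x. a *\<^sub>R F x $ j + b *\<^sub>R G x $ j) \<phi>"
    using L2 test by (subst L2s.lin) (auto intro: L2_fields_comp)
  finally show "(LINT x | lebesgue_on \<Omega>. (a *\<^sub>R f x + b *\<^sub>R g x) * partial_deriv j \<phi> x)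
    = - (LINT x | lebesgue_on \<Omega>. (a *\<^sub>R F x + b *\<^sub>R G x) $ j * \<phi> x)"
    by (simp add: L2_inner_def)
qed

lemma H1_L2: "f \<in> H1 \<Omega> \<Longrightarrow> f \<in> L2_fields \<Omega>"
  by (simp add: H1_def)

lemma has_weak_gradient_wgrad: "f \<in> H1 \<Omega> \<Longrightarrow> has_weak_gradient \<Omega> f (wgrad \<Omega> f)"
  unfolding wgrad_def using someI_ex[of "has_weak_gradient \<Omega> f"] by (simp add: H1_def)

lemma wgrad_L2: "f \<in> H1 \<Omega> \<Longrightarrow> wgrad \<Omega> f \<in> L2_fields \<Omega>"
  using has_weak_gradient_wgrad by (simp add: has_weak_gradient_def)

lemma H1_lincomb:
  assumes "f \<in> H1 \<Omega>" "g \<in> H1 \<Omega>"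
  shows "(\<lambda>x. a *\<^sub>R f x + b *\<^sub>R g x) \<in> H1 \<Omega>"
proof -
  have "(\<lambda>x. a *\<^sub>R f x + b *\<^sub>R g x) \<in> L2_fields \<Omega>"
    using assms by (intro L2_fields_lincomb H1_L2)
  moreover have "has_weak_gradient \<Omega> (\<lambda>x. a *\<^sub>R f x + b *\<^sub>R g x)
      (\<lambda>x. a *\<^sub>R wgrad \<Omega> f x + b *\<^sub>R wgrad \<Omega> g x)"
    using assms by (intro has_weak_gradient_lincomb H1_L2 has_weak_gradient_wgrad)
  ultimately show ?thesis unfolding H1_def by blast
qed

lemma wgrad_lincomb:
  assumes "f \<in> H1 \<Omega>" "g \<in> H1 \<Omega>"
  shows "AE x in lebesgue_on \<Omega>. wgrad \<Omega> (\<lambda>x. a *\<^sub>R f x + b *\<^sub>R g x) x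
    = a *\<^sub>R wgrad \<Omega> f x + b *\<^sub>R wgrad \<Omega> g x"
  using assms
  by (intro has_weak_gradient_unique[OF has_weak_gradient_wgrad has_weak_gradient_lincomb]
      has_weak_gradient_wgrad H1_lincomb H1_L2)

lemma test_functions_H1: "\<phi> \<in> test_functions \<Omega> \<Longrightarrow> \<phi> \<in> H1 \<Omega>"
  using has_weak_gradient_test test_functions_L2 unfolding H1_def by blast

lemma wgrad_test:
  assumes "\<phi> \<in> test_functions \<Omega>"
  shows "AE x in lebesgue_on \<Omega>. wgrad \<Omega> \<phi> x = (\<chi> j. partial_deriv j \<phi> x)"
  using assms
  by (intro has_weak_gradient_unique[OF has_weak_gradient_wgrad has_weak_gradient_test] test_functions_H1)

sublocale grad: sym_form "H1 \<Omega>" "\<lambda>f g. L2_inner \<Omega> (wgrad \<Omega> f) (wgrad \<Omega> g)"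
  by (rule sym_form_pullback[OF H1_lincomb wgrad_L2 wgrad_lincomb])

lemma H10_H1: "f \<in> H10 \<Omega> \<Longrightarrow> f \<in> H1 \<Omega>"
  by (simp add: H10_def)

text \<open>Density in the form used below: a defect \<open>b\<close> that is at most a fixed
  multiple of the squared \<open>H1\<close> distance from \<open>f\<close> to any test function
  cannot be positive. It extends inequalities, and identities through \<open>b\<close> a square,
  from test functions to \<open>H10\<close>.\<close>

lemma H10_approx:
  assumes f: "f \<in> H10 \<Omega>"
    and le: "\<And>\<phi>. \<phi> \<in> test_functions \<Omega> \<Longrightarrow> b \<le> C * (L2_inner \<Omega> (\<lambda>x. f x - \<phi> x) (\<lambda>x. f x - \<phi> x)
      + L2_inner \<Omega> (wgrad \<Omega> (\<lambda>x. f x - \<phi> x)) (wgrad \<Omega> (\<lambda>x. f x - \<phi> x)))"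
  shows "b \<le> 0"
proof -
  obtain \<phi> :: "nat \<Rightarrow> real ^ 'd \<Rightarrow> real" where \<phi>: "\<And>k. \<phi> k \<in> test_functions \<Omega>"
    and lim: "(\<lambda>k. H1_norm \<Omega> (\<lambda>x. f x - \<phi> k x)) \<longlonglongrightarrow> 0"
    using f unfolding H10_def by blast
  have "b \<le> C * (H1_norm \<Omega> (\<lambda>x. f x - \<phi> k x))\<^sup>2" for k
  proof -
    have "(\<lambda>x. f x - \<phi> k x) \<in> H1 \<Omega>"
      by (intro grad.diff_mem H10_H1 f test_functions_H1 \<phi>)
    then have "0 \<le> L2_inner \<Omega> (\<lambda>x. f x - \<phi> k x) (\<lambda>x. f x - \<phi> k x)"
      "0 \<le> L2_inner \<Omega> (wgrad \<Omega> (\<lambda>x. f x - \<phi> k x)) (wgrad \<Omega> (\<lambda>x. f x - \<phi> k x))"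
      by (auto intro: L2s.nonneg L2v.nonneg H1_L2 wgrad_L2)
    then show ?thesis
      using le[OF \<phi>, of k] by (simp add: H1_norm_def L2_norm_def)
  qed
  moreover have "(\<lambda>k. C * (H1_norm \<Omega> (\<lambda>x. f x - \<phi> k x))\<^sup>2) \<longlonglongrightarrow> C * 0\<^sup>2"
    by (intro tendsto_intros lim)
  ultimately show ?thesis by (intro LIMSEQ_le_const[of _ "C * 0\<^sup>2" b, simplified]) auto
qed

end

section \<open>Poincare's and Korn's inequalities\<close>

context bounded_open_set
begin

text \<open>Moves the integral to the whole space, where integration by parts and translation are
  available.\<close>

lemma L2_inner_grad_test:
  assumes \<phi>: "\<phi> \<in> test_functions \<Omega>" and \<psi>: "\<psi> \<in> test_functions \<Omega>"
  shows "L2_inner \<Omega> (\<lambda>x. wgrad \<Omega> \<phi> x $ i) (\<lambda>x. wgrad \<Omega> \<psi> x $ j)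
    = (LINT x | lborel. partial_deriv i \<phi> x * partial_deriv j \<psi> x)"
proof -
  have "L2_inner \<Omega> (\<lambda>x. wgrad \<Omega> \<phi> x $ i) (\<lambda>x. wgrad \<Omega> \<psi> x $ j)
    = L2_inner \<Omega> (partial_deriv i \<phi>) (partial_deriv j \<psi>)"
  proof (rule L2_inner_cong_AE)
    show "AE x in lebesgue_on \<Omega>. wgrad \<Omega> \<phi> x $ i = partial_deriv i \<phi> x"
      using wgrad_test[OF \<phi>] by eventually_elim simp
    show "AE x in lebesgue_on \<Omega>. wgrad \<Omega> \<psi> x $ j = partial_deriv j \<psi> x"
      using wgrad_test[OF \<psi>] by eventually_elim simp
  qed (intro L2_fields_comp wgrad_L2 test_functions_H1 test_functions_L2 \<phi> \<psi>)+
  also have "\<dots> = (LINT x | lebesgue_on \<Omega>. partial_deriv i \<phi> x * partial_deriv j \<psi> x)"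
    by (simp add: L2_inner_def)
  also have "\<dots> = (LINT x | lborel. partial_deriv i \<phi> x * partial_deriv j \<psi> x)"
    using test_functionsD(3)[OF \<phi>]
    by (intro integral_lebesgue_on_eq_lborel continuous_intros test_functions_continuous \<phi> \<psi>) auto
  finally show ?thesis .
qed

lemma Poincare_test:
  obtains C where "0 \<le> C" "\<And>\<phi>. \<phi> \<in> test_functions \<Omega> \<Longrightarrow>
    L2_inner \<Omega> \<phi> \<phi> \<le> C * L2_inner \<Omega> (wgrad \<Omega> \<phi>) (wgrad \<Omega> \<phi>)"
proof -
  obtain R where R: "\<And>x. x \<in> \<Omega> \<Longrightarrow> norm x \<le> R"
    using bounded_\<Omega> unfolding bounded_iff by blast
  have "L2_inner \<Omega> \<phi> \<phi> \<le> (4 * R\<^sup>2) * L2_inner \<Omega> (wgrad \<Omega> \<phi>) (wgrad \<Omega> \<phi>)"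
    if \<phi>: "\<phi> \<in> test_functions \<Omega>" for \<phi>
  proof -
    \<comment> \<open>Integrate the \<open>j\<close>-th derivative of \<open>x\<^sub>j \<phi>\<^sup>2\<close>.\<close>
    fix j :: 'd
    let ?d = "partial_deriv j \<phi>"
    note cont = test_functions_continuous[OF \<phi>]
    have supp: "\<phi> x = 0" if "R < norm x" for x
      using test_functionsD(2)[OF \<phi>, of x] R[of x] that by force
    note supp' = partial_deriv_outside_support[of R \<phi>, OF supp]
    have coord: "partial_deriv j (\<lambda>x::real ^ 'd. x $ j) x = 1" for x
      by (subst partial_deriv_eqI[OF bounded_linear.has_derivative[OF bounded_linear_vec_nth has_derivative_ident]])
        simp
    have der: "partial_deriv j (\<lambda>x. x $ j * \<phi> x) x = \<phi> x + x $ j * ?d x" for x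
      by (subst partial_deriv_mult)
        (auto simp: coord intro: Ck_fun_1D[OF Ck_fun_coord] Ck_fun_1D[OF test_functionsD(1)[OF \<phi>]])
    have I: "integrable lborel (\<lambda>x. \<phi> x * \<phi> x)" "integrable lborel (\<lambda>x. ?d x * ?d x)"
      "integrable lborel (\<lambda>x. x $ j * ?d x * \<phi> x)"
      by (rule compact_support_integrable[of _ R];
          use supp in \<open>auto intro!: continuous_intros cont\<close>)
        (rule compact_support_integrable[of _ R];
          use supp supp' in \<open>auto intro!: continuous_intros cont\<close>)+
    have "(LINT x | lborel. x $ j * \<phi> x * ?d x) = - (LINT x | lborel. (\<phi> x + x $ j * ?d x) * \<phi> x)"
      using integration_by_parts[of "\<lambda>x. x $ j * \<phi> x" \<phi> R j, OF Ck_fun_mult[OF Ck_fun_coord] _ supp]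
        test_functionsD(1)[OF \<phi>] by (simp add: der)
    also have "(LINT x | lborel. (\<phi> x + x $ j * ?d x) * \<phi> x)
      = (LINT x | lborel. \<phi> x * \<phi> x) + (LINT x | lborel. x $ j * ?d x * \<phi> x)"
      using I by (simp add: distrib_right)
    finally have "(LINT x | lborel. x $ j * \<phi> x * ?d x)
      = - ((LINT x | lborel. \<phi> x * \<phi> x) + (LINT x | lborel. x $ j * ?d x * \<phi> x))" .
    moreover have "(LINT x | lborel. x $ j * \<phi> x * ?d x) = (LINT x | lborel. x $ j * ?d x * \<phi> x)"
      by (simp add: ac_simps)
    ultimately have "(LINT x | lborel. \<phi> x * \<phi> x) = - 2 * (LINT x | lborel. x $ j * ?d x * \<phi> x)"
      by linarith
    also have "\<dots> = (LINT x | lborel. - 2 * (x $ j * ?d x * \<phi> x))"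
      by (simp only: Bochner_Integration.integral_mult_right_zero)
    \<comment> \<open>Young's inequality with weight 1/2, so that half of the left-hand side can be
      absorbed; this produces the constant \<open>4 * R\<^sup>2\<close>.\<close>
    also have "\<dots> \<le> (LINT x | lborel. 1 / 2 * (\<phi> x * \<phi> x) + 2 * R\<^sup>2 * (?d x * ?d x))"
    proof (intro integral_mono)
      show "integrable lborel (\<lambda>x. - 2 * (x $ j * ?d x * \<phi> x))"
        using I(3) by simp
      show "integrable lborel (\<lambda>x. 1 / 2 * (\<phi> x * \<phi> x) + 2 * R\<^sup>2 * (?d x * ?d x))"
        using I(1,2) by simp
      fix x
      show "- 2 * (x $ j * ?d x * \<phi> x) \<le> 1 / 2 * (\<phi> x * \<phi> x) + 2 * R\<^sup>2 * (?d x * ?d x)"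
      proof (cases "R < norm x")
        case False
        then have "\<bar>x $ j\<bar> \<le> R" using component_le_norm_cart[of x j] by linarith
        then have "(x $ j)\<^sup>2 \<le> R\<^sup>2" by (metis abs_le_square_iff abs_of_nonneg abs_ge_zero order_trans)
        then have "(x $ j)\<^sup>2 * (?d x)\<^sup>2 \<le> R\<^sup>2 * (?d x)\<^sup>2" by (simp add: mult_right_mono)
        moreover have "0 \<le> (\<phi> x + 2 * (x $ j * ?d x))\<^sup>2" by simp
        ultimately show ?thesis
          by (simp add: power2_eq_square algebra_simps)
      qed (use supp in simp)
    qed
    also have "\<dots> = 1 / 2 * (LINT x | lborel. \<phi> x * \<phi> x) + 2 * R\<^sup>2 * (LINT x | lborel. ?d x * ?d x)"
      using I by simp
    finally have le: "(LINT x | lborel. \<phi> x * \<phi> x) \<le> 4 * R\<^sup>2 * (LINT x | lborel. ?d x * ?d x)"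
      by simp
    have "(LINT x | lborel. \<phi> x * \<phi> x) = L2_inner \<Omega> \<phi> \<phi>"
      using test_functionsD(2)[OF \<phi>] unfolding L2_inner_def inner_real_def
      by (intro integral_lebesgue_on_eq_lborel[symmetric] continuous_intros cont) auto
    moreover have "(LINT x | lborel. ?d x * ?d x) \<le> L2_inner \<Omega> (wgrad \<Omega> \<phi>) (wgrad \<Omega> \<phi>)"
    proof -
      have g: "wgrad \<Omega> \<phi> \<in> L2_fields \<Omega>" by (intro wgrad_L2 test_functions_H1 \<phi>)
      have "L2_inner \<Omega> (\<lambda>x. wgrad \<Omega> \<phi> x $ j) (\<lambda>x. wgrad \<Omega> \<phi> x $ j)
        \<le> (\<Sum>j\<in>UNIV. L2_inner \<Omega> (\<lambda>x. wgrad \<Omega> \<phi> x $ j) (\<lambda>x. wgrad \<Omega> \<phi> x $ j))"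
        by (rule member_le_sum) (auto intro: L2s.nonneg L2_fields_comp g)
      then show ?thesis
        by (simp add: L2_inner_grad_test[OF \<phi> \<phi>] L2_inner_vec[OF g g])
    qed
    then have "4 * R\<^sup>2 * (LINT x | lborel. ?d x * ?d x) \<le> 4 * R\<^sup>2 * L2_inner \<Omega> (wgrad \<Omega> \<phi>) (wgrad \<Omega> \<phi>)"
      by (intro mult_left_mono) auto
    ultimately show ?thesis using le by linarith
  qed
  then show thesis by (intro that[of "4 * R\<^sup>2"]) auto
qed

text \<open>The factor 4 comes from two uses of the squared triangle inequality, once to pass from
  \<open>f\<close> to a test function and once to return in the gradient norm.\<close>

lemma Poincare:
  obtains C where "0 \<le> C" "\<And>f. f \<in> H10 \<Omega> \<Longrightarrow>
    L2_inner \<Omega> f f \<le> C * L2_inner \<Omega> (wgrad \<Omega> f) (wgrad \<Omega> f)"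
proof -
  obtain C where C: "0 \<le> C" "\<And>\<phi>. \<phi> \<in> test_functions \<Omega> \<Longrightarrow>
    L2_inner \<Omega> \<phi> \<phi> \<le> C * L2_inner \<Omega> (wgrad \<Omega> \<phi>) (wgrad \<Omega> \<phi>)"
    by (rule Poincare_test) blast
  let ?g = "\<lambda>f. L2_inner \<Omega> (wgrad \<Omega> f) (wgrad \<Omega> f)"
  have "L2_inner \<Omega> f f - 4 * C * ?g f \<le> 0" if f: "f \<in> H10 \<Omega>" for f
  proof (rule H10_approx[OF f])
    fix \<phi> assume \<phi>: "\<phi> \<in> test_functions \<Omega>"
    let ?e = "\<lambda>x. f x - \<phi> x"
    note H = H10_H1[OF f] test_functions_H1[OF \<phi>]
    have e: "?e \<in> H1 \<Omega>" by (rule grad.diff_mem[OF H])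
    have "L2_inner \<Omega> f f \<le> 2 * L2_inner \<Omega> ?e ?e + 2 * L2_inner \<Omega> \<phi> \<phi>"
      by (intro L2s.square_le_diff H1_L2 H)
    moreover have "?g \<phi> \<le> 2 * ?g ?e + 2 * ?g f"
      using grad.square_le_diff[OF H(2,1)] grad.square_diff[OF H] grad.square_diff[OF H(2,1)]
        grad.sym[OF H] by simp
    then have "C * ?g \<phi> \<le> C * (2 * ?g ?e + 2 * ?g f)"
      using C(1) by (rule mult_left_mono)
    moreover have "L2_inner \<Omega> \<phi> \<phi> \<le> C * ?g \<phi>" by (rule C(2)[OF \<phi>])
    moreover have "0 \<le> ?g ?e" by (rule grad.nonneg[OF e])
    moreover have "0 \<le> C * L2_inner \<Omega> ?e ?e"
      by (intro mult_nonneg_nonneg C(1) L2s.nonneg H1_L2 e)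
    ultimately show "L2_inner \<Omega> f f - 4 * C * ?g f \<le> (2 + 4 * C) * (L2_inner \<Omega> ?e ?e + ?g ?e)"
      by (simp add: algebra_simps)
  qed
  then show thesis using C(1) by (intro that[of "4 * C"]) auto
qed

text \<open>This turns the mixed terms of the squared strain into the square of the divergence.\<close>

lemma grad_swap:
  assumes f: "f \<in> H10 \<Omega>" and g: "g \<in> H10 \<Omega>"
  shows "L2_inner \<Omega> (\<lambda>x. wgrad \<Omega> f x $ i) (\<lambda>x. wgrad \<Omega> g x $ j)
    = L2_inner \<Omega> (\<lambda>x. wgrad \<Omega> f x $ j) (\<lambda>x. wgrad \<Omega> g x $ i)"
proof -
  define P where "P i j f g = L2_inner \<Omega> (\<lambda>x. wgrad \<Omega> f x $ i) (\<lambda>x. wgrad \<Omega> g x $ j)" for i j f g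
  define B where "B f g = P i j f g - P j i f g" for f g
  let ?g = "\<lambda>f. L2_inner \<Omega> (wgrad \<Omega> f) (wgrad \<Omega> f)"
  have comp: "(\<lambda>x. wgrad \<Omega> f x $ i) \<in> L2_fields \<Omega>" if "f \<in> H1 \<Omega>" for f i
    using that by (intro L2_fields_comp wgrad_L2)
  have comp_diff: "AE x in lebesgue_on \<Omega>. wgrad \<Omega> (\<lambda>x. f x - g x) x $ i = wgrad \<Omega> f x $ i - wgrad \<Omega> g x $ i"
    if "f \<in> H1 \<Omega>" "g \<in> H1 \<Omega>" for f g i
    using wgrad_lincomb[OF that, of 1 "-1"] by eventually_elim simp
  have P_left: "P i j (\<lambda>x. f x - g x) h = P i j f h - P i j g h"
    if H: "f \<in> H1 \<Omega>" "g \<in> H1 \<Omega>" "h \<in> H1 \<Omega>" for i j f g h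
    unfolding P_def L2s.diff_left[OF comp[OF H(1)] comp[OF H(2)] comp[OF H(3)], symmetric]
    by (rule L2_inner_cong_AE[OF comp[OF grad.diff_mem[OF H(1,2)]] L2s.diff_mem[OF comp[OF H(1)] comp[OF H(2)]]
          comp[OF H(3)] comp[OF H(3)] comp_diff[OF H(1,2)]]) simp
  have P_sym: "P i j f g = P j i g f" if "f \<in> H1 \<Omega>" "g \<in> H1 \<Omega>" for i j f g
    unfolding P_def using that by (intro L2s.sym comp)
  have comp_le: "L2_inner \<Omega> (\<lambda>x. wgrad \<Omega> f x $ i) (\<lambda>x. wgrad \<Omega> f x $ i) \<le> ?g f" if "f \<in> H1 \<Omega>" for f i
    unfolding L2_inner_vec[OF wgrad_L2[OF that] wgrad_L2[OF that]]
    by (rule member_le_sum) (auto intro: L2s.nonneg comp that)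
  have P_le: "(P i j f g)\<^sup>2 \<le> ?g f * ?g g" if "f \<in> H1 \<Omega>" "g \<in> H1 \<Omega>" for i j f g
  proof -
    have "(P i j f g)\<^sup>2 \<le> L2_inner \<Omega> (\<lambda>x. wgrad \<Omega> f x $ i) (\<lambda>x. wgrad \<Omega> f x $ i)
        * L2_inner \<Omega> (\<lambda>x. wgrad \<Omega> g x $ j) (\<lambda>x. wgrad \<Omega> g x $ j)"
      unfolding P_def using that by (intro L2s.Cauchy_Schwarz comp)
    also have "\<dots> \<le> ?g f * ?g g"
      using that by (intro mult_mono comp_le L2s.nonneg grad.nonneg comp)
    finally show ?thesis .
  qed
  have B_le: "(B f g)\<^sup>2 \<le> 4 * ?g f * ?g g" if "f \<in> H1 \<Omega>" "g \<in> H1 \<Omega>" for f g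
  proof -
    have "(B f g)\<^sup>2 \<le> 2 * (P i j f g)\<^sup>2 + 2 * (P j i f g)\<^sup>2"
      unfolding B_def using sum_squares_bound[of "P i j f g" "- P j i f g"]
      by (simp add: power2_diff)
    then show ?thesis using P_le[OF that, of i j] P_le[OF that, of j i] by simp
  qed
  \<comment> \<open>Density in the first argument only: \<open>B\<close> is controlled by the
    gradient seminorms, so vanishing on test functions extends to \<open>H10\<close> while
    \<open>g\<close> stays fixed.\<close>
  have zero: "B f g = 0" if f: "f \<in> H10 \<Omega>" and g: "g \<in> H1 \<Omega>"
    and z: "\<And>\<phi>. \<phi> \<in> test_functions \<Omega> \<Longrightarrow> B \<phi> g = 0" for f g
  proof -
    have "(B f g)\<^sup>2 \<le> 0"
    proof (rule H10_approx[OF f])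
      fix \<phi> assume \<phi>: "\<phi> \<in> test_functions \<Omega>"
      let ?e = "\<lambda>x. f x - \<phi> x"
      note H = H10_H1[OF f] test_functions_H1[OF \<phi>]
      have e: "?e \<in> H1 \<Omega>" by (rule grad.diff_mem[OF H])
      have "B f g = B ?e g"
        using z[OF \<phi>] P_left[OF H g] by (simp add: B_def)
      then have "(B f g)\<^sup>2 \<le> 4 * ?g ?e * ?g g" using B_le[OF e g] by simp
      moreover have "0 \<le> 4 * ?g g * L2_inner \<Omega> ?e ?e"
        by (intro mult_nonneg_nonneg L2s.nonneg H1_L2 e grad.nonneg g) simp
      ultimately show "(B f g)\<^sup>2 \<le> (4 * ?g g) * (L2_inner \<Omega> ?e ?e + ?g ?e)"
        by (simp add: algebra_simps)
    qed
    then show ?thesis by simp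
  qed
  have test: "B \<phi> \<psi> = 0" if \<phi>: "\<phi> \<in> test_functions \<Omega>" and \<psi>: "\<psi> \<in> test_functions \<Omega>" for \<phi> \<psi>
  proof -
    obtain R R' where R: "\<And>x. R < norm x \<Longrightarrow> \<phi> x = 0" "\<And>x. R' < norm x \<Longrightarrow> \<psi> x = 0"
      using test_functionsD(4)[OF \<phi>] test_functionsD(4)[OF \<psi>] by blast
    show ?thesis
      unfolding B_def P_def L2_inner_grad_test[OF \<phi> \<psi>]
      using partial_deriv_swap[of \<phi> "max R R'" \<psi> i j, OF test_functionsD(1)[OF \<phi>] _ test_functionsD(1)[OF \<psi>]]
        R by simp
  qed
  have B_skew: "B f g = - B g f" if "f \<in> H1 \<Omega>" "g \<in> H1 \<Omega>" for f g
    using P_sym[OF that] by (simp add: B_def)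
  \<comment> \<open>The density step is used twice: first on \<open>g\<close> against a test
    function, then, after exchanging the arguments by skew symmetry, on \<open>f\<close> against
    \<open>g\<close>.\<close>
  have "B f g = 0"
  proof (rule zero[OF f H10_H1[OF g]])
    fix \<phi> assume \<phi>: "\<phi> \<in> test_functions \<Omega>"
    have "B g \<phi> = 0"
      by (rule zero[OF g test_functions_H1[OF \<phi>] test[OF _ \<phi>]])
    then show "B \<phi> g = 0"
      using B_skew[OF test_functions_H1[OF \<phi>] H10_H1[OF g]] by simp
  qed
  then show ?thesis by (simp add: B_def P_def)
qed

section \<open>Strain, divergence and Korn's inequality\<close>

lemma H10_vec_comp: "v \<in> H10_vec \<Omega> \<Longrightarrow> (\<lambda>x. v x $ i) \<in> H10 \<Omega>"
  by (simp add: H10_vec_def)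

lemma wjac_L2:
  assumes "\<And>i. (\<lambda>x. v x $ i) \<in> H1 \<Omega>"
  shows "wjac \<Omega> v \<in> L2_fields \<Omega>"
  using wgrad_L2[OF assms] by (intro L2_fields_vec[of "wjac \<Omega> v"]) (simp add: wjac_def)

lemma strain_nth: "strain \<Omega> v x $ i $ j = (wjac \<Omega> v x $ i $ j + wjac \<Omega> v x $ j $ i) / 2"
  by (simp add: strain_def transpose_def)

lemma strain_L2:
  assumes "\<And>i. (\<lambda>x. v x $ i) \<in> H1 \<Omega>"
  shows "strain \<Omega> v \<in> L2_fields \<Omega>"
proof (intro L2_fields_vec)
  fix i j
  have "(\<lambda>x. (1 / 2) *\<^sub>R (wjac \<Omega> v x $ i $ j) + (1 / 2) *\<^sub>R (wjac \<Omega> v x $ j $ i)) \<in> L2_fields \<Omega>"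
    by (intro L2_fields_lincomb L2_fields_comp wjac_L2 assms)
  then show "(\<lambda>x. strain \<Omega> v x $ i $ j) \<in> L2_fields \<Omega>"
    by (simp add: strain_nth add_divide_distrib)
qed

lemma wdiv_eq: "wdiv \<Omega> v x = (\<Sum>i\<in>UNIV. wjac \<Omega> v x $ i $ i)"
  by (simp add: wdiv_def trace_def)

lemma L2_fields_sum:
  fixes f :: "'i \<Rightarrow> real ^ 'd \<Rightarrow> real"
  assumes "finite I" "\<And>i. i \<in> I \<Longrightarrow> f i \<in> L2_fields \<Omega>"
  shows "(\<lambda>x. \<Sum>i\<in>I. f i x) \<in> L2_fields \<Omega>"
  using assms
proof (induction I)
  case empty
  then show ?case by (intro L2_fields_bounded[of _ 0]) auto
next
  case (insert i I)
  then show ?case using L2_fields_lincomb[of "f i" \<Omega> "\<lambda>x. \<Sum>i\<in>I. f i x" 1 1] by simp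
qed

lemma wdiv_L2:
  assumes "\<And>i. (\<lambda>x. v x $ i) \<in> H1 \<Omega>"
  shows "wdiv \<Omega> v \<in> L2_fields \<Omega>"
  unfolding wdiv_eq[abs_def] by (intro L2_fields_sum L2_fields_comp wjac_L2 assms) simp

text \<open>Expanding the square of the strain leaves mixed terms, derivative \<open>j\<close> of
  component \<open>i\<close> times derivative \<open>i\<close> of component \<open>j\<close>.
  Exchanging the derivatives turns their sum into the squared norm of the divergence, which is
  nonnegative. Hence the explicit constant 2.\<close>

theorem Korn:
  assumes v: "v \<in> H10_vec \<Omega>"
  shows "L2_inner \<Omega> (wjac \<Omega> v) (wjac \<Omega> v) \<le> 2 * L2_inner \<Omega> (strain \<Omega> v) (strain \<Omega> v)"
proof -
  define J where "J i j x = wjac \<Omega> v x $ i $ j" for i j x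
  define S where "S i j k l = L2_inner \<Omega> (J i j) (J k l)" for i j k l
  have v0: "(\<lambda>x. v x $ i) \<in> H10 \<Omega>" for i using v by (rule H10_vec_comp)
  then have v1: "(\<lambda>x. v x $ i) \<in> H1 \<Omega>" for i by (rule H10_H1)
  have J: "J i j \<in> L2_fields \<Omega>" for i j
    unfolding J_def[abs_def] by (intro L2_fields_comp wjac_L2 v1)
  note wj = wjac_L2[of v, OF v1] and st = strain_L2[of v, OF v1]
  have jac: "L2_inner \<Omega> (wjac \<Omega> v) (wjac \<Omega> v) = (\<Sum>i\<in>UNIV. \<Sum>j\<in>UNIV. S i j i j)"
    by (simp add: L2_inner_vec wj L2_fields_comp S_def J_def[abs_def])
  have comp: "L2_inner \<Omega> (\<lambda>x. strain \<Omega> v x $ i $ j) (\<lambda>x. strain \<Omega> v x $ i $ j)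
    = (S i j i j + 2 * S i j j i + S j i j i) / 4" for i j
  proof -
    have "(\<lambda>x. strain \<Omega> v x $ i $ j) = (\<lambda>x. (1 / 2) *\<^sub>R J i j x + (1 / 2) *\<^sub>R J j i x)"
      by (simp add: strain_nth J_def add_divide_distrib)
    then show ?thesis
      using L2s.square_lincomb[OF J[of i j] J[of j i], of "1 / 2" "1 / 2"]
      by (simp add: S_def power2_eq_square field_simps)
  qed
  have "L2_inner \<Omega> (strain \<Omega> v) (strain \<Omega> v)
    = (\<Sum>i\<in>UNIV. \<Sum>j\<in>UNIV. (S i j i j + 2 * S i j j i + S j i j i) / 4)"
    by (simp only: L2_inner_vec[OF st st] L2_inner_vec[OF L2_fields_comp[OF st] L2_fields_comp[OF st]] comp)
  also have "\<dots> = ((\<Sum>i\<in>UNIV. \<Sum>j\<in>UNIV. S i j i j) + 2 * (\<Sum>i\<in>UNIV. \<Sum>j\<in>UNIV. S i j j i)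
      + (\<Sum>i\<in>UNIV. \<Sum>j\<in>UNIV. S j i j i)) / 4"
    by (simp add: sum.distrib sum_distrib_left sum_divide_distrib add_divide_distrib)
  also have "(\<Sum>i\<in>UNIV. \<Sum>j\<in>UNIV. S j i j i) = (\<Sum>i\<in>UNIV. \<Sum>j\<in>UNIV. S i j i j)"
    by (rule sum.swap)
  finally have str: "2 * L2_inner \<Omega> (strain \<Omega> v) (strain \<Omega> v)
    = (\<Sum>i\<in>UNIV. \<Sum>j\<in>UNIV. S i j i j) + (\<Sum>i\<in>UNIV. \<Sum>j\<in>UNIV. S i j j i)"
    by simp
  have "S i j j i = S i i j j" for i j
    using grad_swap[OF v0 v0, of i j j i] by (simp add: S_def J_def[abs_def] wjac_def)
  then have "(\<Sum>i\<in>UNIV. \<Sum>j\<in>UNIV. S i j j i) = (\<Sum>i\<in>UNIV. \<Sum>j\<in>UNIV. S i i j j)" by simp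
  also have "\<dots> = L2_inner \<Omega> (wdiv \<Omega> v) (wdiv \<Omega> v)"
    using L2_inner_integrable[OF J J]
    by (simp add: L2_inner_def wdiv_eq S_def J_def[abs_def] sum_product)
  also have "\<dots> \<ge> 0" by (intro L2s.nonneg wdiv_L2 v1)
  finally show ?thesis using jac str by simp
qed

text \<open>The divergence is the trace of the strain, so Cauchy-Schwarz on the diagonal gives the
  dimension as constant. This matches the term \<open>2 * \<mu> / d\<close> in the bulk
  modulus.\<close>

lemma wdiv_le_strain:
  assumes "\<And>i. (\<lambda>x. v x $ i) \<in> H1 \<Omega>"
  shows "L2_inner \<Omega> (wdiv \<Omega> v) (wdiv \<Omega> v)
    \<le> real CARD('d) * L2_inner \<Omega> (strain \<Omega> v) (strain \<Omega> v)"
proof -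
  have "L2_inner \<Omega> (wdiv \<Omega> v) (wdiv \<Omega> v)
    \<le> (LINT x | lebesgue_on \<Omega>. real CARD('d) * (strain \<Omega> v x \<bullet> strain \<Omega> v x))"
    unfolding L2_inner_def
  proof (rule integral_mono)
    show "integrable (lebesgue_on \<Omega>) (\<lambda>x. wdiv \<Omega> v x \<bullet> wdiv \<Omega> v x)"
      by (intro L2_inner_integrable wdiv_L2 assms)
    show "integrable (lebesgue_on \<Omega>) (\<lambda>x. real CARD('d) * (strain \<Omega> v x \<bullet> strain \<Omega> v x))"
      by (intro integrable_mult_right L2_inner_integrable strain_L2 assms)
    fix x
    have "wdiv \<Omega> v x = (\<Sum>i\<in>UNIV. strain \<Omega> v x $ i $ i)"
      by (simp add: wdiv_eq strain_nth)
    then have "(wdiv \<Omega> v x)\<^sup>2 \<le> (\<Sum>i\<in>(UNIV :: 'd set). 1\<^sup>2) * (\<Sum>i\<in>UNIV. (strain \<Omega> v x $ i $ i)\<^sup>2)"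
      using Cauchy_Schwarz_ineq_sum[of "\<lambda>i. 1" "\<lambda>i. strain \<Omega> v x $ i $ i" UNIV] by simp
    also have "(\<Sum>i\<in>UNIV. (strain \<Omega> v x $ i $ i)\<^sup>2) \<le> (\<Sum>i\<in>UNIV. \<Sum>j\<in>UNIV. (strain \<Omega> v x $ i $ j)\<^sup>2)"
      by (intro sum_mono member_le_sum) auto
    finally show "wdiv \<Omega> v x \<bullet> wdiv \<Omega> v x \<le> real CARD('d) * (strain \<Omega> v x \<bullet> strain \<Omega> v x)"
      by (simp add: inner_vec_def power2_eq_square mult_left_mono)
  qed
  then show ?thesis by (simp add: L2_inner_def)
qed

end

section \<open>Convergence of the fixed-stress splitting for abstract forms\<close>

text \<open>In the application \<open>h\<close>, \<open>g\<close> and \<open>a\<close> are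
  \<open>H\<close> at the error, \<open>G\<close> at the error and \<open>G\<close> at the
  increment. The hypothesis \<open>quad\<close> says that \<open>G\<close> is nonnegative along the
  line through successive errors, with the error equation already inserted in the mixed term; it
  plays the part of Cauchy-Schwarz without square roots.\<close>

lemma energy_descent_tendsto_0:
  fixes h g a :: "nat \<Rightarrow> real"
  assumes k: "0 < k" and desc: "\<And>i. k * a i \<le> h i - h (Suc i)"
    and coer: "\<And>i. k * g i \<le> h i" "\<And>i. 0 \<le> h i" "\<And>i. 0 \<le> a i"
    and quad: "\<And>i c. 0 \<le> g i - 2 * c * h i + c\<^sup>2 * a i"
  shows "h \<longlonglongrightarrow> 0"
proof -
  have "h (Suc i) \<le> h i" for i
    using desc[of i] mult_nonneg_nonneg[of k "a i"] k coer(3)[of i] by linarith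
  then obtain l where l: "h \<longlonglongrightarrow> l"
    using decseq_convergent[of h 0] coer(2) decseq_SucI by metis
  have "(\<lambda>i. (h i - h (Suc i)) / k\<^sup>2) \<longlonglongrightarrow> (l - l) / k\<^sup>2"
    by (intro tendsto_intros l LIMSEQ_Suc) (use k in simp)
  then have lim: "(\<lambda>i. (h i - h (Suc i)) / k\<^sup>2) \<longlonglongrightarrow> 0" by simp
  have "h i \<le> (h i - h (Suc i)) / k\<^sup>2" for i
  proof -
    \<comment> \<open>The value \<open>c = 1 / k\<close> turns the coercivity
      \<open>k * g i \<le> h i\<close> into \<open>k * h i \<le> a i\<close>; with the descent
      hypothesis a fixed fraction of \<open>h i\<close> is lost in every step.\<close>
    have "0 \<le> k\<^sup>2 * (g i - 2 * (1 / k) * h i + (1 / k)\<^sup>2 * a i)"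
      using quad[of i "1 / k"] by (intro mult_nonneg_nonneg) auto
    also have "\<dots> = k * (k * g i) - 2 * k * h i + a i"
      using k by (simp add: field_simps power2_eq_square)
    also have "\<dots> \<le> k * h i - 2 * k * h i + a i"
      using mult_left_mono[OF coer(1)[of i], of k] k by simp
    finally have "k * (k * h i) \<le> k * a i"
      using k by (intro mult_left_mono) auto
    then have "k\<^sup>2 * h i \<le> h i - h (Suc i)" using desc[of i] by (simp add: power2_eq_square)
    then show ?thesis using k by (simp add: field_simps)
  qed
  then show ?thesis
    by (intro tendsto_sandwich[OF _ _ tendsto_const lim]) (auto simp: coer(2))
qed

text \<open>The equations are tested only with the errors themselves, which is all that the energy
  argument uses. The same \<open>\<gamma>\<close> in both equations makes \<open>H\<close>
  symmetric. The weight 1/4 in \<open>b_le\<close> lets the pressure and the temperature coupling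
  together use up half of the elastic energy.\<close>

lemma fixed_stress_tendsto_0:
  fixes P Q :: "nat \<Rightarrow> 'a \<Rightarrow> real" and U :: "nat \<Rightarrow> 'b \<Rightarrow> 'c::real_vector"
  assumes m: "sym_form X m" and rP: "sym_form X rP" and rQ: "sym_form X rQ" and A: "sym_form Y A"
    and b_diff: "\<And>f g v. f \<in> X \<Longrightarrow> g \<in> X \<Longrightarrow> v \<in> Y \<Longrightarrow> b (\<lambda>x. f x - g x) v = b f v - b g v"
      "\<And>f u v. f \<in> X \<Longrightarrow> u \<in> Y \<Longrightarrow> v \<in> Y \<Longrightarrow> b f (\<lambda>x. u x - v x) = b f u - b f v"
    and b_le: "\<And>f v c. f \<in> X \<Longrightarrow> v \<in> Y \<Longrightarrow> c * b f v \<le> c\<^sup>2 * m f f / \<kappa> + A v v / 4"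
    and mem: "\<And>i. P i \<in> X" "\<And>i. Q i \<in> X" "\<And>i. U i \<in> Y"
    and coeff: "0 \<le> \<gamma>" "\<gamma> < cP" "\<gamma> < cQ" "0 < \<kappa>" "1 \<le> L"
    and eqP: "\<And>i j. cP * m (P (Suc i)) (P j) + rP (P (Suc i)) (P j)
        + L * \<alpha>\<^sup>2 / \<kappa> * (m (P (Suc i)) (P j) - m (P i) (P j)) = - \<alpha> * b (P j) (U i) + \<gamma> * m (Q i) (P j)"
    and eqQ: "\<And>i j. cQ * m (Q (Suc i)) (Q j) + rQ (Q (Suc i)) (Q j)
        + L * \<beta>\<^sup>2 / \<kappa> * (m (Q (Suc i)) (Q j) - m (Q i) (Q j)) = - \<beta> * b (Q j) (U i) + \<gamma> * m (P i) (Q j)"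
    and eqU: "\<And>i j. A (U i) (U j) = \<alpha> * b (P i) (U j) + \<beta> * b (Q i) (U j)"
  shows "(\<lambda>i. m (P i) (P i)) \<longlonglongrightarrow> 0" "(\<lambda>i. m (Q i) (Q i)) \<longlonglongrightarrow> 0" "(\<lambda>i. A (U i) (U i)) \<longlonglongrightarrow> 0"
proof -
  interpret m: sym_form X m by fact
  interpret rP: sym_form X rP by fact
  interpret rQ: sym_form X rQ by fact
  interpret A: sym_form Y A by fact
  define tP tQ where "tP = L * \<alpha>\<^sup>2 / \<kappa>" and "tQ = L * \<beta>\<^sup>2 / \<kappa>"
  define g where "g f q = (cP + tP) * m f f + (cQ + tQ) * m q q + rP f f + rQ q q" for f q
  define h where "h f q v = cP * m f f + cQ * m q q + rP f f + rQ q q + A v v - 2 * \<gamma> * m f q" for f q v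
  \<comment> \<open>The largest common factor that serves all terms: 1 for the diffusion forms, and
    for each mass form the ratio of what survives the cross term to the full mass with
    stabilisation.\<close>
  define k where "k = min 1 (min ((cP - \<gamma>) / (cP + tP)) ((cQ - \<gamma>) / (cQ + tQ)))"
  have t: "0 \<le> tP" "0 \<le> tQ" using coeff by (auto simp: tP_def tQ_def)
  have pos: "0 < cP + tP" "0 < cQ + tQ" using t coeff by linarith+
  have k: "0 < k" "k \<le> 1" using pos coeff by (auto simp: k_def)
  have kP: "k * (cP + tP) \<le> cP - \<gamma>" and kQ: "k * (cQ + tQ) \<le> cQ - \<gamma>"
    unfolding pos_le_divide_eq[OF pos(1), symmetric] pos_le_divide_eq[OF pos(2), symmetric]
    by (simp_all add: k_def min_le_iff_disj)
  \<comment> \<open>Stated for any triple obeying the displacement constraint \<open>Av\<close>,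
    because it is needed both for the errors and for their increments.\<close>
  have coercive: "k * g f q \<le> h f q v" "k * g f q \<le> 2 * g f q - h f q v"
    "(cP - \<gamma>) * m f f \<le> h f q v" "(cQ - \<gamma>) * m q q \<le> h f q v" "A v v \<le> h f q v"
    if f: "f \<in> X" and q: "q \<in> X" and v: "v \<in> Y" and Av: "A v v = \<alpha> * b f v + \<beta> * b q v" for f q v
  proof -
    have nn: "0 \<le> m f f" "0 \<le> m q q" "0 \<le> rP f f" "0 \<le> rQ q q" "0 \<le> A v v"
      using f q v m.nonneg rP.nonneg rQ.nonneg A.nonneg by auto
    have cross: "2 * \<gamma> * m f q \<le> \<gamma> * m f f + \<gamma> * m q q" "- (\<gamma> * m f f + \<gamma> * m q q) \<le> 2 * \<gamma> * m f q"
    proof -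
      have "\<gamma> * (2 * \<bar>m f q\<bar>) \<le> \<gamma> * (m f f + m q q)"
        using m.two_mult_le[OF f q] coeff(1) by (rule mult_left_mono)
      moreover have "\<gamma> * \<bar>m f q\<bar> = \<bar>\<gamma> * m f q\<bar>" using coeff(1) by (simp add: abs_mult)
      ultimately show "2 * \<gamma> * m f q \<le> \<gamma> * m f f + \<gamma> * m q q"
        "- (\<gamma> * m f f + \<gamma> * m q q) \<le> 2 * \<gamma> * m f q"
        by (simp_all add: distrib_left)
    qed
    have "A v v / 2 \<le> \<alpha>\<^sup>2 * m f f / \<kappa> + \<beta>\<^sup>2 * m q q / \<kappa>"
      using b_le[OF f v, of \<alpha>] b_le[OF q v, of \<beta>] Av by linarith
    also have "\<dots> \<le> tP * m f f + tQ * m q q"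
    proof -
      have "1 * (\<alpha>\<^sup>2 * m f f / \<kappa>) \<le> L * (\<alpha>\<^sup>2 * m f f / \<kappa>)" "1 * (\<beta>\<^sup>2 * m q q / \<kappa>) \<le> L * (\<beta>\<^sup>2 * m q q / \<kappa>)"
        by (rule mult_right_mono; use coeff nn in simp)+
      then show ?thesis by (simp add: tP_def tQ_def)
    qed
    \<comment> \<open>This is where \<open>1 \<le> L\<close> enters: in
      \<open>2 * g f q - h f q v\<close> the stabilisation occurs as \<open>2 * tP\<close> and
      \<open>2 * tQ\<close>, exactly enough to pay for \<open>A v v\<close>.\<close>
    finally have Ale: "A v v \<le> 2 * tP * m f f + 2 * tQ * m q q" by simp
    have kr: "k * rP f f \<le> rP f f" "k * rQ q q \<le> rQ q q"
      using nn k by (auto intro: mult_left_le_one_le)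
    have kg: "k * g f q \<le> (cP - \<gamma>) * m f f + (cQ - \<gamma>) * m q q + rP f f + rQ q q"
    proof -
      have "k * g f q = k * (cP + tP) * m f f + k * (cQ + tQ) * m q q + k * rP f f + k * rQ q q"
        by (simp add: g_def algebra_simps)
      then show ?thesis
        using mult_right_mono[OF kP nn(1)] mult_right_mono[OF kQ nn(2)] kr by linarith
    qed
    show "k * g f q \<le> h f q v"
      using kg cross nn by (simp add: h_def left_diff_distrib)
    show "k * g f q \<le> 2 * g f q - h f q v"
      using kg cross nn Ale by (simp add: h_def g_def left_diff_distrib distrib_right distrib_left)
    have "0 \<le> (cP - \<gamma>) * m f f" "0 \<le> (cQ - \<gamma>) * m q q" using coeff nn by auto
    then show "(cP - \<gamma>) * m f f \<le> h f q v" "(cQ - \<gamma>) * m q q \<le> h f q v" "A v v \<le> h f q v"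
      using cross nn by (simp_all add: h_def left_diff_distrib)
  qed
  define G where "G i j = (cP + tP) * m (P i) (P j) + (cQ + tQ) * m (Q i) (Q j)
    + rP (P i) (P j) + rQ (Q i) (Q j)" for i j
  define H where "H i j = cP * m (P i) (P j) + cQ * m (Q i) (Q j) + rP (P i) (P j) + rQ (Q i) (Q j)
    + A (U i) (U j) - \<gamma> * (m (Q i) (P j) + m (P i) (Q j))" for i j
  have sm: "m (P i) (P j) = m (P j) (P i)" "m (Q i) (Q j) = m (Q j) (Q i)" "m (Q i) (P j) = m (P j) (Q i)"
    "rP (P i) (P j) = rP (P j) (P i)" "rQ (Q i) (Q j) = rQ (Q j) (Q i)" "A (U i) (U j) = A (U j) (U i)"
    for i j
    by (intro m.sym rP.sym rQ.sym A.sym mem)+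
  \<comment> \<open>The coupling terms of both equations carry the test index \<open>j\<close> on
    pressure and temperature and \<open>i\<close> on the displacement. The constraint
    \<open>eqU\<close> with these indices exchanged collects them into \<open>A (U j) (U i)\<close>,
    which removes \<open>b\<close> altogether.\<close>
  have rel: "G (Suc i) j - G i j = - H i j" for i j
    using eqP[of i j] eqQ[of i j] eqU[of j i] sm(6)[of i j]
    by (simp add: G_def H_def tP_def[symmetric] tQ_def[symmetric] algebra_simps)
  have Gsym: "G i j = G j i" for i j
    using sm(1)[of i j] sm(2)[of i j] sm(4)[of i j] sm(5)[of i j] by (simp add: G_def)
  define dP dQ where "dP i x = P (Suc i) x - P i x" and "dQ i x = Q (Suc i) x - Q i x" for i x
  define dU where "dU i x = U (Suc i) x - U i x" for i x
  have dmem: "dP i \<in> X" "dQ i \<in> X" "dU i \<in> Y" for i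
    unfolding dP_def[abs_def] dQ_def[abs_def] dU_def[abs_def]
    by (intro m.diff_mem A.diff_mem mem)+
  \<comment> \<open>The constraint is known for every pair of indices, and both sides are additive
    in each argument, so it passes to increments.\<close>
  have dA: "A (dU i) (dU i) = \<alpha> * b (dP i) (dU i) + \<beta> * b (dQ i) (dU i)" for i
  proof -
    have bd: "b (dP i) (dU i) = b (P (Suc i)) (U (Suc i)) - b (P (Suc i)) (U i) - b (P i) (U (Suc i)) + b (P i) (U i)"
      "b (dQ i) (dU i) = b (Q (Suc i)) (U (Suc i)) - b (Q (Suc i)) (U i) - b (Q i) (U (Suc i)) + b (Q i) (U i)"
      using dmem mem unfolding dP_def[abs_def] dQ_def[abs_def] dU_def[abs_def] by (simp_all add: b_diff)
    have Ad: "A (dU i) (dU i) = A (U (Suc i)) (U (Suc i)) - A (U (Suc i)) (U i) - A (U i) (U (Suc i)) + A (U i) (U i)"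
      unfolding dU_def[abs_def] using A.square_diff[OF mem(3) mem(3)] sm(6)[of i "Suc i"] by simp
    show ?thesis unfolding bd Ad eqU by (simp add: algebra_simps)
  qed
  have gd: "g (dP i) (dQ i) = G (Suc i) (Suc i) - 2 * G i (Suc i) + G i i" for i
    unfolding dP_def[abs_def] dQ_def[abs_def] g_def
      m.square_diff[OF mem(1) mem(1)] m.square_diff[OF mem(2) mem(2)]
      rP.square_diff[OF mem(1) mem(1)] rQ.square_diff[OF mem(2) mem(2)]
    using sm(1)[of "Suc i" i] sm(2)[of "Suc i" i] sm(4)[of "Suc i" i] sm(5)[of "Suc i" i]
    by (simp add: G_def algebra_simps)
  have hd: "h (dP i) (dQ i) (dU i) = H (Suc i) (Suc i) - 2 * H i (Suc i) + H i i" for i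
  proof -
    have md: "m (dP i) (dQ i) = m (P (Suc i)) (Q (Suc i)) - m (P (Suc i)) (Q i) - m (P i) (Q (Suc i)) + m (P i) (Q i)"
      unfolding dP_def[abs_def] dQ_def[abs_def] using mem
      by (simp add: m.diff_left m.diff_right m.diff_mem)
    show ?thesis
      unfolding h_def md
      unfolding dP_def[abs_def] dQ_def[abs_def] dU_def[abs_def]
        m.square_diff[OF mem(1) mem(1)] m.square_diff[OF mem(2) mem(2)]
        rP.square_diff[OF mem(1) mem(1)] rQ.square_diff[OF mem(2) mem(2)] A.square_diff[OF mem(3) mem(3)]
      using sm(1)[of "Suc i" i] sm(2)[of "Suc i" i] sm(4)[of "Suc i" i] sm(5)[of "Suc i" i]
        sm(6)[of "Suc i" i] sm(3)[of i "Suc i"] sm(3)[of "Suc i" i] sm(3)[of i i] sm(3)[of "Suc i" "Suc i"]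
      by (simp add: H_def algebra_simps)
  qed
  have hH: "h (P i) (Q i) (U i) = H i i" for i
    using sm(3)[of i i] by (simp add: h_def H_def)
  note coer = coercive[OF mem eqU]
  have "(\<lambda>i. H i i) \<longlonglongrightarrow> 0"
  proof (rule energy_descent_tendsto_0[where k = k and g = "\<lambda>i. G i i" and a = "\<lambda>i. g (dP i) (dQ i)"])
    fix i
    show "0 < k" by (rule k)
    have "k * g (dP i) (dQ i) \<le> 2 * g (dP i) (dQ i) - h (dP i) (dQ i) (dU i)"
      by (rule coercive(2)[OF dmem dA])
    \<comment> \<open>The energy identity needs the error equation tested at \<open>i\<close> and at
      \<open>Suc i\<close>, that is, with the increment as test function.\<close>
    then show "k * g (dP i) (dQ i) \<le> H i i - H (Suc i) (Suc i)"
      unfolding gd hd using rel[of i i] rel[of i "Suc i"] Gsym[of "Suc i" i] by (simp add: algebra_simps)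
    have gG: "g (P i) (Q i) = G i i" by (simp add: g_def G_def)
    show "k * G i i \<le> H i i"
      using coer(1)[of i] unfolding hH gG .
    have "0 \<le> A (U i) (U i)" by (rule A.nonneg[OF mem(3)])
    then show "0 \<le> H i i" using coer(5)[of i] unfolding hH by linarith
    show "0 \<le> g (dP i) (dQ i)"
      unfolding g_def using dmem pos by (simp add: m.nonneg rP.nonneg rQ.nonneg)
    fix c :: real
    have gen: "0 \<le> (1 - c)\<^sup>2 * B f f + 2 * (1 - c) * c * B f f' + c\<^sup>2 * B f' f'"
      if "sym_form X B" "f \<in> X" "f' \<in> X" for B and f f' :: "'a \<Rightarrow> real"
      using sym_form.nonneg[OF that(1) sym_form.lincomb[OF that, of "1 - c" c]]
        sym_form.square_lincomb[OF that, of "1 - c" c] by simp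
    \<comment> \<open>This is \<open>G\<close> at the affine combination of the errors
      \<open>i\<close> and \<open>Suc i\<close> with weights \<open>1 - c\<close> and
      \<open>c\<close>, written summand by summand since pressure and temperature parts are separate
      functions.\<close>
    have "0 \<le> (cP + tP) * ((1 - c)\<^sup>2 * m (P i) (P i) + 2 * (1 - c) * c * m (P i) (P (Suc i)) + c\<^sup>2 * m (P (Suc i)) (P (Suc i)))
      + (cQ + tQ) * ((1 - c)\<^sup>2 * m (Q i) (Q i) + 2 * (1 - c) * c * m (Q i) (Q (Suc i)) + c\<^sup>2 * m (Q (Suc i)) (Q (Suc i)))
      + ((1 - c)\<^sup>2 * rP (P i) (P i) + 2 * (1 - c) * c * rP (P i) (P (Suc i)) + c\<^sup>2 * rP (P (Suc i)) (P (Suc i)))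
      + ((1 - c)\<^sup>2 * rQ (Q i) (Q i) + 2 * (1 - c) * c * rQ (Q i) (Q (Suc i)) + c\<^sup>2 * rQ (Q (Suc i)) (Q (Suc i)))"
      using pos by (intro add_nonneg_nonneg mult_nonneg_nonneg[OF less_imp_le] gen m rP rQ mem)
    also have "\<dots> = (1 - c)\<^sup>2 * G i i + 2 * (1 - c) * c * G i (Suc i) + c\<^sup>2 * G (Suc i) (Suc i)"
      unfolding G_def by (simp only: distrib_left ac_simps)
    also have "\<dots> = G i i + 2 * c * (G (Suc i) i - G i i) + c\<^sup>2 * g (dP i) (dQ i)"
      unfolding gd Gsym[of "Suc i" i] by (simp add: power2_eq_square algebra_simps)
    finally show "0 \<le> G i i - 2 * c * H i i + c\<^sup>2 * g (dP i) (dQ i)"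
      unfolding rel by simp
  qed
  note lim = this
  have "(\<lambda>i. H i i / (cP - \<gamma>)) \<longlonglongrightarrow> 0" "(\<lambda>i. H i i / (cQ - \<gamma>)) \<longlonglongrightarrow> 0"
    by (rule tendsto_divide_zero[OF lim])+
  note lims = this
  show "(\<lambda>i. m (P i) (P i)) \<longlonglongrightarrow> 0"
  proof (rule tendsto_sandwich[OF _ _ tendsto_const lims(1)])
    show "\<forall>\<^sub>F i in sequentially. m (P i) (P i) \<le> H i i / (cP - \<gamma>)"
      using coer(3) coeff unfolding hH by (simp add: le_divide_eq mult.commute)
  qed (simp add: m.nonneg mem)
  show "(\<lambda>i. m (Q i) (Q i)) \<longlonglongrightarrow> 0"
  proof (rule tendsto_sandwich[OF _ _ tendsto_const lims(2)])
    show "\<forall>\<^sub>F i in sequentially. m (Q i) (Q i) \<le> H i i / (cQ - \<gamma>)"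
      using coer(4) coeff unfolding hH by (simp add: le_divide_eq mult.commute)
  qed (simp add: m.nonneg mem)
  show "(\<lambda>i. A (U i) (U i)) \<longlonglongrightarrow> 0"
  proof (rule tendsto_sandwich[OF _ _ tendsto_const lim])
    show "\<forall>\<^sub>F i in sequentially. A (U i) (U i) \<le> H i i"
      using coer(5) unfolding hH by simp
  qed (simp add: A.nonneg mem)
qed

section \<open>The bilinear forms of thermo-poroelasticity\<close>

text \<open>The ellipticity bounds concern only the quadratic form; symmetry and positivity upgrade
  the upper one to a bound on the operator norm, without diagonalisation. It is what makes fluxes
  square integrable.\<close>

lemma elliptic_tensor_norm_le:
  assumes A: "elliptic_tensor \<Omega> A amin amax" and x: "x \<in> \<Omega>"
  shows "(norm (A x *v \<xi>))\<^sup>2 \<le> amax\<^sup>2 * (norm \<xi>)\<^sup>2"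
proof -
  let ?q = "\<lambda>\<zeta>. \<zeta> \<bullet> (A x *v \<zeta>)"
  have pos: "0 < amin" "0 < amax" and upper: "?q \<zeta> \<le> amax * (\<zeta> \<bullet> \<zeta>)"
    and lower: "amin * (\<zeta> \<bullet> \<zeta>) \<le> ?q \<zeta>" and sym: "transpose (A x) = A x" for \<zeta>
    using A x by (auto simp: elliptic_tensor_def)
  have adj: "(A x *v \<xi>) \<bullet> \<zeta> = \<xi> \<bullet> (A x *v \<zeta>)" for \<xi> \<zeta>
    by (metis dot_lmul_matrix transpose_matrix_vector sym)
  let ?y = "A x *v \<xi>"
  \<comment> \<open>Evaluate the nonnegative quadratic form at \<open>amax \<xi> - A \<xi>\<close>.\<close>
  have "0 \<le> ?q (amax *\<^sub>R \<xi> - ?y)"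
    using lower[of "amax *\<^sub>R \<xi> - ?y"] pos
    by (meson inner_ge_zero less_imp_le mult_nonneg_nonneg order_trans)
  also have "\<dots> = amax\<^sup>2 * ?q \<xi> - 2 * amax * (?y \<bullet> ?y) + ?q ?y"
    using adj[of \<xi> ?y]
    by (simp add: matrix_vector_mult_diff_distrib matrix_vector_mult_scaleR inner_diff_left inner_diff_right
        power2_eq_square algebra_simps inner_commute)
  also have "\<dots> \<le> amax\<^sup>2 * (amax * (\<xi> \<bullet> \<xi>)) - 2 * amax * (?y \<bullet> ?y) + amax * (?y \<bullet> ?y)"
    using upper[of \<xi>] upper[of ?y] pos by (intro add_mono diff_mono mult_left_mono) auto
  also have "\<dots> = amax * (amax\<^sup>2 * (\<xi> \<bullet> \<xi>) - ?y \<bullet> ?y)"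
    by (simp add: power2_eq_square algebra_simps)
  finally show ?thesis using pos by (simp add: zero_le_mult_iff dot_square_norm)
qed

context bounded_open_set
begin

lemma tensor_L2:
  assumes A: "elliptic_tensor \<Omega> A amin amax" and F: "F \<in> L2_fields \<Omega>"
  shows "(\<lambda>x. A x *v F x) \<in> L2_fields \<Omega>"
proof (rule L2_fields_dominated)
  have "A \<in> borel_measurable (lebesgue_on \<Omega>)" using A by (simp add: elliptic_tensor_def)
  then have meas: "(\<lambda>x. A x $ i $ j) \<in> borel_measurable (lebesgue_on \<Omega>)" for i j
    by (rule measurable_compose) (intro borel_measurable_continuous_onI continuous_intros)
  show "(\<lambda>x. A x *v F x) \<in> borel_measurable (lebesgue_on \<Omega>)"
    using meas L2_fieldsD(1)[OF L2_fields_comp[OF F]]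
    by (intro borel_measurable_vec) (simp add: matrix_vector_mult_def)
  show "integrable (lebesgue_on \<Omega>) (\<lambda>x. amax\<^sup>2 * (norm (F x))\<^sup>2)"
    using L2_fieldsD(2)[OF F] by simp
qed (rule elliptic_tensor_norm_le[OF A])

lemma sym_form_diffusion:
  assumes A: "elliptic_tensor \<Omega> A amin amax"
  shows "sym_form (H1 \<Omega>) (\<lambda>f g. L2_inner \<Omega> (\<lambda>x. A x *v wgrad \<Omega> f x) (wgrad \<Omega> g))"
proof
  show "(\<lambda>x. a *\<^sub>R f x + b *\<^sub>R g x) \<in> H1 \<Omega>" if "f \<in> H1 \<Omega>" "g \<in> H1 \<Omega>" for f g a b
    using that by (rule H1_lincomb)
  have sp: "x \<in> space (lebesgue_on \<Omega>) \<Longrightarrow> x \<in> \<Omega>" for x by (simp add: space_restrict_space)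
  note AL2 = tensor_L2[OF A wgrad_L2]
  show "L2_inner \<Omega> (\<lambda>x. A x *v wgrad \<Omega> f x) (wgrad \<Omega> g) = L2_inner \<Omega> (\<lambda>x. A x *v wgrad \<Omega> g x) (wgrad \<Omega> f)"
    for f g
    unfolding L2_inner_def
  proof (rule Bochner_Integration.integral_cong[OF refl])
    fix x assume "x \<in> space (lebesgue_on \<Omega>)"
    then have "transpose (A x) = A x" using A sp by (auto simp: elliptic_tensor_def)
    then show "(A x *v wgrad \<Omega> f x) \<bullet> wgrad \<Omega> g x = (A x *v wgrad \<Omega> g x) \<bullet> wgrad \<Omega> f x"
      by (metis dot_lmul_matrix transpose_matrix_vector inner_commute)
  qed
  show "0 \<le> L2_inner \<Omega> (\<lambda>x. A x *v wgrad \<Omega> f x) (wgrad \<Omega> f)" for f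
    unfolding L2_inner_def
  proof (rule Bochner_Integration.integral_nonneg)
    fix x assume "x \<in> space (lebesgue_on \<Omega>)"
    then have "0 < amin" "amin * (wgrad \<Omega> f x \<bullet> wgrad \<Omega> f x) \<le> wgrad \<Omega> f x \<bullet> (A x *v wgrad \<Omega> f x)"
      using A sp by (auto simp: elliptic_tensor_def)
    then show "0 \<le> (A x *v wgrad \<Omega> f x) \<bullet> wgrad \<Omega> f x"
      by (simp add: inner_commute order_trans[rotated])
  qed
  fix f g h a b assume H: "f \<in> H1 \<Omega>" "g \<in> H1 \<Omega>" "h \<in> H1 \<Omega>"
  have "L2_inner \<Omega> (\<lambda>x. A x *v wgrad \<Omega> (\<lambda>x. a *\<^sub>R f x + b *\<^sub>R g x) x) (wgrad \<Omega> h)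
    = L2_inner \<Omega> (\<lambda>x. a *\<^sub>R (A x *v wgrad \<Omega> f x) + b *\<^sub>R (A x *v wgrad \<Omega> g x)) (wgrad \<Omega> h)"
  proof (rule L2_inner_cong_AE)
    show "AE x in lebesgue_on \<Omega>. A x *v wgrad \<Omega> (\<lambda>x. a *\<^sub>R f x + b *\<^sub>R g x) x
      = a *\<^sub>R (A x *v wgrad \<Omega> f x) + b *\<^sub>R (A x *v wgrad \<Omega> g x)"
      using wgrad_lincomb[OF H(1,2), of a b]
      by eventually_elim (simp add: matrix_vector_right_distrib matrix_vector_mult_scaleR)
  qed (intro AL2 wgrad_L2 H1_lincomb L2v.lincomb H AE_I2 refl)+
  also have "\<dots> = a * L2_inner \<Omega> (\<lambda>x. A x *v wgrad \<Omega> f x) (wgrad \<Omega> h)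
      + b * L2_inner \<Omega> (\<lambda>x. A x *v wgrad \<Omega> g x) (wgrad \<Omega> h)"
    by (intro L2v.lin AL2 wgrad_L2 H)
  finally show "L2_inner \<Omega> (\<lambda>x. A x *v wgrad \<Omega> (\<lambda>x. a *\<^sub>R f x + b *\<^sub>R g x) x) (wgrad \<Omega> h)
    = a * L2_inner \<Omega> (\<lambda>x. A x *v wgrad \<Omega> f x) (wgrad \<Omega> h)
      + b * L2_inner \<Omega> (\<lambda>x. A x *v wgrad \<Omega> g x) (wgrad \<Omega> h)" .
qed

section \<open>The elastic form and its control of the coupling and of the displacement norm\<close>

definition H1_vec :: "(real ^ 'd \<Rightarrow> real ^ 'd) set" where
  "H1_vec = {v. \<forall>i. (\<lambda>x. v x $ i) \<in> H1 \<Omega>}"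

lemma H1_vec_comp: "v \<in> H1_vec \<Longrightarrow> (\<lambda>x. v x $ i) \<in> H1 \<Omega>"
  by (simp add: H1_vec_def)

lemma H10_vec_subset: "H10_vec \<Omega> \<subseteq> H1_vec"
  using H10_H1 by (auto simp: H1_vec_def H10_vec_def)

lemma H1_vec_lincomb:
  assumes "u \<in> H1_vec" "v \<in> H1_vec"
  shows "(\<lambda>x. a *\<^sub>R u x + b *\<^sub>R v x) \<in> H1_vec"
  using H1_lincomb[OF H1_vec_comp[OF assms(1)] H1_vec_comp[OF assms(2)]] by (simp add: H1_vec_def)

lemma wjac_lincomb:
  assumes "u \<in> H1_vec" "v \<in> H1_vec"
  shows "AE x in lebesgue_on \<Omega>. wjac \<Omega> (\<lambda>x. a *\<^sub>R u x + b *\<^sub>R v x) x = a *\<^sub>R wjac \<Omega> u x + b *\<^sub>R wjac \<Omega> v x"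
proof -
  have "AE x in lebesgue_on \<Omega>. \<forall>i\<in>UNIV. wgrad \<Omega> (\<lambda>y. a *\<^sub>R u y $ i + b *\<^sub>R v y $ i) x
    = a *\<^sub>R wgrad \<Omega> (\<lambda>y. u y $ i) x + b *\<^sub>R wgrad \<Omega> (\<lambda>y. v y $ i) x"
    using assms by (intro AE_ball_countable' wgrad_lincomb H1_vec_comp) auto
  then show ?thesis
    by eventually_elim (simp add: vec_eq_iff wjac_def)
qed

lemma strain_lincomb:
  assumes "u \<in> H1_vec" "v \<in> H1_vec"
  shows "AE x in lebesgue_on \<Omega>. strain \<Omega> (\<lambda>x. a *\<^sub>R u x + b *\<^sub>R v x) x = a *\<^sub>R strain \<Omega> u x + b *\<^sub>R strain \<Omega> v x"
  using wjac_lincomb[OF assms, of a b]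
  by eventually_elim (simp add: vec_eq_iff strain_nth field_simps)

lemma wdiv_lincomb:
  assumes "u \<in> H1_vec" "v \<in> H1_vec"
  shows "AE x in lebesgue_on \<Omega>. wdiv \<Omega> (\<lambda>x. a *\<^sub>R u x + b *\<^sub>R v x) x = a *\<^sub>R wdiv \<Omega> u x + b *\<^sub>R wdiv \<Omega> v x"
  using wjac_lincomb[OF assms, of a b]
  by eventually_elim (simp add: wdiv_eq sum.distrib sum_distrib_left)

lemma wdiv_H1_vec_L2: "v \<in> H1_vec \<Longrightarrow> wdiv \<Omega> v \<in> L2_fields \<Omega>"
  by (intro wdiv_L2 H1_vec_comp)

lemma sym_form_elastic:
  assumes "0 \<le> \<mu>" "0 \<le> lam"
  shows "sym_form H1_vec (\<lambda>u v. 2 * \<mu> * L2_inner \<Omega> (strain \<Omega> u) (strain \<Omega> v)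
    + lam * L2_inner \<Omega> (wdiv \<Omega> u) (wdiv \<Omega> v))"
  using assms
  by (intro sym_form_scaled_add sym_form_pullback[OF H1_vec_lincomb strain_L2[OF H1_vec_comp] strain_lincomb]
      sym_form_pullback[OF H1_vec_lincomb wdiv_H1_vec_L2 wdiv_lincomb]) auto

lemma wdiv_lincomb_inner:
  assumes "f \<in> L2_fields \<Omega>" "u \<in> H1_vec" "v \<in> H1_vec"
  shows "L2_inner \<Omega> f (wdiv \<Omega> (\<lambda>x. a *\<^sub>R u x + b *\<^sub>R v x))
    = a * L2_inner \<Omega> f (wdiv \<Omega> u) + b * L2_inner \<Omega> f (wdiv \<Omega> v)"
proof -
  have "L2_inner \<Omega> f (wdiv \<Omega> (\<lambda>x. a *\<^sub>R u x + b *\<^sub>R v x))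
    = L2_inner \<Omega> f (\<lambda>x. a *\<^sub>R wdiv \<Omega> u x + b *\<^sub>R wdiv \<Omega> v x)"
    using assms by (intro L2_inner_cong_AE wdiv_lincomb wdiv_H1_vec_L2 H1_vec_lincomb L2s.lincomb) auto
  also have "\<dots> = a * L2_inner \<Omega> f (wdiv \<Omega> u) + b * L2_inner \<Omega> f (wdiv \<Omega> v)"
    by (intro L2s.lin_right wdiv_H1_vec_L2 assms)
  finally show ?thesis .
qed

text \<open>Writing \<open>\<kappa>\<close> as \<open>lam + 2 * \<mu> / d\<close> and using the
  trace bound shows that \<open>\<kappa>\<close> times the squared divergence norm is at most the
  elastic energy. Completing the square at \<open>c f - (\<kappa> / 2) div v\<close> does the rest;
  so the bulk modulus is the natural weight for the stabilisation.\<close>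

lemma coupling_le_elastic:
  assumes f: "f \<in> L2_fields \<Omega>" and v: "v \<in> H1_vec" and "0 < \<mu>" "0 \<le> lam"
    and \<kappa>: "\<kappa> = (real CARD('d) * lam + 2 * \<mu>) / real CARD('d)"
  shows "c * L2_inner \<Omega> f (wdiv \<Omega> v) \<le> c\<^sup>2 * L2_inner \<Omega> f f / \<kappa>
    + (2 * \<mu> * L2_inner \<Omega> (strain \<Omega> v) (strain \<Omega> v) + lam * L2_inner \<Omega> (wdiv \<Omega> v) (wdiv \<Omega> v)) / 4"
proof -
  let ?d = "wdiv \<Omega> v" and ?n = "real CARD('d)"
  have n: "0 < ?n" by simp
  have \<kappa>': "\<kappa> = lam + 2 * \<mu> / ?n" unfolding \<kappa> by (simp add: add_divide_distrib)
  then have pos: "0 < \<kappa>" using assms(3,4) n by (simp add: add_nonneg_pos)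
  have d: "?d \<in> L2_fields \<Omega>" by (rule wdiv_H1_vec_L2[OF v])
  have "2 * \<mu> / ?n * L2_inner \<Omega> ?d ?d \<le> 2 * \<mu> / ?n * (?n * L2_inner \<Omega> (strain \<Omega> v) (strain \<Omega> v))"
    using assms(3) by (intro mult_left_mono wdiv_le_strain H1_vec_comp v) auto
  then have le: "\<kappa> * L2_inner \<Omega> ?d ?d
    \<le> 2 * \<mu> * L2_inner \<Omega> (strain \<Omega> v) (strain \<Omega> v) + lam * L2_inner \<Omega> ?d ?d"
    using n by (simp add: \<kappa>' distrib_right)
  have "0 \<le> (c\<^sup>2 * L2_inner \<Omega> f f - c * \<kappa> * L2_inner \<Omega> f ?d + \<kappa>\<^sup>2 / 4 * L2_inner \<Omega> ?d ?d) / \<kappa>"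
    using L2s.nonneg[OF L2s.lincomb[OF f d, of c "- \<kappa> / 2"]] L2s.square_lincomb[OF f d, of c "- \<kappa> / 2"] pos
    by (simp add: power2_eq_square)
  also have "\<dots> = c\<^sup>2 * L2_inner \<Omega> f f / \<kappa> - c * L2_inner \<Omega> f ?d + \<kappa> * L2_inner \<Omega> ?d ?d / 4"
    using pos by (simp add: field_simps power2_eq_square)
  finally have "c * L2_inner \<Omega> f ?d \<le> c\<^sup>2 * L2_inner \<Omega> f f / \<kappa> + \<kappa> * L2_inner \<Omega> ?d ?d / 4"
    by (simp only: diff_add_eq le_diff_eq add_0)
  also have "\<dots> \<le> c\<^sup>2 * L2_inner \<Omega> f f / \<kappa> + (2 * \<mu> * L2_inner \<Omega> (strain \<Omega> v) (strain \<Omega> v)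
      + lam * L2_inner \<Omega> ?d ?d) / 4"
    by (intro add_left_mono divide_right_mono le) simp
  finally show ?thesis .
qed

text \<open>Poincare componentwise gives the factor \<open>C\<close>, the gradient itself adds 1,
  and Korn's factor 2 cancels against \<open>2 * \<mu>\<close>.\<close>

lemma H1_norm_vec_le_elastic:
  assumes "0 < \<mu>" "0 \<le> lam"
  obtains C where "\<And>v. v \<in> H10_vec \<Omega> \<Longrightarrow> (H1_norm_vec \<Omega> v)\<^sup>2
    \<le> C * (2 * \<mu> * L2_inner \<Omega> (strain \<Omega> v) (strain \<Omega> v) + lam * L2_inner \<Omega> (wdiv \<Omega> v) (wdiv \<Omega> v))"
proof -
  obtain C where C: "0 \<le> C" "\<And>f. f \<in> H10 \<Omega> \<Longrightarrow>
    L2_inner \<Omega> f f \<le> C * L2_inner \<Omega> (wgrad \<Omega> f) (wgrad \<Omega> f)"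
    by (rule Poincare) blast
  have "(H1_norm_vec \<Omega> v)\<^sup>2 \<le> (C + 1) / \<mu>
    * (2 * \<mu> * L2_inner \<Omega> (strain \<Omega> v) (strain \<Omega> v) + lam * L2_inner \<Omega> (wdiv \<Omega> v) (wdiv \<Omega> v))"
    if v: "v \<in> H10_vec \<Omega>" for v
  proof -
    have v1: "v \<in> H1_vec" using v H10_vec_subset by blast
    have L2: "v \<in> L2_fields \<Omega>" "wjac \<Omega> v \<in> L2_fields \<Omega>" "wdiv \<Omega> v \<in> L2_fields \<Omega>"
      using H1_vec_comp[OF v1] by (auto intro: L2_fields_vec H1_L2 wjac_L2 wdiv_L2)
    have nn: "0 \<le> L2_inner \<Omega> v v" "0 \<le> L2_inner \<Omega> (wjac \<Omega> v) (wjac \<Omega> v)" "0 \<le> L2_inner \<Omega> (wdiv \<Omega> v) (wdiv \<Omega> v)"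
      using sym_form.nonneg[OF sym_form_L2 L2(1)] sym_form.nonneg[OF sym_form_L2 L2(2)]
        sym_form.nonneg[OF sym_form_L2 L2(3)] by auto
    have "L2_inner \<Omega> v v \<le> (\<Sum>i\<in>UNIV. C * L2_inner \<Omega> (wgrad \<Omega> (\<lambda>x. v x $ i)) (wgrad \<Omega> (\<lambda>x. v x $ i)))"
      unfolding L2_inner_vec[OF L2(1) L2(1)] by (intro sum_mono C(2) H10_vec_comp v)
    also have "\<dots> = C * L2_inner \<Omega> (wjac \<Omega> v) (wjac \<Omega> v)"
      unfolding L2_inner_vec[OF L2(2) L2(2)] by (simp add: wjac_def sum_distrib_left)
    finally have "(H1_norm_vec \<Omega> v)\<^sup>2 \<le> (C + 1) * L2_inner \<Omega> (wjac \<Omega> v) (wjac \<Omega> v)"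
      using nn by (simp add: H1_norm_vec_def L2_norm_def distrib_right)
    also have "\<dots> \<le> (C + 1) * (2 * L2_inner \<Omega> (strain \<Omega> v) (strain \<Omega> v))"
      using C(1) by (intro mult_left_mono Korn v) auto
    also have "\<dots> = (C + 1) / \<mu> * (2 * \<mu> * L2_inner \<Omega> (strain \<Omega> v) (strain \<Omega> v))"
      using assms by simp
    also have "\<dots> \<le> (C + 1) / \<mu>
      * (2 * \<mu> * L2_inner \<Omega> (strain \<Omega> v) (strain \<Omega> v) + lam * L2_inner \<Omega> (wdiv \<Omega> v) (wdiv \<Omega> v))"
      using assms C(1) nn by (intro mult_left_mono) auto
    finally show ?thesis .
  qed
  then show thesis by (rule that)
qed

end

section \<open>Error equations of the discrete schemes and convergence\<close>

lemma fin_dim_fun_space_diff: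
  assumes S: "fin_dim_fun_space S" and "f \<in> S" "g \<in> S"
  shows "(\<lambda>x. f x - g x) \<in> S"
proof -
  obtain B where B: "S = {f. \<exists>c. f = (\<lambda>x. \<Sum>b\<in>B. c b *\<^sub>R b x)}"
    using S unfolding fin_dim_fun_space_def by blast
  then obtain c c' where "f = (\<lambda>x. \<Sum>b\<in>B. c b *\<^sub>R b x)" "g = (\<lambda>x. \<Sum>b\<in>B. c' b *\<^sub>R b x)"
    using assms(2,3) by blast
  then have "(\<lambda>x. f x - g x) = (\<lambda>x. \<Sum>b\<in>B. (c b - c' b) *\<^sub>R b x)"
    by (simp add: sum_subtractf scaleR_left_diff_distrib)
  then show ?thesis using B by (auto intro!: exI[of _ "\<lambda>b. c b - c' b"])
qed

lemma (in bounded_open_set) L2_inner_difference_quotient: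
  fixes f g w :: "real ^ 'd \<Rightarrow> real"
  assumes "f \<in> L2_fields \<Omega>" "g \<in> L2_fields \<Omega>" "w \<in> L2_fields \<Omega>"
  shows "L2_inner \<Omega> (\<lambda>x. (f x - g x) / dt) w = (L2_inner \<Omega> f w - L2_inner \<Omega> g w) / dt"
  using L2s.lin[OF assms, of "1 / dt" "- 1 / dt"] by (simp add: diff_divide_distrib)

text \<open>The fixed-stress steps take the divergence of a displacement quotient, the monolithic
  ones the quotient of divergences. As \<open>wdiv\<close> is linear only almost everywhere, the two
  are identified under the inner product.\<close>

lemma (in bounded_open_set) wdiv_difference_quotient:
  assumes "u \<in> H1_vec" "v \<in> H1_vec" "w \<in> L2_fields \<Omega>"
  shows "L2_inner \<Omega> (wdiv \<Omega> (\<lambda>x. (u x - v x) /\<^sub>R dt)) w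
    = (L2_inner \<Omega> (wdiv \<Omega> u) w - L2_inner \<Omega> (wdiv \<Omega> v) w) / dt"
proof -
  have "(\<lambda>x. (u x - v x) /\<^sub>R dt) = (\<lambda>x. (1 / dt) *\<^sub>R u x + (- 1 / dt) *\<^sub>R v x)"
    by (simp add: scaleR_diff_right inverse_eq_divide)
  then have "(\<lambda>x. (u x - v x) /\<^sub>R dt) \<in> H1_vec"
    "L2_inner \<Omega> w (wdiv \<Omega> (\<lambda>x. (u x - v x) /\<^sub>R dt))
      = (L2_inner \<Omega> w (wdiv \<Omega> u) - L2_inner \<Omega> w (wdiv \<Omega> v)) / dt"
    using H1_vec_lincomb[OF assms(1,2), of "1 / dt" "- 1 / dt"] wdiv_lincomb_inner[OF assms(3,1,2), of "1 / dt" "- 1 / dt"]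
    by (simp_all add: diff_divide_distrib)
  then show ?thesis
    using assms by (simp add: L2s.sym[OF wdiv_H1_vec_L2 assms(3)])
qed

text \<open>Subtracting the monolithic equation from an iteration step cancels the source
  \<open>l\<close> and the data \<open>o0\<close>, \<open>d0\<close>, \<open>q0\<close> of the
  previous time level. The stabilisation involves iterates only, so it survives as a difference of
  iterates. Pressure and temperature share this form.\<close>

lemma euler_step_error:
  fixes dt :: real
  assumes "0 < dt"
    and "c * ((y' - o0) / dt) + e' + \<tau> * ((y' - y) / dt) = l - a * ((d - d0) / dt) + b * ((q - q0) / dt)"
    and "c * ((ys - o0) / dt) + a * ((ds - d0) / dt) - b * ((qs - q0) / dt) + es = l"
  shows "c * (y' - ys) + dt * (e' - es) + \<tau> * (y' - y) = - a * (d - ds) + b * (q - qs)"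
proof -
  have cancel: "dt * (k * (z / dt)) = k * z" for k z using assms(1) by simp
  have "dt * (c * ((y' - o0) / dt) + e' + \<tau> * ((y' - y) / dt))
    = dt * (l - a * ((d - d0) / dt) + b * ((q - q0) / dt))"
    "dt * (c * ((ys - o0) / dt) + a * ((ds - d0) / dt) - b * ((qs - q0) / dt) + es) = dt * l"
    by (simp_all only: assms)
  then have "c * (y' - o0) + dt * e' + \<tau> * (y' - y) = dt * l - a * (d - d0) + b * (q - q0)"
    "c * (ys - o0) + a * (ds - d0) - b * (qs - q0) + dt * es = dt * l"
    by (simp_all only: distrib_left[of dt] right_diff_distrib[of dt] cancel)
  then show ?thesis by (simp add: algebra_simps)
qed

theorem theorem3p1:
  fixes \<Omega> :: "(real ^ 'd) set"
    and \<mu> \<mu>0 \<mu>1 lam Kdr \<alpha> M c0 \<alpha>T \<alpha>m Cd \<theta>0 L \<delta> :: real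
    and K D :: "real ^ 'd \<Rightarrow> real ^ 'd ^ 'd"
    and kmin kmax dmin dmax :: real
    and dt T :: real and t :: "nat \<Rightarrow> real" and N n :: nat
    and f :: "real \<Rightarrow> real ^ 'd \<Rightarrow> real ^ 'd"
    and g \<eta> :: "real \<Rightarrow> real ^ 'd \<Rightarrow> real"
    and Vh :: "(real ^ 'd \<Rightarrow> real ^ 'd) set"
    and Wh Th :: "(real ^ 'd \<Rightarrow> real) set"
    and u :: "nat \<Rightarrow> real ^ 'd \<Rightarrow> real ^ 'd"
    and p \<theta> :: "nat \<Rightarrow> real ^ 'd \<Rightarrow> real"
    and ufs :: "nat \<Rightarrow> real ^ 'd \<Rightarrow> real ^ 'd"
    and pfs \<theta>fs :: "nat \<Rightarrow> real ^ 'd \<Rightarrow> real"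
  assumes dim: "CARD('d) = 2 \<or> CARD('d) = 3"
    and domain: "bounded_lipschitz_domain \<Omega>"
    \<comment> \<open>parameters\<close>
    and lame: "0 < \<mu>0" "\<mu>0 \<le> \<mu>" "\<mu> \<le> \<mu>1" "0 \<le> lam"
    and Kdr: "Kdr = (real CARD('d) * lam + 2 * \<mu>) / real CARD('d)"
    and c0: "c0 = 1 / M"
    and physical: "0 \<le> \<alpha>m" "0 \<le> \<theta>0" "\<theta>0 \<noteq> 0"
    and tensors: "elliptic_tensor \<Omega> K kmin kmax" "elliptic_tensor \<Omega> D dmin dmax"
    and time: "0 < dt" "\<And>k. t k = real k * dt" "t N = T" "n < N"
    and sources: "f (t (Suc n)) \<in> L2_fields \<Omega>" "g (t (Suc n)) \<in> L2_fields \<Omega>"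
      "\<eta> (t (Suc n)) \<in> L2_fields \<Omega>"
    and spaces: "fin_dim_fun_space Vh" "Vh \<subseteq> H10_vec \<Omega>"
      "fin_dim_fun_space Wh" "Wh \<subseteq> H10 \<Omega>"
      "fin_dim_fun_space Th" "Th \<subseteq> H10 \<Omega>"
    \<comment> \<open>M-HF solution at step \<open>n + 1\<close>, given the state at step \<open>n\<close>\<close>
    and MHF_old: "u n \<in> Vh" "p n \<in> Wh" "\<theta> n \<in> Th"
    and MHF_new: "u (Suc n) \<in> Vh" "p (Suc n) \<in> Wh" "\<theta> (Suc n) \<in> Th"
    and MHF_u: "\<And>v. v \<in> Vh \<Longrightarrow>
        2 * \<mu> * L2_inner \<Omega> (strain \<Omega> (u (Suc n))) (strain \<Omega> v)
        + lam * L2_inner \<Omega> (wdiv \<Omega> (u (Suc n))) (wdiv \<Omega> v)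
        - \<alpha> * L2_inner \<Omega> (p (Suc n)) (wdiv \<Omega> v)
        - 3 * \<alpha>T * Kdr * L2_inner \<Omega> (\<theta> (Suc n)) (wdiv \<Omega> v)
        = L2_inner \<Omega> (f (t (Suc n))) v"
    and MHF_p: "\<And>w. w \<in> Wh \<Longrightarrow>
        c0 * L2_inner \<Omega> (\<lambda>x. (p (Suc n) x - p n x) / dt) w
        + \<alpha> * L2_inner \<Omega> (\<lambda>x. (wdiv \<Omega> (u (Suc n)) x - wdiv \<Omega> (u n) x) / dt) w
        - 3 * \<alpha>m * L2_inner \<Omega> (\<lambda>x. (\<theta> (Suc n) x - \<theta> n x) / dt) w
        + L2_inner \<Omega> (\<lambda>x. K x *v wgrad \<Omega> (p (Suc n)) x) (wgrad \<Omega> w)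
        = L2_inner \<Omega> (g (t (Suc n))) w"
    and MHF_\<theta>: "\<And>s. s \<in> Th \<Longrightarrow>
        Cd * L2_inner \<Omega> (\<lambda>x. (\<theta> (Suc n) x - \<theta> n x) / dt) s
        + 3 * \<alpha>T * Kdr * \<theta>0
            * L2_inner \<Omega> (\<lambda>x. (wdiv \<Omega> (u (Suc n)) x - wdiv \<Omega> (u n) x) / dt) s
        - 3 * \<alpha>m * \<theta>0 * L2_inner \<Omega> (\<lambda>x. (p (Suc n) x - p n x) / dt) s
        + L2_inner \<Omega> (\<lambda>x. D x *v wgrad \<Omega> (\<theta> (Suc n)) x) (wgrad \<Omega> s)
        = L2_inner \<Omega> (\<eta> (t (Suc n))) s"
    \<comment> \<open>FS-HF iterates at step \<open>n + 1\<close>\<close>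
    and FS_spaces: "\<And>i. ufs i \<in> Vh" "\<And>i. pfs i \<in> Wh" "\<And>i. \<theta>fs i \<in> Th"
    and FS_p: "\<And>i w. w \<in> Wh \<Longrightarrow>
        c0 * L2_inner \<Omega> (\<lambda>x. (pfs (Suc i) x - p n x) / dt) w
        + L2_inner \<Omega> (\<lambda>x. K x *v wgrad \<Omega> (pfs (Suc i)) x) (wgrad \<Omega> w)
        + L * (\<alpha>\<^sup>2 / Kdr) * L2_inner \<Omega> (\<lambda>x. (pfs (Suc i) x - pfs i x) / dt) w
        = L2_inner \<Omega> (g (t (Suc n))) w
        - \<alpha> * L2_inner \<Omega> (wdiv \<Omega> (\<lambda>x. (ufs i x - u n x) /\<^sub>R dt)) w
        + 3 * \<alpha>m * L2_inner \<Omega> (\<lambda>x. (\<theta>fs i x - \<theta> n x) / dt) w"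
    and FS_\<theta>: "\<And>i s. s \<in> Th \<Longrightarrow>
        Cd * L2_inner \<Omega> (\<lambda>x. (\<theta>fs (Suc i) x - \<theta> n x) / dt) s
        + L2_inner \<Omega> (\<lambda>x. D x *v wgrad \<Omega> (\<theta>fs (Suc i)) x) (wgrad \<Omega> s)
        + 9 * L * \<alpha>T\<^sup>2 * Kdr * \<theta>0 * L2_inner \<Omega> (\<lambda>x. (\<theta>fs (Suc i) x - \<theta>fs i x) / dt) s
        = L2_inner \<Omega> (\<eta> (t (Suc n))) s
        + 3 * \<alpha>m * \<theta>0 * L2_inner \<Omega> (\<lambda>x. (pfs i x - p n x) / dt) s
        - 3 * \<alpha>T * Kdr * \<theta>0 * L2_inner \<Omega> (wdiv \<Omega> (\<lambda>x. (ufs i x - u n x) /\<^sub>R dt)) s"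
    and FS_u: "\<And>i v. v \<in> Vh \<Longrightarrow>
        2 * \<mu> * L2_inner \<Omega> (strain \<Omega> (ufs (Suc i))) (strain \<Omega> v)
        + lam * L2_inner \<Omega> (wdiv \<Omega> (ufs (Suc i))) (wdiv \<Omega> v)
        = L2_inner \<Omega> (f (t (Suc n))) v
        + \<alpha> * L2_inner \<Omega> (pfs (Suc i)) (wdiv \<Omega> v)
        + 3 * \<alpha>T * Kdr * L2_inner \<Omega> (\<theta>fs (Suc i)) (wdiv \<Omega> v)"
    and FS_init: "ufs 0 = u n" "pfs 0 = p n" "\<theta>fs 0 = \<theta> n"
    \<comment> \<open>hypotheses of the theorem\<close>
    and coeffs: "c0 > 3 * \<alpha>m" "Cd > 3 * \<alpha>m * \<theta>0"
    and stab: "L > 0" "\<delta> \<ge> 1 / 2" "L \<ge> 2 * \<delta>"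
  shows "(\<lambda>i. H1_norm_vec \<Omega> (\<lambda>x. ufs i x - u (Suc n) x)) \<longlonglongrightarrow> 0
       \<and> (\<lambda>i. L2_norm \<Omega> (\<lambda>x. pfs i x - p (Suc n) x)) \<longlonglongrightarrow> 0
       \<and> (\<lambda>i. L2_norm \<Omega> (\<lambda>x. \<theta>fs i x - \<theta> (Suc n) x)) \<longlonglongrightarrow> 0"
proof -
  interpret bounded_open_set \<Omega>
    using domain by unfold_locales (auto simp: bounded_lipschitz_domain_def)
  have \<mu>: "0 < \<mu>" using lame by linarith
  have Kpos: "0 < Kdr"
    unfolding Kdr using \<mu> lame by (simp add: add_nonneg_pos)
  \<comment> \<open>Positivity keeps the signs when the temperature equation is divided by
    \<open>\<theta>0\<close>.\<close>
  have th: "0 < \<theta>0" using physical by simp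
  have H1: "w \<in> Wh \<Longrightarrow> w \<in> H1 \<Omega>" "s \<in> Th \<Longrightarrow> s \<in> H1 \<Omega>" "v \<in> Vh \<Longrightarrow> v \<in> H1_vec" for w s v
    using spaces H10_H1 H10_vec_subset by blast+
  note L2 = H1(1)[THEN H1_L2] H1(2)[THEN H1_L2] H1(3)[THEN wdiv_H1_vec_L2]
  define kf where "kf f g = L2_inner \<Omega> (\<lambda>x. K x *v wgrad \<Omega> f x) (wgrad \<Omega> g)" for f g
  define df where "df f g = L2_inner \<Omega> (\<lambda>x. D x *v wgrad \<Omega> f x) (wgrad \<Omega> g)" for f g
  define A where "A v w = 2 * \<mu> * L2_inner \<Omega> (strain \<Omega> v) (strain \<Omega> w)
    + lam * L2_inner \<Omega> (wdiv \<Omega> v) (wdiv \<Omega> w)" for v w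
  interpret kf: sym_form "H1 \<Omega>" kf
    unfolding kf_def[abs_def] by (rule sym_form_diffusion[OF tensors(1)])
  interpret df: sym_form "H1 \<Omega>" df
    unfolding df_def[abs_def] by (rule sym_form_diffusion[OF tensors(2)])
  interpret A: sym_form H1_vec A
    unfolding A_def[abs_def] using \<mu> lame by (intro sym_form_elastic) auto
  let ?m = "L2_inner \<Omega> :: (real ^ 'd \<Rightarrow> real) \<Rightarrow> _"
  \<comment> \<open>With this \<open>\<beta>\<close> the thermal stabilisation, divided by
    \<open>\<theta>0\<close>, becomes \<open>L * \<beta>\<^sup>2 / Kdr\<close>, the exact analogue
    of the pressure one.\<close>
  define \<beta> where "\<beta> = 3 * \<alpha>T * Kdr"
  define p' \<theta>' u' where "p' = p (Suc n)" and "\<theta>' = \<theta> (Suc n)" and "u' = u (Suc n)"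
  \<comment> \<open>Errors start at iterate 1: the initial displacement solves no mechanics step
    with the new load, so the displacement constraint may fail at iterate 0.\<close>
  define P where "P i x = pfs (Suc i) x - p' x" for i x
  define Q where "Q i x = \<theta>fs (Suc i) x - \<theta>' x" for i x
  define U where "U i x = ufs (Suc i) x - u' x" for i x
  have new: "p' \<in> Wh" "\<theta>' \<in> Th" "u' \<in> Vh"
    using MHF_new by (auto simp: p'_def \<theta>'_def u'_def)
  have P_Wh: "P i \<in> Wh" and Q_Th: "Q i \<in> Th" and U_Vh: "U i \<in> Vh" for i
    unfolding P_def[abs_def] Q_def[abs_def] U_def[abs_def]
    by (intro fin_dim_fun_space_diff spaces FS_spaces new)+
  have wdiv_diff: "L2_inner \<Omega> f (wdiv \<Omega> (\<lambda>x. v x - w x)) = L2_inner \<Omega> f (wdiv \<Omega> v) - L2_inner \<Omega> f (wdiv \<Omega> w)"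
    if "f \<in> L2_fields \<Omega>" "v \<in> H1_vec" "w \<in> H1_vec" for f v w
    using wdiv_lincomb_inner[OF that, of 1 "-1"] by simp
  note quot = L2_inner_difference_quotient wdiv_difference_quotient
  have P_step: "c0 * (?m (pfs (Suc i)) w - ?m p' w) + dt * (kf (pfs (Suc i)) w - kf p' w)
      + L * (\<alpha>\<^sup>2 / Kdr) * (?m (pfs (Suc i)) w - ?m (pfs i) w)
    = - \<alpha> * (?m (wdiv \<Omega> (ufs i)) w - ?m (wdiv \<Omega> u') w) + 3 * \<alpha>m * (?m (\<theta>fs i) w - ?m \<theta>' w)"
    if w: "w \<in> Wh" for i w
  proof -
    note fs = FS_p[OF w, of i, unfolded
        quot(1)[OF L2(1)[OF FS_spaces(2)] L2(1)[OF MHF_old(2)] L2(1)[OF w]]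
        quot(1)[OF L2(1)[OF FS_spaces(2)] L2(1)[OF FS_spaces(2)] L2(1)[OF w]]
        quot(1)[OF L2(2)[OF FS_spaces(3)] L2(2)[OF MHF_old(3)] L2(1)[OF w]]
        quot(2)[OF H1(3)[OF FS_spaces(1)] H1(3)[OF MHF_old(1)] L2(1)[OF w]], folded kf_def]
    note mono = MHF_p[OF w, folded p'_def \<theta>'_def u'_def, unfolded
        quot(1)[OF L2(1)[OF new(1)] L2(1)[OF MHF_old(2)] L2(1)[OF w]]
        quot(1)[OF L2(2)[OF new(2)] L2(2)[OF MHF_old(3)] L2(1)[OF w]]
        quot(1)[OF L2(3)[OF new(3)] L2(3)[OF MHF_old(1)] L2(1)[OF w]], folded kf_def]
    show ?thesis
      by (rule euler_step_error[OF time(1) _ mono]) (use fs in linarith)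
  qed
  have Q_step: "Cd * (?m (\<theta>fs (Suc i)) s - ?m \<theta>' s) + dt * (df (\<theta>fs (Suc i)) s - df \<theta>' s)
      + 9 * L * \<alpha>T\<^sup>2 * Kdr * \<theta>0 * (?m (\<theta>fs (Suc i)) s - ?m (\<theta>fs i) s)
    = - (3 * \<alpha>T * Kdr * \<theta>0) * (?m (wdiv \<Omega> (ufs i)) s - ?m (wdiv \<Omega> u') s)
      + 3 * \<alpha>m * \<theta>0 * (?m (pfs i) s - ?m p' s)"
    if s: "s \<in> Th" for i s
  proof -
    note fs = FS_\<theta>[OF s, of i, unfolded
        quot(1)[OF L2(1)[OF FS_spaces(2)] L2(1)[OF MHF_old(2)] L2(2)[OF s]]
        quot(1)[OF L2(2)[OF FS_spaces(3)] L2(2)[OF FS_spaces(3)] L2(2)[OF s]]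
        quot(1)[OF L2(2)[OF FS_spaces(3)] L2(2)[OF MHF_old(3)] L2(2)[OF s]]
        quot(2)[OF H1(3)[OF FS_spaces(1)] H1(3)[OF MHF_old(1)] L2(2)[OF s]], folded df_def]
    note mono = MHF_\<theta>[OF s, folded p'_def \<theta>'_def u'_def, unfolded
        quot(1)[OF L2(1)[OF new(1)] L2(1)[OF MHF_old(2)] L2(2)[OF s]]
        quot(1)[OF L2(2)[OF new(2)] L2(2)[OF MHF_old(3)] L2(2)[OF s]]
        quot(1)[OF L2(3)[OF new(3)] L2(3)[OF MHF_old(1)] L2(2)[OF s]], folded df_def]
    show ?thesis
      by (rule euler_step_error[OF time(1) _ mono]) (use fs in linarith)
  qed
  \<comment> \<open>In the last equation the arguments change places, since the schemes put the
    divergence first while the abstract coupling takes the scalar field first.\<close>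
  have form_diff: "?m (P i) w = ?m (pfs (Suc i)) w - ?m p' w" "kf (P i) f = kf (pfs (Suc i)) f - kf p' f"
    "?m (Q i) w = ?m (\<theta>fs (Suc i)) w - ?m \<theta>' w" "df (Q i) f = df (\<theta>fs (Suc i)) f - df \<theta>' f"
    "?m w (wdiv \<Omega> (U i)) = ?m (wdiv \<Omega> (ufs (Suc i))) w - ?m (wdiv \<Omega> u') w"
    if "w \<in> L2_fields \<Omega>" "f \<in> H1 \<Omega>" for i w f
    using that unfolding P_def[abs_def] Q_def[abs_def] U_def[abs_def]
    by (simp_all add: L2s.diff_left kf.diff_left df.diff_left wdiv_diff L2 H1 FS_spaces new
        L2s.sym[OF that(1) L2(3)])
  have conv: "(\<lambda>i. ?m (P i) (P i)) \<longlonglongrightarrow> 0" "(\<lambda>i. ?m (Q i) (Q i)) \<longlonglongrightarrow> 0" "(\<lambda>i. A (U i) (U i)) \<longlonglongrightarrow> 0"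
  proof -
    have eqP: "c0 * ?m (P (Suc i)) (P j) + dt * kf (P (Suc i)) (P j)
        + L * \<alpha>\<^sup>2 / Kdr * (?m (P (Suc i)) (P j) - ?m (P i) (P j))
      = - \<alpha> * ?m (P j) (wdiv \<Omega> (U i)) + 3 * \<alpha>m * ?m (Q i) (P j)" for i j
      using P_step[OF P_Wh[of j], of "Suc i"]
      by (simp add: form_diff[OF L2(1)[OF P_Wh] H1(1)[OF P_Wh]])
    \<comment> \<open>Division by \<open>\<theta>0\<close> gives the temperature equation the same
      \<open>3 * \<alpha>m\<close> as the pressure equation and the same coupling
      \<open>\<beta>\<close> as the mechanics step.\<close>
    have eqQ: "Cd / \<theta>0 * ?m (Q (Suc i)) (Q j) + dt / \<theta>0 * df (Q (Suc i)) (Q j)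
        + L * \<beta>\<^sup>2 / Kdr * (?m (Q (Suc i)) (Q j) - ?m (Q i) (Q j))
      = - \<beta> * ?m (Q j) (wdiv \<Omega> (U i)) + 3 * \<alpha>m * ?m (P i) (Q j)" for i j
    proof -
      have "Cd * ?m (Q (Suc i)) (Q j) + dt * df (Q (Suc i)) (Q j)
          + \<theta>0 * (9 * L * \<alpha>T\<^sup>2 * Kdr) * (?m (Q (Suc i)) (Q j) - ?m (Q i) (Q j))
        = \<theta>0 * (- \<beta> * ?m (Q j) (wdiv \<Omega> (U i)) + 3 * \<alpha>m * ?m (P i) (Q j))"
        using Q_step[OF Q_Th[of j], of "Suc i"]
        by (simp add: form_diff[OF L2(2)[OF Q_Th] H1(2)[OF Q_Th]] \<beta>_def algebra_simps)
      moreover have "L * \<beta>\<^sup>2 / Kdr = 9 * L * \<alpha>T\<^sup>2 * Kdr"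
        using Kpos by (simp add: \<beta>_def power2_eq_square)
      ultimately show ?thesis
        using th by (simp add: field_simps)
    qed
    have eqU: "A (U i) (U j) = \<alpha> * ?m (P i) (wdiv \<Omega> (U j)) + \<beta> * ?m (Q i) (wdiv \<Omega> (U j))" for i j
    proof -
      note d = L2(3)[OF U_Vh[of j]]
      have "A (ufs (Suc i)) (U j) - A u' (U j)
        = \<alpha> * (?m (pfs (Suc i)) (wdiv \<Omega> (U j)) - ?m p' (wdiv \<Omega> (U j)))
          + \<beta> * (?m (\<theta>fs (Suc i)) (wdiv \<Omega> (U j)) - ?m \<theta>' (wdiv \<Omega> (U j)))"
        using FS_u[OF U_Vh[of j], of i] MHF_u[OF U_Vh[of j], folded p'_def \<theta>'_def u'_def]
        unfolding A_def \<beta>_def by (simp add: algebra_simps)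
      moreover have "A (U i) (U j) = A (ufs (Suc i)) (U j) - A u' (U j)"
        unfolding U_def[of i, abs_def] by (intro A.diff_left H1 FS_spaces new U_Vh)
      ultimately show ?thesis
        unfolding P_def[of i, abs_def] Q_def[of i, abs_def]
        by (simp add: L2s.diff_left L2 FS_spaces new d)
    qed
    have scaled: "sym_form (H1 \<Omega>) (\<lambda>f g. r * B f g)" if "sym_form (H1 \<Omega>) B" "0 \<le> r" for r B
      using sym_form_scaled_add[OF that(1,1,2) order_refl] by simp
    have m: "sym_form (H1 \<Omega>) ?m"
      by (rule sym_form_pullback[where T = "\<lambda>f. f"]) (assumption | rule H1_lincomb H1_L2 AE_I2 refl)+
    have bd: "c * ?m f (wdiv \<Omega> v) \<le> c\<^sup>2 * ?m f f / Kdr + A v v / 4"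
      if "f \<in> H1 \<Omega>" "v \<in> H1_vec" for c f v
      unfolding A_def using coupling_le_elastic[OF H1_L2[OF that(1)] that(2) \<mu> lame(4) Kdr] .
    \<comment> \<open>\<open>L \<ge> 2 * \<delta>\<close> with \<open>\<delta> \<ge> 1 / 2\<close>
      gives \<open>1 \<le> L\<close>; the strict mass bounds are the hypotheses on \<open>c0\<close>
      and on \<open>Cd\<close> divided by \<open>\<theta>0\<close>.\<close>
    have coeff: "0 \<le> 3 * \<alpha>m" "3 * \<alpha>m < c0" "3 * \<alpha>m < Cd / \<theta>0" "0 < Kdr" "1 \<le> L"
      using physical coeffs stab Kpos th by (auto simp: less_divide_eq)
    note * = fixed_stress_tendsto_0[where m = ?m and b = "\<lambda>f v. ?m f (wdiv \<Omega> v)" and P = P and Q = Q and U = U,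
        OF m scaled[OF kf.sym_form_axioms] scaled[OF df.sym_form_axioms] A.sym_form_axioms
          L2s.diff_left[OF H1_L2 H1_L2 wdiv_H1_vec_L2] wdiv_diff[OF H1_L2] bd
          H1(1)[OF P_Wh] H1(2)[OF Q_Th] H1(3)[OF U_Vh] coeff eqP eqQ eqU]
    show "(\<lambda>i. ?m (P i) (P i)) \<longlonglongrightarrow> 0" "(\<lambda>i. ?m (Q i) (Q i)) \<longlonglongrightarrow> 0" "(\<lambda>i. A (U i) (U i)) \<longlonglongrightarrow> 0"
      by (rule *; use time(1) th in simp)+
  qed
  obtain C where C: "\<And>v. v \<in> H10_vec \<Omega> \<Longrightarrow> (H1_norm_vec \<Omega> v)\<^sup>2 \<le> C * A v v"
    unfolding A_def by (rule H1_norm_vec_le_elastic[OF \<mu> lame(4)]) blast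
  have "(\<lambda>i. (H1_norm_vec \<Omega> (U i))\<^sup>2) \<longlonglongrightarrow> 0"
    by (rule tendsto_sandwich[OF _ _ tendsto_const tendsto_mult_right_zero[OF conv(3), of C]])
      (use C[OF subsetD[OF spaces(2) U_Vh]] in auto)
  then have "(\<lambda>i. sqrt ((H1_norm_vec \<Omega> (U i))\<^sup>2)) \<longlonglongrightarrow> sqrt 0"
    by (rule tendsto_real_sqrt)
  then have limU: "(\<lambda>i. H1_norm_vec \<Omega> (U i)) \<longlonglongrightarrow> 0"
    by (simp add: tendsto_rabs_zero_iff)
  have lims: "(\<lambda>i. L2_norm \<Omega> (P i)) \<longlonglongrightarrow> 0" "(\<lambda>i. L2_norm \<Omega> (Q i)) \<longlonglongrightarrow> 0"
    using tendsto_real_sqrt[OF conv(1)] tendsto_real_sqrt[OF conv(2)] by (simp_all add: L2_norm_def)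
  show ?thesis
  proof (intro conjI)
    show "(\<lambda>i. H1_norm_vec \<Omega> (\<lambda>x. ufs i x - u (Suc n) x)) \<longlonglongrightarrow> 0"
      by (rule LIMSEQ_imp_Suc) (fact limU[unfolded U_def[abs_def] u'_def])
    show "(\<lambda>i. L2_norm \<Omega> (\<lambda>x. pfs i x - p (Suc n) x)) \<longlonglongrightarrow> 0"
      by (rule LIMSEQ_imp_Suc) (fact lims(1)[unfolded P_def[abs_def] p'_def])
    show "(\<lambda>i. L2_norm \<Omega> (\<lambda>x. \<theta>fs i x - \<theta> (Suc n) x)) \<longlonglongrightarrow> 0"
      by (rule LIMSEQ_imp_Suc) (fact lims(2)[unfolded Q_def[abs_def] \<theta>'_def])
  qed
qed


end
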